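(* Let $Y(A_4)$ be the Demazure model, described in the context, of the algebraic $k$-torus $T$ with Galois splitting field $L/k$ and with character lattice and splitting group $(\Lambda(A_4),\mathrm{Aut}(A_4))$. The fan of $Y(A_4)$ has $6$ $\mathrm{Aut}(A_4)$-orbits of rays, corresponding to the vectors $$s_{r,t}=s_{[1,r],[r+1,r+t]},\qquad 1\le r\le t,\ r+t\le 5,$$ and $3$ further $\mathrm{Aut}(A_4)$-orbits of rays, corresponding to \begin{itemize} \item $\mathbf{v}_1=(\mathbf{e}_1+2\mathbf{e}_2)-(\mathbf{e}_3+\mathbf{e}_4+\mathbf{e}_5)$, \item $\mathbf{v}_2=2(\mathbf{e}_1+\mathbf{e}_2)-2\mathbf{e}_3-(\mathbf{e}_4+\mathbf{e}_5)$, \item $\mathbf{v}_3=2\mathbf{e}_1+3\mathbf{e}_2-2(\mathbf{e}_3+\mathbf{e}_4)-\mathbf{e}_5$, \end{itemize} with stabilizer subgroups (up to isomorphism): \begin{itemize} \item $\mathrm{Stab}_{\mathrm{Aut}(A_4)}(s_{r,t})=S_r\times S_t\times S_{5-(r+t)}$ for $r<t$; \item $\mathrm{Stab}_{\mathrm{Aut}(A_4)}(s_{r,r})=[(S_r\times S_r)\rtimes S_2]\times S_{5-2r}$; \item $\mathrm{Stab}_{\mathrm{Aut}(A_4)}(\mathbf{v}_1)=S_3$; \item $\mathrm{Stab}_{\mathrm{Aut}(A_4)}(\mathbf{v}_2)=S_2\times S_2$; \item $\mathrm{Stab}_{\mathrm{Aut}(A_4)}(\mathbf{v}_3)=S_2$.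 \end{itemize} This determines an $\mathrm{Aut}(A_4)$-coflasque resolution of $\mathbb{Z}A_4$: writing $\Omega$ for the set of these $9$ representatives, the $\mathrm{Aut}(A_4)$-equivariant map $\bigoplus_{x\in\Omega}\mathbb{Z}[\mathrm{Aut}(A_4)/\mathrm{Stab}_{\mathrm{Aut}(A_4)}(x)]\to\mathbb{Z}A_4$ sending the coset $g\,\mathrm{Stab}(x)$ to $gx$ is surjective with coflasque kernel; and so by duality it determines an $\mathrm{Aut}(A_4)$-flasque resolution of $\Lambda(A_4)$.
   Context: $A_4=\{\mathbf{e}_i-\mathbf{e}_j:1\le i\ne j\le5\}$; $\mathbb{Z}A_4\subset\mathbb{Z}^5$ is the root lattice (coordinate sum $0$), $\Lambda(A_4)$ the weight lattice, which is the dual lattice of $\mathbb{Z}A_4$; $\mathrm{Aut}(A_4)$ is generated by $S_5$ and $-\mathrm{id}$. For disjoint nonempty $I,J\subseteq[1,5]$, $s_{I,J}=\dfrac{|J|\sum_{i\in I}\mathbf{e}_i-|I|\sum_{j\in J}\mathbf{e}_j}{\gcd(|I|,|J|)}$, and $[a,b]=\{m\in\mathbb{Z}:a\le m\le b\}$. $S_0$ and $S_1$ are trivial groups. A Demazure model of $T$ is a smooth projective toric $T_L$-variety whose fan (in $(\widehat{T_L})^0\otimes\mathbb{R}$) is invariant under $\mathrm{Gal}(L/k)$. The model $Y(A_4)$ is defined by the following $\mathrm{Aut}(A_4)$-invariant fan in $(\mathbb{Z}A_4)\otimes\mathbb{R}$. A minimal staircase path from $(i,i+1)$ to $(1,5)$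 is a sequence $((a_r,b_r))_{r=1}^4$ starting at $(i,i+1)$, ending at $(1,5)$, with steps $(a,b)\mapsto(a-1,b)$ or $(a,b)\mapsto(a,b+1)$; put $\gamma_C=\{s_{[a_r,i],[i+1,b_r]}:1\le r\le 4\}$. The simplicial fan $\Sigma^{\mathrm{simp}}_{A_4}$ has as maximal cones the $\mathrm{Aut}(A_4)$-translates of $\mathrm{Cone}(\gamma_C)$ for the paths $C=((1,2),(1,3),(1,4),(1,5))$, $C_1=((2,3),(2,4),(2,5),(1,5))$, $C_2=((2,3),(1,3),(1,4),(1,5))$, $C_3=((2,3),(2,4),(1,4),(1,5))$. The fan of $Y(A_4)$ is obtained by star-subdividing, $\mathrm{Aut}(A_4)$-equivariantly, $\mathrm{Cone}(\gamma_{C_i})$ with respect to $\mathbf{v}_i$ for $i=1,2,3$ (and their translates correspondingly); the star subdivision of $\sigma$ with respect to $\mathbf{v}\in\sigma$ replaces $\sigma$ by the cones $\mathrm{Cone}(\tau,\mathbf{v})$, $\tau$ a face of $\sigma$ not containing $\mathbf{v}$. A $G$-lattice $F$ is coflasque if $H^1(H,F)=0$ for all subgroups $H\le G$, and flasque if its dual $F^0=\mathrm{Hom}(F,\mathbb{Z})$ is coflasque. A coflasque resolution of $N$ is an exact sequence of $G$-lattices $0\to F\to P\to N\to0$ with $P$ permutation and $F$ coflasque; a flasque resolution of $M$ is an exact sequence $0\to M\to P\to F\to0$ with $P$ permutation and $F$ flasque. *)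

theory Defs
  imports
    "HOL-Analysis.Analysis"
    "HOL-Algebra.Algebra"
    "HOL-Algebra.Left_Coset"
    "HOL-Algebra.Free_Abelian_Groups"
    "HOL-Algebra.Product_Groups"
begin

section \<open>Lattices with a group action\<close>

text \<open>
  A module over the integral group ring of a group \<open>G\<close> is an abelian group (written
  multiplicatively, as everywhere in HOL-Algebra) together with the action map.
\<close>

record ('g, 'm) gmodule = "'m monoid" +
  act :: "'g \<Rightarrow> 'm \<Rightarrow> 'm"

definition with_act :: "('m, 'b) monoid_scheme \<Rightarrow> ('g \<Rightarrow> 'm \<Rightarrow> 'm) \<Rightarrow> ('g, 'm) gmodule" where
  "with_act M a = \<lparr>carrier = carrier M, monoid.mult = monoid.mult M, one = one M, act = a\<rparr>"

definition lattice_basis :: "('m, 'b) monoid_scheme \<Rightarrow> 'm set \<Rightarrow> bool" where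
  "lattice_basis M B \<longleftrightarrow> finite B \<and> B \<subseteq> carrier M \<and>
     (\<forall>x\<in>carrier M. \<exists>!c. c \<in> B \<rightarrow>\<^sub>E (UNIV :: int set) \<and>
        x = finprod M (\<lambda>b. b [^]\<^bsub>M\<^esub> c b) B)"

definition is_G_lattice :: "('g, 'a) monoid_scheme \<Rightarrow> ('g, 'm) gmodule \<Rightarrow> bool" where
  "is_G_lattice G M \<longleftrightarrow> group G \<and> comm_group M \<and> (\<exists>B. lattice_basis M B) \<and>
     (\<forall>g\<in>carrier G. act M g \<in> hom M M) \<and>
     (\<forall>x\<in>carrier M. act M \<one>\<^bsub>G\<^esub> x = x) \<and>
     (\<forall>g\<in>carrier G. \<forall>h\<in>carrier G. \<forall>x\<in>carrier M.
        act M (g \<otimes>\<^bsub>G\<^esub> h) x = act M g (act M h x))"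

definition permutation_lattice :: "('g, 'a) monoid_scheme \<Rightarrow> ('g, 'm) gmodule \<Rightarrow> bool" where
  "permutation_lattice G M \<longleftrightarrow> is_G_lattice G M \<and>
     (\<exists>B. lattice_basis M B \<and> (\<forall>g\<in>carrier G. act M g ` B = B))"

text \<open>\<open>H\<^sup>1(H, M)\<close> as crossed homomorphisms modulo principal ones.\<close>

definition cocycle_group ::
    "('g, 'a) monoid_scheme \<Rightarrow> 'g set \<Rightarrow> ('g, 'm) gmodule \<Rightarrow> ('g \<Rightarrow> 'm) monoid" where
  "cocycle_group G H M =
     \<lparr>carrier = {f \<in> H \<rightarrow>\<^sub>E carrier M. \<forall>g\<in>H. \<forall>h\<in>H.
                  f (g \<otimes>\<^bsub>G\<^esub> h) = f g \<otimes>\<^bsub>M\<^esub> act M g (f h)},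
      monoid.mult = (\<lambda>f f'. \<lambda>g\<in>H. f g \<otimes>\<^bsub>M\<^esub> f' g),
      one = (\<lambda>g\<in>H. \<one>\<^bsub>M\<^esub>)\<rparr>"

definition coboundaries :: "'g set \<Rightarrow> ('g, 'm) gmodule \<Rightarrow> ('g \<Rightarrow> 'm) set" where
  "coboundaries H M = (\<lambda>m. \<lambda>g\<in>H. act M g m \<otimes>\<^bsub>M\<^esub> inv\<^bsub>M\<^esub> m) ` carrier M"

definition H1 ::
    "('g, 'a) monoid_scheme \<Rightarrow> 'g set \<Rightarrow> ('g, 'm) gmodule \<Rightarrow> ('g \<Rightarrow> 'm) set monoid" where
  "H1 G H M = cocycle_group G H M Mod coboundaries H M"

definition dual_lattice ::
    "('g, 'a) monoid_scheme \<Rightarrow> ('g, 'm) gmodule \<Rightarrow> ('g, 'm \<Rightarrow> int) gmodule" where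
  "dual_lattice G M =
     \<lparr>carrier = hom M integer_group \<inter> extensional (carrier M),
      monoid.mult = (\<lambda>f f'. \<lambda>x\<in>carrier M. f x + f' x),
      one = (\<lambda>x\<in>carrier M. 0),
      act = (\<lambda>g f. \<lambda>x\<in>carrier M. f (act M (inv\<^bsub>G\<^esub> g) x))\<rparr>"

definition coflasque :: "('g, 'a) monoid_scheme \<Rightarrow> ('g, 'm) gmodule \<Rightarrow> bool" where
  "coflasque G F \<longleftrightarrow> is_G_lattice G F \<and> (\<forall>H. subgroup H G \<longrightarrow> trivial_group (H1 G H F))"

definition flasque :: "('g, 'a) monoid_scheme \<Rightarrow> ('g, 'm) gmodule \<Rightarrow> bool" where
  "flasque G F \<longleftrightarrow> is_G_lattice G F \<and> coflasque G (dual_lattice G F)"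

definition equivariant_hom ::
    "('g, 'a) monoid_scheme \<Rightarrow> ('g, 'm) gmodule \<Rightarrow> ('g, 'n) gmodule \<Rightarrow> ('m \<Rightarrow> 'n) set" where
  "equivariant_hom G M N =
     {f \<in> hom M N. \<forall>g\<in>carrier G. \<forall>x\<in>carrier M. f (act M g x) = act N g (f x)}"

text \<open>
  The library's short exact sequences force all terms to have the same element type, hence the
  following version.
\<close>

definition exact_lattices ::
    "('g, 'a) monoid_scheme \<Rightarrow> ('g, 'm) gmodule \<Rightarrow> ('m \<Rightarrow> 'n) \<Rightarrow> ('g, 'n) gmodule
       \<Rightarrow> ('n \<Rightarrow> 'p) \<Rightarrow> ('g, 'p) gmodule \<Rightarrow> bool" where
  "exact_lattices G A f B h C \<longleftrightarrow>
     is_G_lattice G A \<and> is_G_lattice G B \<and> is_G_lattice G C \<and>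
     f \<in> equivariant_hom G A B \<and> h \<in> equivariant_hom G B C \<and>
     inj_on f (carrier A) \<and> f ` carrier A = kernel B C h \<and> h ` carrier B = carrier C"

definition coflasque_resolution ::
    "('g, 'a) monoid_scheme \<Rightarrow> ('g, 'm) gmodule \<Rightarrow> ('m \<Rightarrow> 'n) \<Rightarrow> ('g, 'n) gmodule
       \<Rightarrow> ('n \<Rightarrow> 'p) \<Rightarrow> ('g, 'p) gmodule \<Rightarrow> bool" where
  "coflasque_resolution G F \<iota> P \<pi> N \<longleftrightarrow>
     exact_lattices G F \<iota> P \<pi> N \<and> permutation_lattice G P \<and> coflasque G F"

definition flasque_resolution ::
    "('g, 'a) monoid_scheme \<Rightarrow> ('g, 'm) gmodule \<Rightarrow> ('m \<Rightarrow> 'n) \<Rightarrow> ('g, 'n) gmodule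
       \<Rightarrow> ('n \<Rightarrow> 'p) \<Rightarrow> ('g, 'p) gmodule \<Rightarrow> bool" where
  "flasque_resolution G M \<iota> P \<pi> F \<longleftrightarrow>
     exact_lattices G M \<iota> P \<pi> F \<and> permutation_lattice G P \<and> flasque G F"

text \<open>The lattice \<open>\<int>[G/H]\<close> on the left cosets of \<open>H\<close>, and direct sums.\<close>

definition coset_lattice ::
    "('g, 'a) monoid_scheme \<Rightarrow> 'g set \<Rightarrow> ('g, 'g set \<Rightarrow>\<^sub>0 int) gmodule" where
  "coset_lattice G H = with_act (free_Abelian_group (lcosets\<^bsub>G\<^esub> H))
     (\<lambda>g. frag_extend (\<lambda>C. frag_of (g <#\<^bsub>G\<^esub> C)))"

definition direct_sum_lattice ::
    "'i set \<Rightarrow> ('i \<Rightarrow> ('g, 'm) gmodule) \<Rightarrow> ('g, 'i \<Rightarrow> 'm) gmodule" where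
  "direct_sum_lattice I M = with_act (sum_group I M) (\<lambda>g f. \<lambda>i\<in>I. act (M i) g (f i))"


section \<open>Semidirect products\<close>

definition semidirect_product ::
    "('n, 'a) monoid_scheme \<Rightarrow> ('h, 'b) monoid_scheme \<Rightarrow> ('h \<Rightarrow> 'n \<Rightarrow> 'n) \<Rightarrow> ('n \<times> 'h) monoid" where
  "semidirect_product N H \<phi> =
     \<lparr>carrier = carrier N \<times> carrier H,
      monoid.mult = (\<lambda>(n, h) (n', h'). (n \<otimes>\<^bsub>N\<^esub> \<phi> h n', h \<otimes>\<^bsub>H\<^esub> h')),
      one = (\<one>\<^bsub>N\<^esub>, \<one>\<^bsub>H\<^esub>)\<rparr>"

text \<open>
  \<open>S\<^sub>2\<close> (the permutations of \<open>{1, 2}\<close>) acts on \<open>S\<^sub>r \<times> S\<^sub>r\<close> by interchanging the factors.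
\<close>

definition swap_action :: "(nat \<Rightarrow> nat) \<Rightarrow> 'a \<times> 'a \<Rightarrow> 'a \<times> 'a" where
  "swap_action q = (if q = id then id else prod.swap)"


section \<open>The root system of type \<open>A\<^sub>4\<close>\<close>

text \<open>
  The index type \<open>5\<close> consists of the residues modulo 5, so the standard basis vectors
  \<open>evec 1, \<dots>, evec 5\<close> of \<open>\<real>\<^sup>5\<close> are indexed by the residues of \<open>1, \<dots>, 5\<close>
  (the last one being \<open>0\<close>).  All lattices and cones are subsets of \<open>\<real>\<^sup>5\<close>.
\<close>

definition evec :: "nat \<Rightarrow> real^5" where
  "evec i = axis (of_nat i) 1"

definition roots_A4 :: "(real^5) set" where
  "roots_A4 = {evec i - evec j | i j. i \<in> {1..5} \<and> j \<in> {1..5} \<and> i \<noteq> j}"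

definition perm_map :: "(5 \<Rightarrow> 5) \<Rightarrow> real^5 \<Rightarrow> real^5" where
  "perm_map p x = (\<chi> i. x $ inv_into UNIV p i)"

text \<open>
  The group generated by \<open>S\<^sub>5\<close> and \<open>-id\<close> is realised by linear automorphisms of \<open>\<real>\<^sup>5\<close>; it acts
  faithfully on the hyperplane spanned by the roots, so that this is the automorphism group of
  the root system.
\<close>

definition Aut_A4 :: "(real^5 \<Rightarrow> real^5) monoid" where
  "Aut_A4 = (BijGroup UNIV)
     \<lparr>carrier := generate (BijGroup UNIV) (perm_map ` {p. p permutes UNIV} \<union> {uminus})\<rparr>"

definition vec_group :: "(real^5) set \<Rightarrow> (real^5) monoid" where
  "vec_group S = \<lparr>carrier = S, monoid.mult = (+), one = 0\<rparr>"

definition ZA4 :: "(real^5 \<Rightarrow> real^5, real^5) gmodule" where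
  "ZA4 = with_act (vec_group (generate (vec_group UNIV) roots_A4)) (\<lambda>g. g)"

text \<open>
  The weight lattice, i.e. the dual of the root lattice under the standard scalar product.  The
  scalar product is invariant under \<open>Aut_A4\<close>, so the contragredient action is the given one.
\<close>

definition Lambda_A4 :: "(real^5 \<Rightarrow> real^5, real^5) gmodule" where
  "Lambda_A4 = with_act
     (vec_group {x \<in> span roots_A4. \<forall>y\<in>carrier ZA4. inner x y \<in> \<int>}) (\<lambda>g. g)"

definition svec :: "nat set \<Rightarrow> nat set \<Rightarrow> real^5" where
  "svec I J = (1 / real (gcd (card I) (card J))) *\<^sub>R
     (real (card J) *\<^sub>R (\<Sum>i\<in>I. evec i) - real (card I) *\<^sub>R (\<Sum>j\<in>J. evec j))"

abbreviation srt :: "nat \<Rightarrow> nat \<Rightarrow> real^5" where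
  "srt r t \<equiv> svec {1..r} {r+1..r+t}"

definition v1 :: "real^5" where
  "v1 = (evec 1 + 2 *\<^sub>R evec 2) - (evec 3 + evec 4 + evec 5)"

definition v2 :: "real^5" where
  "v2 = 2 *\<^sub>R (evec 1 + evec 2) - 2 *\<^sub>R evec 3 - (evec 4 + evec 5)"

definition v3 :: "real^5" where
  "v3 = 2 *\<^sub>R evec 1 + 3 *\<^sub>R evec 2 - 2 *\<^sub>R (evec 3 + evec 4) - evec 5"

definition primitive_vector :: "(real^5) set \<Rightarrow> real^5 \<Rightarrow> bool" where
  "primitive_vector L x \<longleftrightarrow> x \<in> L \<and> x \<noteq> 0 \<and>
     (\<forall>y\<in>L. \<forall>n::int. x = of_int n *\<^sub>R y \<longrightarrow> \<bar>n\<bar> = 1)"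


section \<open>The fan of \<open>Y(A\<^sub>4)\<close>\<close>

abbreviation Cone :: "(real^5) set \<Rightarrow> (real^5) set" where
  "Cone S \<equiv> convex_cone hull S"

text \<open>The relation \<open>face_of\<close> of the library admits the empty face.\<close>

definition cone_faces :: "(real^5) set \<Rightarrow> (real^5) set set" where
  "cone_faces \<sigma> = {\<tau>. \<tau> face_of \<sigma> \<and> \<tau> \<noteq> {}}"

text \<open>Fans are given by their maximal cones.\<close>

definition fan_of :: "(real^5) set set \<Rightarrow> (real^5) set set" where
  "fan_of M = (\<Union>\<sigma>\<in>M. cone_faces \<sigma>)"

definition rays :: "(real^5) set set \<Rightarrow> (real^5) set set" where
  "rays \<Sigma> = {\<rho> \<in> \<Sigma>. dim \<rho> = 1}"

definition star_subdivision :: "(real^5) set \<Rightarrow> real^5 \<Rightarrow> (real^5) set set" where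
  "star_subdivision \<sigma> v = {Cone (insert v \<tau>) | \<tau>. \<tau> \<in> cone_faces \<sigma> \<and> v \<notin> \<tau>}"

text \<open>A path is the list of its vertices; \<open>i\<close> is the first coordinate of the first one.\<close>

definition gamma :: "(nat \<times> nat) list \<Rightarrow> (real^5) set" where
  "gamma C = (let i = fst (hd C) in (\<lambda>(a, b). svec {a..i} {i+1..b}) ` set C)"

definition path0 :: "(nat \<times> nat) list" where "path0 = [(1,2), (1,3), (1,4), (1,5)]"
definition path1 :: "(nat \<times> nat) list" where "path1 = [(2,3), (2,4), (2,5), (1,5)]"
definition path2 :: "(nat \<times> nat) list" where "path2 = [(2,3), (1,3), (1,4), (1,5)]"
definition path3 :: "(nat \<times> nat) list" where "path3 = [(2,3), (2,4), (1,4), (1,5)]"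

definition simp_max_cones :: "(real^5) set set" where
  "simp_max_cones =
     {g ` Cone (gamma C) | g C. g \<in> carrier Aut_A4 \<and> C \<in> {path0, path1, path2, path3}}"

definition subdivided :: "((real^5) set \<times> (real^5)) set" where
  "subdivided =
     {(g ` Cone (gamma C), g v) | g C v.
        g \<in> carrier Aut_A4 \<and> (C, v) \<in> {(path1, v1), (path2, v2), (path3, v3)}}"

definition fan_Y_A4 :: "(real^5) set set" where
  "fan_Y_A4 = fan_of
     ((simp_max_cones - fst ` subdivided) \<union> (\<Union>(\<sigma>, v)\<in>subdivided. star_subdivision \<sigma> v))"


section \<open>The permutation lattice on the rays\<close>

definition s_reps :: "(real^5) set" where
  "s_reps = {srt r t | r t. 1 \<le> r \<and> r \<le> t \<and> r + t \<le> 5}"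

definition v_reps :: "(real^5) set" where
  "v_reps = {v1, v2, v3}"

definition Omega :: "(real^5) set" where
  "Omega = s_reps \<union> v_reps"

definition Stab :: "real^5 \<Rightarrow> (real^5 \<Rightarrow> real^5) set" where
  "Stab x = stabilizer Aut_A4 (\<lambda>g. g) x"

definition stab_group :: "real^5 \<Rightarrow> (real^5 \<Rightarrow> real^5) monoid" where
  "stab_group x = Aut_A4\<lparr>carrier := Stab x\<rparr>"

definition P_A4 ::
    "(real^5 \<Rightarrow> real^5, real^5 \<Rightarrow> ((real^5 \<Rightarrow> real^5) set \<Rightarrow>\<^sub>0 int)) gmodule" where
  "P_A4 = direct_sum_lattice Omega (\<lambda>x. coset_lattice Aut_A4 (Stab x))"

text \<open>The coset \<open>g Stab x\<close> as an element of the summand with index \<open>x\<close>.\<close>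

definition coset_elem ::
    "real^5 \<Rightarrow> (real^5 \<Rightarrow> real^5) \<Rightarrow> real^5 \<Rightarrow> ((real^5 \<Rightarrow> real^5) set \<Rightarrow>\<^sub>0 int)" where
  "coset_elem x g = (\<lambda>y\<in>Omega. if y = x then frag_of (g <#\<^bsub>Aut_A4\<^esub> Stab x) else 0)"

end

theory Submission
  imports Defs
begin

text \<open>
  A short exact sequence \<open>0 \<rightarrow> F \<rightarrow> P \<rightarrow> N \<rightarrow> 0\<close> of \<open>G\<close>-lattices with \<open>P\<close> permutation has \<open>H\<^sup>1(H, P) = 0\<close>, so
  \<open>H\<^sup>1(H, F)\<close> is the cokernel of \<open>P\<^sup>H \<rightarrow> N\<^sup>H\<close> (\<open>cocycles_split_permutation_lattice\<close>, \<open>cocycles_split_F\<close>).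
  To see that the kernel of the map from the permutation lattice on the rays to the root lattice is
  coflasque, it therefore suffices to lift every vector \<open>x\<close> of the root lattice to an element of the
  permutation lattice that is fixed by the whole stabilizer of \<open>x\<close>. This means to write \<open>x\<close> as an integral
  combination of ray generators with coefficients that have the symmetries of \<open>x\<close>
  (\<open>symmetric_expansion_exists\<close>), and there are three cases. If \<open>-x\<close> is a permutation of \<open>x\<close>, then \<open>x\<close> is the
  sum over \<open>a > 0\<close> of \<open>a s\<^sub>I\<^sub>,\<^sub>J\<close>, where \<open>I\<close> and \<open>J\<close> are the sets of coordinates at which \<open>x\<close> is \<open>a\<close> and \<open>-a\<close>;
  these have the same size, at most two. Otherwise only permutations fix \<open>x\<close>. If the value of the
  coordinate \<open>i\<close> is taken nowhere else, then \<open>x\<close> is the sum of the \<open>x\<^sub>j (e\<^sub>j - e\<^sub>i)\<close>. If all values are repeated,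
  five being the number of coordinates, \<open>x\<close> is zero or a multiple of some \<open>s\<^sub>I\<^sub>,\<^sub>J\<close> with blocks of sizes 2 and 3.

  The flasque resolution is the dual sequence. It is exact since the map onto the root lattice sends
  some of the basis vectors to a basis, so that it splits and its kernel has a basis; the kernel is
  reflexive, and the scalar product identifies the weight lattice with the dual of the root lattice
  (\<open>coflasque_resolution_kernel\<close>, \<open>flasque_resolution_dual\<close>).

  The automorphism group consists of the signed permutations of the coordinates. The symmetries of a
  vector without a change of sign are the permutations of its blocks of equal coordinates, which gives
  the stabilizers (\<open>stab_group_iso\<close>); for \<open>s\<^sub>r\<^sub>,\<^sub>r\<close> there is in addition the interchange of the blocks of
  positive and negative coordinates, combined with the change of sign (\<open>stab_group_iso_swap\<close>).

  A face of a finitely generated cone is generated by the generators that it contains, and all generators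
  of the cones of the fan are images of the nine representatives, so there are no other rays
  (\<open>rays_subset\<close>). Conversely, supporting hyperplanes exhibit each representative as a ray: the \<open>v\<^sub>i\<close> by
  subdivision, \<open>s\<^sub>1\<^sub>,\<^sub>4\<close> from the cone of the first path, and the others from the subdivided cones
  (\<open>Cone_Aut_ray\<close>). Different representatives have different ratios of the \<open>l\<^sup>1\<close> and \<open>l\<^sup>2\<close> norms, which are
  invariants of orbits of rays (\<open>ray_orbits\<close>).
\<close>

section \<open>Coordinates with respect to a lattice basis\<close>

lemma hom_finprod:
  assumes M: "comm_group M" and N: "comm_group N" and h: "h \<in> hom M N"
    and f: "f \<in> A \<rightarrow> carrier M"
  shows "h (finprod M f A) = finprod N (\<lambda>a. h (f a)) A"
proof -
  interpret M: comm_group M by fact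
  interpret N: comm_group N by fact
  interpret group_hom M N h by unfold_locales (use h in simp)
  show ?thesis using f
  proof (induction A rule: infinite_finite_induct)
    case (insert a A)
    then have "f \<in> A \<rightarrow> carrier M" "f a \<in> carrier M" by auto
    moreover have "h (f x) \<in> carrier N" if "x \<in> A" for x
      using that Pi_mem[OF insert.prems, of x] by simp
    ultimately show ?case using insert.hyps insert.IH
      by (simp add: M.finprod_insert N.finprod_insert Pi_def)
  qed auto
qed

lemma finprod_integer_group: "finprod integer_group f A = sum f A"
proof -
  interpret comm_group integer_group by (rule abelian_integer_group)
  show ?thesis by (induction A rule: infinite_finite_induct) (auto simp: finprod_insert)
qed

lemma int_hom_finprod:
  assumes "comm_group M" "h \<in> hom M integer_group" "f \<in> A \<rightarrow> carrier M"
  shows "h (finprod M f A) = (\<Sum>a\<in>A. h (f a))"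
  using hom_finprod[OF assms(1) abelian_integer_group assms(2,3)] by (simp add: finprod_integer_group)

lemma int_hom_pow:
  assumes "comm_group M" "h \<in> hom M integer_group" "x \<in> carrier M"
  shows "h (x [^]\<^bsub>M\<^esub> (n::int)) = n * h x"
  using hom_int_pow[OF assms(2,3)] assms(1) by (simp add: comm_group_def)

definition coord :: "('m, 'b) monoid_scheme \<Rightarrow> 'm set \<Rightarrow> 'm \<Rightarrow> 'm \<Rightarrow> int" where
  "coord M B x = (THE c. c \<in> B \<rightarrow>\<^sub>E UNIV \<and> x = finprod M (\<lambda>b. b [^]\<^bsub>M\<^esub> c b) B)"

locale based_lattice = comm_group M for M (structure) +
  fixes B
  assumes basis: "lattice_basis M B"
begin

lemma finite_basis [simp]: "finite B"
  and basis_carrier: "B \<subseteq> carrier M"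
  using basis by (auto simp: lattice_basis_def)

lemma basis_in [simp]: "b \<in> B \<Longrightarrow> b \<in> carrier M"
  using basis_carrier by auto

lemma coord_expand:
  assumes "x \<in> carrier M"
  shows "finprod M (\<lambda>b. b [^] coord M B x b) B = x"
proof -
  have "\<exists>!c. c \<in> B \<rightarrow>\<^sub>E (UNIV :: int set) \<and> x = finprod M (\<lambda>b. b [^] c b) B"
    using basis assms by (auto simp: lattice_basis_def)
  from theI'[OF this] show ?thesis unfolding coord_def by simp
qed

lemma coord_finprod:
  fixes c :: "'a \<Rightarrow> int"
  assumes "b \<in> B"
  shows "coord M B (finprod M (\<lambda>b. b [^] c b) B) b = c b"
proof -
  let ?x = "finprod M (\<lambda>b. b [^] c b) B"
  have 1: "?x = finprod M (\<lambda>b. b [^] restrict c B b) B"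
    by (rule finprod_cong') auto
  have x: "?x \<in> carrier M" by (auto intro!: finprod_closed)
  have "\<exists>!c. c \<in> B \<rightarrow>\<^sub>E (UNIV :: int set) \<and> ?x = finprod M (\<lambda>b. b [^] c b) B"
    using basis x unfolding lattice_basis_def by blast
  then have "coord M B ?x = restrict c B"
    unfolding coord_def by (rule the1_equality) (use 1 in auto)
  with assms show ?thesis by simp
qed

lemma coord_mult:
  assumes "b \<in> B" "x \<in> carrier M" "y \<in> carrier M"
  shows "coord M B (x \<otimes> y) b = coord M B x b + coord M B y b"
proof -
  have "x \<otimes> y = finprod M (\<lambda>b. b [^] coord M B x b) B \<otimes> finprod M (\<lambda>b. b [^] coord M B y b) B"
    using assms by (simp add: coord_expand)
  also have "\<dots> = finprod M (\<lambda>b. b [^] coord M B x b \<otimes> b [^] coord M B y b) B"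
    by (subst finprod_multf) auto
  also have "\<dots> = finprod M (\<lambda>b. b [^] (coord M B x b + coord M B y b)) B"
    by (rule finprod_cong') (auto simp: int_pow_mult)
  finally show ?thesis using assms coord_finprod[of b "\<lambda>b. coord M B x b + coord M B y b"] by simp
qed

lemma coord_hom: "b \<in> B \<Longrightarrow> (\<lambda>x. coord M B x b) \<in> hom M integer_group"
  by (auto simp: hom_def coord_mult)

lemma coord_one [simp]: "b \<in> B \<Longrightarrow> coord M B \<one> b = 0"
  using coord_mult[of b \<one> \<one>] by simp

lemma coord_inv: "b \<in> B \<Longrightarrow> x \<in> carrier M \<Longrightarrow> coord M B (inv x) b = - coord M B x b"
  using coord_mult[of b x "inv x"] by simp

lemma coord_basis:
  assumes "b \<in> B" "b' \<in> B"
  shows "coord M B b' b = (if b = b' then 1 else 0)"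
proof -
  have "finprod M (\<lambda>b. b [^] (if b = b' then 1 else 0 :: int)) B =
        finprod M (\<lambda>b. if b = b' then b else \<one>) B"
    by (rule finprod_cong') auto
  also have "\<dots> = b'"
    using finprod_singleton_swap[of b' B "\<lambda>b. b"] assms by auto
  finally have "b' = finprod M (\<lambda>b. b [^] (if b = b' then 1 else 0 :: int)) B" ..
  then show ?thesis using coord_finprod[OF assms(1), of "\<lambda>b. if b = b' then 1 else 0"] by simp
qed

lemma coord_eqI:
  assumes "x \<in> carrier M" "y \<in> carrier M" "\<And>b. b \<in> B \<Longrightarrow> coord M B x b = coord M B y b"
  shows "x = y"
proof -
  have "finprod M (\<lambda>b. b [^] coord M B x b) B = finprod M (\<lambda>b. b [^] coord M B y b) B"
    by (rule finprod_cong') (use assms(3) in auto)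
  then show ?thesis using assms coord_expand by metis
qed

lemma hom_expand:
  assumes N: "comm_group N" and h: "h \<in> hom M N" and x: "x \<in> carrier M"
  shows "h x = finprod N (\<lambda>b. h b [^]\<^bsub>N\<^esub> coord M B x b) B"
proof -
  interpret N: comm_group N by fact
  have hc: "h y \<in> carrier N" if "y \<in> carrier M" for y using h that by (auto simp: hom_def)
  have "h x = h (finprod M (\<lambda>b. b [^] coord M B x b) B)" using x by (simp add: coord_expand)
  also have "\<dots> = finprod N (\<lambda>b. h (b [^] coord M B x b)) B"
    by (rule hom_finprod[OF comm_group_axioms N h]) auto
  also have "\<dots> = finprod N (\<lambda>b. h b [^]\<^bsub>N\<^esub> coord M B x b) B"
    by (rule N.finprod_cong') (auto simp: hc hom_int_pow[OF h])
  finally show ?thesis .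
qed

lemma int_hom_expand:
  assumes "h \<in> hom M integer_group" "x \<in> carrier M"
  shows "h x = (\<Sum>b\<in>B. coord M B x b * h b)"
  using hom_expand[OF abelian_integer_group assms] by (simp add: finprod_integer_group)

lemma hom_eqI:
  assumes N: "comm_group N" and "h \<in> hom M N" "k \<in> hom M N"
    and eq: "\<And>b. b \<in> B \<Longrightarrow> h b = k b" and x: "x \<in> carrier M"
  shows "h x = k x"
proof -
  interpret N: comm_group N by fact
  have "k b \<in> carrier N" if "b \<in> B" for b using assms(3) that by (auto simp: hom_def)
  then show ?thesis
    unfolding hom_expand[OF N assms(2) x] hom_expand[OF N assms(3) x]
    by (intro N.finprod_cong') (auto simp: eq)
qed

lemma hom_of_basis:
  assumes "comm_group N" and f: "f \<in> B \<rightarrow> carrier N"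
  obtains h where "h \<in> hom M N" "\<And>b. b \<in> B \<Longrightarrow> h b = f b"
proof
  interpret N: comm_group N by fact
  have fb: "f b \<in> carrier N" if "b \<in> B" for b using f that by auto
  define h where "h x = finprod N (\<lambda>b. f b [^]\<^bsub>N\<^esub> coord M B x b) B" for x
  show "h \<in> hom M N"
  proof (rule homI)
    fix x y assume xy: "x \<in> carrier M" "y \<in> carrier M"
    have "h (x \<otimes> y) = finprod N (\<lambda>b. f b [^]\<^bsub>N\<^esub> coord M B x b \<otimes>\<^bsub>N\<^esub> f b [^]\<^bsub>N\<^esub> coord M B y b) B"
      unfolding h_def using xy fb by (intro N.finprod_cong') (auto simp: coord_mult N.int_pow_mult)
    then show "h (x \<otimes> y) = h x \<otimes>\<^bsub>N\<^esub> h y"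
      unfolding h_def using fb by (subst (asm) N.finprod_multf) auto
  qed (auto simp: h_def fb intro!: N.finprod_closed)
  show "h b = f b" if "b \<in> B" for b
  proof -
    have "h b = finprod N (\<lambda>b'. if b = b' then f b' else \<one>\<^bsub>N\<^esub>) B"
      unfolding h_def using that fb
      by (intro N.finprod_cong') (auto simp: coord_basis)
    also have "\<dots> = f b" using N.finprod_singleton[of b B f] that f by simp
    finally show ?thesis .
  qed
qed

end

text \<open>
  The working criterion: a finite family is a basis as soon as it has a dual family of integer
  valued homomorphisms that separates the elements of the group.
\<close>

lemma lattice_basisI:
  fixes \<beta> :: "'i \<Rightarrow> 'm" and d :: "'i \<Rightarrow> 'm \<Rightarrow> int"
  assumes M: "comm_group M" and I: "finite I"
    and \<beta>: "\<And>i. i \<in> I \<Longrightarrow> \<beta> i \<in> carrier M"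
    and d: "\<And>i. i \<in> I \<Longrightarrow> d i \<in> hom M integer_group"
    and dual: "\<And>i j. i \<in> I \<Longrightarrow> j \<in> I \<Longrightarrow> d i (\<beta> j) = (if i = j then 1 else 0)"
    and sep: "\<And>x. x \<in> carrier M \<Longrightarrow> (\<And>i. i \<in> I \<Longrightarrow> d i x = 0) \<Longrightarrow> x = \<one>\<^bsub>M\<^esub>"
  shows "lattice_basis M (\<beta> ` I)"
proof -
  interpret comm_group M by fact
  have inj: "inj_on \<beta> I"
  proof (rule inj_onI)
    fix i j assume "i \<in> I" "j \<in> I" "\<beta> i = \<beta> j"
    then show "i = j" using dual[of i i] dual[of i j] by (auto split: if_splits)
  qed
  have prod: "finprod M (\<lambda>b. b [^]\<^bsub>M\<^esub> c b) (\<beta> ` I) = finprod M (\<lambda>i. \<beta> i [^]\<^bsub>M\<^esub> c (\<beta> i)) I"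
    for c :: "'m \<Rightarrow> int"
    using \<beta> by (subst finprod_reindex[OF _ inj]) auto
  have d_prod: "d i (finprod M (\<lambda>i. \<beta> i [^]\<^bsub>M\<^esub> c i) I) = c i" if "i \<in> I" for c :: "'i \<Rightarrow> int" and i
  proof -
    have "d i (finprod M (\<lambda>i. \<beta> i [^]\<^bsub>M\<^esub> c i) I) = (\<Sum>j\<in>I. d i (\<beta> j [^]\<^bsub>M\<^esub> c j))"
      by (rule int_hom_finprod[OF M d[OF that]]) (use \<beta> in auto)
    also have "\<dots> = (\<Sum>j\<in>I. if i = j then c j else 0)"
      by (rule sum.cong) (use that \<beta> d in \<open>auto simp: int_hom_pow[OF M] dual\<close>)
    finally show ?thesis using that I by simp
  qed
  have "\<exists>!c. c \<in> \<beta> ` I \<rightarrow>\<^sub>E (UNIV :: int set) \<and> x = finprod M (\<lambda>b. b [^]\<^bsub>M\<^esub> c b) (\<beta> ` I)"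
    if x: "x \<in> carrier M" for x
  proof (rule ex1I)
    let ?c = "\<lambda>b\<in>\<beta> ` I. d (the_inv_into I \<beta> b) x"
    let ?y = "finprod M (\<lambda>i. \<beta> i [^]\<^bsub>M\<^esub> d i x) I"
    have y: "?y \<in> carrier M" using \<beta> by (auto intro!: finprod_closed)
    have "d i (x \<otimes>\<^bsub>M\<^esub> inv\<^bsub>M\<^esub> ?y) = 0" if "i \<in> I" for i
    proof -
      interpret h: group_hom M integer_group "d i"
        by unfold_locales (use d[OF that] group_integer_group in \<open>auto simp: group.is_monoid group_def group_axioms_def\<close>)
      show ?thesis using h.hom_mult[of x "inv\<^bsub>M\<^esub> ?y"] h.hom_inv[OF y] x y d_prod[OF that]
        by (simp)
    qed
    then have "x \<otimes>\<^bsub>M\<^esub> inv\<^bsub>M\<^esub> ?y = \<one>\<^bsub>M\<^esub>" using x y by (intro sep) auto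
    then have "x = ?y" using x y by (metis inv_closed inv_equality inv_inv)
    also have "\<dots> = finprod M (\<lambda>b. b [^]\<^bsub>M\<^esub> ?c b) (\<beta> ` I)"
      unfolding prod using \<beta> by (intro finprod_cong') (auto simp: the_inv_into_f_f[OF inj])
    finally show "?c \<in> \<beta> ` I \<rightarrow>\<^sub>E UNIV \<and> x = finprod M (\<lambda>b. b [^]\<^bsub>M\<^esub> ?c b) (\<beta> ` I)" by auto
    fix c :: "'m \<Rightarrow> int"
    assume c: "c \<in> \<beta> ` I \<rightarrow>\<^sub>E UNIV \<and> x = finprod M (\<lambda>b. b [^]\<^bsub>M\<^esub> c b) (\<beta> ` I)"
    then have "d i x = c (\<beta> i)" if "i \<in> I" for i
      using d_prod[OF that, of "\<lambda>i. c (\<beta> i)"] prod[of c] by simp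
    then show "c = ?c" using c by (intro extensionalityI[of _ "\<beta> ` I"]) (auto simp: the_inv_into_f_f[OF inj] PiE_def)
  qed
  then show ?thesis unfolding lattice_basis_def using I \<beta> by auto
qed


section \<open>Lattices with a group action and their duals\<close>

locale G_lattice =
  fixes G :: "('g, 'a) monoid_scheme" and M :: "('g, 'm) gmodule"
  assumes lat: "is_G_lattice G M"
begin

sublocale G: group G using lat by (simp add: is_G_lattice_def)
sublocale M: comm_group M using lat by (simp add: is_G_lattice_def)

lemma act_hom: "g \<in> carrier G \<Longrightarrow> act M g \<in> hom M M"
  using lat by (simp add: is_G_lattice_def)

lemma act_closed [simp]: "g \<in> carrier G \<Longrightarrow> x \<in> carrier M \<Longrightarrow> act M g x \<in> carrier M"
  using act_hom by (auto simp: hom_def)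

lemma act_mult: "g \<in> carrier G \<Longrightarrow> x \<in> carrier M \<Longrightarrow> y \<in> carrier M \<Longrightarrow>
    act M g (x \<otimes>\<^bsub>M\<^esub> y) = act M g x \<otimes>\<^bsub>M\<^esub> act M g y"
  using act_hom by (auto simp: hom_def)

lemma act_one [simp]: "x \<in> carrier M \<Longrightarrow> act M \<one>\<^bsub>G\<^esub> x = x"
  using lat by (simp add: is_G_lattice_def)

lemma act_comp: "g \<in> carrier G \<Longrightarrow> h \<in> carrier G \<Longrightarrow> x \<in> carrier M \<Longrightarrow>
    act M (g \<otimes>\<^bsub>G\<^esub> h) x = act M g (act M h x)"
  using lat by (simp add: is_G_lattice_def)

lemma act_group_hom: "g \<in> carrier G \<Longrightarrow> group_hom M M (act M g)"
  by unfold_locales (simp add: act_hom)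

lemma act_neutral [simp]: "g \<in> carrier G \<Longrightarrow> act M g \<one>\<^bsub>M\<^esub> = \<one>\<^bsub>M\<^esub>"
  using group_hom.hom_one[OF act_group_hom] .

lemma act_inv: "g \<in> carrier G \<Longrightarrow> x \<in> carrier M \<Longrightarrow> act M g (inv\<^bsub>M\<^esub> x) = inv\<^bsub>M\<^esub> act M g x"
  using group_hom.hom_inv[OF act_group_hom] .

lemma act_inv_act [simp]: "g \<in> carrier G \<Longrightarrow> x \<in> carrier M \<Longrightarrow> act M (inv\<^bsub>G\<^esub> g) (act M g x) = x"
  by (simp flip: act_comp)

lemma act_act_inv [simp]: "g \<in> carrier G \<Longrightarrow> x \<in> carrier M \<Longrightarrow> act M g (act M (inv\<^bsub>G\<^esub> g) x) = x"
  by (simp flip: act_comp)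

lemma act_eq_iff: "g \<in> carrier G \<Longrightarrow> x \<in> carrier M \<Longrightarrow> y \<in> carrier M \<Longrightarrow>
    act M g x = act M g y \<longleftrightarrow> x = y"
  by (metis act_inv_act)

end

lemma dual_lattice_simps [simp]:
  "carrier (dual_lattice G M) = hom M integer_group \<inter> extensional (carrier M)"
  "f \<otimes>\<^bsub>dual_lattice G M\<^esub> f' = (\<lambda>x\<in>carrier M. f x + f' x)"
  "\<one>\<^bsub>dual_lattice G M\<^esub> = (\<lambda>x\<in>carrier M. 0)"
  "act (dual_lattice G M) g f = (\<lambda>x\<in>carrier M. f (act M (inv\<^bsub>G\<^esub> g) x))"
  by (simp_all add: dual_lattice_def)

lemma comm_group_dual_lattice:
  assumes "comm_group M"
  shows "comm_group (dual_lattice G M)"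
proof -
  interpret M: comm_group M by fact
  show ?thesis
  proof (rule comm_groupI)
    fix f assume f: "f \<in> carrier (dual_lattice G M)"
    then show "\<exists>k\<in>carrier (dual_lattice G M). k \<otimes>\<^bsub>dual_lattice G M\<^esub> f = \<one>\<^bsub>dual_lattice G M\<^esub>"
      by (intro bexI[of _ "\<lambda>x\<in>carrier M. - f x"]) (auto simp: hom_def)
  next
    fix f assume "f \<in> carrier (dual_lattice G M)"
    then show "\<one>\<^bsub>dual_lattice G M\<^esub> \<otimes>\<^bsub>dual_lattice G M\<^esub> f = f"
      by (auto simp: extensional_def)
  qed (auto simp: hom_def add_ac)
qed

definition dual_vector :: "('m, 'b) monoid_scheme \<Rightarrow> 'm set \<Rightarrow> 'm \<Rightarrow> 'm \<Rightarrow> int" where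
  "dual_vector M B b = (\<lambda>x\<in>carrier M. coord M B x b)"

lemma (in based_lattice) dual_vector_hom: "b \<in> B \<Longrightarrow> dual_vector M B b \<in> hom M integer_group"
  by (auto simp: dual_vector_def hom_def coord_mult)

lemma eval_hom: "x \<in> carrier M \<Longrightarrow> (\<lambda>f. f x) \<in> hom (dual_lattice G M) integer_group"
  by (auto simp: hom_def)

lemma lattice_basis_dual:
  assumes M: "comm_group M" and B: "lattice_basis M B"
  shows "lattice_basis (dual_lattice G M) (dual_vector M B ` B)"
proof -
  interpret based_lattice M B using assms by (simp add: based_lattice_def based_lattice_axioms_def)
  show ?thesis
  proof (rule lattice_basisI[where d = "\<lambda>b f. f b"])
    fix f assume f: "f \<in> carrier (dual_lattice G M)" and 0: "\<And>b. b \<in> B \<Longrightarrow> f b = 0"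
    then have "f x = 0" if "x \<in> carrier M" for x
      using int_hom_expand[of f x] that by simp
    with f show "f = \<one>\<^bsub>dual_lattice G M\<^esub>" by (auto simp: extensional_def)
  qed (use dual_vector_hom in \<open>auto simp: comm_group_dual_lattice[OF M] coord_basis eval_hom dual_vector_def\<close>)
qed

lemma is_G_lattice_dual:
  assumes "is_G_lattice G M"
  shows "is_G_lattice G (dual_lattice G M)"
proof -
  interpret G_lattice G M by unfold_locales fact
  obtain B where B: "lattice_basis M B" using assms by (auto simp: is_G_lattice_def)
  show ?thesis unfolding is_G_lattice_def
  proof (intro conjI ballI)
    show "\<exists>B. lattice_basis (dual_lattice G M) B"
      using lattice_basis_dual[OF M.comm_group_axioms B] by blast
    fix g assume g: "g \<in> carrier G"
    then show "act (dual_lattice G M) g \<in> hom (dual_lattice G M) (dual_lattice G M)"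
      by (auto simp: hom_def act_mult)
  next
    fix g h f assume "g \<in> carrier G" "h \<in> carrier G" "f \<in> carrier (dual_lattice G M)"
    then show "act (dual_lattice G M) (g \<otimes>\<^bsub>G\<^esub> h) f =
        act (dual_lattice G M) g (act (dual_lattice G M) h f)"
      by (auto simp: G.inv_mult_group act_comp)
  next
    fix f assume "f \<in> carrier (dual_lattice G M)"
    then show "act (dual_lattice G M) \<one>\<^bsub>G\<^esub> f = f"
      by (auto simp: extensional_def)
  qed (auto simp: G.group_axioms comm_group_dual_lattice M.comm_group_axioms)
qed

text \<open>A group that permutes a basis moves the coordinates along.\<close>

lemma coord_act:
  assumes "is_G_lattice G M" "lattice_basis M B" "\<And>g. g \<in> carrier G \<Longrightarrow> act M g ` B = B"
    and "g \<in> carrier G" "x \<in> carrier M" "b \<in> B"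
  shows "coord M B (act M g x) (act M g b) = coord M B x b"
proof -
  interpret G_lattice G M by unfold_locales fact
  interpret based_lattice M B
    using assms by (simp add: based_lattice_def based_lattice_axioms_def M.comm_group_axioms)
  have gB: "act M g b' \<in> B" if "b' \<in> B" for b' using assms that by blast
  show ?thesis
  proof (rule hom_eqI[OF abelian_integer_group, where h = "\<lambda>x. coord M B (act M g x) (act M g b)"])
    show "(\<lambda>x. coord M B (act M g x) (act M g b)) \<in> hom M integer_group"
      using assms gB by (auto simp: hom_def act_mult coord_mult)
    show "coord M B (act M g b') (act M g b) = coord M B b' b" if "b' \<in> B" for b'
      using assms that gB by (simp add: coord_basis act_eq_iff)
  qed (use assms coord_hom in auto)
qed

lemma permutation_lattice_dual:
  assumes "permutation_lattice G M"
  shows "permutation_lattice G (dual_lattice G M)"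
proof -
  obtain B where M: "is_G_lattice G M" and B: "lattice_basis M B"
    and perm: "\<And>g. g \<in> carrier G \<Longrightarrow> act M g ` B = B"
    using assms by (auto simp: permutation_lattice_def)
  interpret G_lattice G M by unfold_locales fact
  interpret based_lattice M B
    using B by (simp add: based_lattice_def based_lattice_axioms_def M.comm_group_axioms)
  have act_dual: "act (dual_lattice G M) g (dual_vector M B b) = dual_vector M B (act M g b)"
    if "g \<in> carrier G" "b \<in> B" for g b
  proof -
    have "coord M B (act M (inv\<^bsub>G\<^esub> g) x) b = coord M B x (act M g b)" if "x \<in> carrier M" for x
      using coord_act[OF M B perm, of g "act M (inv\<^bsub>G\<^esub> g) x" b] that \<open>g \<in> carrier G\<close> \<open>b \<in> B\<close>
      by simp
    then show ?thesis using that by (auto simp: dual_vector_def)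
  qed
  have "act (dual_lattice G M) g ` (dual_vector M B ` B) = dual_vector M B ` B"
    if g: "g \<in> carrier G" for g
  proof -
    have "act (dual_lattice G M) g ` (dual_vector M B ` B) = dual_vector M B ` (act M g ` B)"
      using act_dual[OF g] by (simp add: image_image cong: image_cong del: dual_lattice_simps)
    then show ?thesis using perm[OF g] by simp
  qed
  then show ?thesis
    unfolding permutation_lattice_def
    using is_G_lattice_dual[OF M] lattice_basis_dual[OF M.comm_group_axioms B] by blast
qed

text \<open>
  The evaluation map takes the coordinates of \<open>x\<close> to the values of \<open>ev x\<close> at the dual basis, and an
  element of the double dual is determined by these values.
\<close>

lemma double_dual_iso:
  assumes "is_G_lattice G M"
  defines "ev \<equiv> \<lambda>x. \<lambda>f\<in>carrier (dual_lattice G M). f x"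
  shows "ev \<in> equivariant_hom G M (dual_lattice G (dual_lattice G M))"
    and "bij_betw ev (carrier M) (carrier (dual_lattice G (dual_lattice G M)))"
proof -
  interpret G_lattice G M by unfold_locales fact
  obtain B where B: "lattice_basis M B" using assms by (auto simp: is_G_lattice_def)
  interpret based_lattice M B
    using B by (simp add: based_lattice_def based_lattice_axioms_def M.comm_group_axioms)
  let ?D = "dual_lattice G M"
  interpret D: based_lattice ?D "dual_vector M B ` B"
    using lattice_basis_dual[OF M.comm_group_axioms B]
    by (simp add: based_lattice_def based_lattice_axioms_def comm_group_dual_lattice M.comm_group_axioms)
  have ev_closed: "ev x \<in> carrier (dual_lattice G ?D)" if "x \<in> carrier M" for x
    using that by (auto simp: ev_def hom_def)
  have dv: "dual_vector M B b \<in> carrier ?D" if "b \<in> B" for b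
    using dual_vector_hom[OF that] by (auto simp: dual_vector_def)
  have ev_dv: "ev x (dual_vector M B b) = coord M B x b" if "x \<in> carrier M" "b \<in> B" for x b
    using dv[OF that(2)] that by (simp add: ev_def dual_vector_def)
  have DG: "act ?D g f \<in> carrier ?D" if "g \<in> carrier G" "f \<in> carrier ?D" for g f
    using G_lattice.act_closed[OF G_lattice.intro[OF is_G_lattice_dual[OF assms(1)]] that] .
  show "ev \<in> equivariant_hom G M (dual_lattice G ?D)"
    unfolding equivariant_hom_def
  proof (intro CollectI conjI ballI)
    show "ev \<in> hom M (dual_lattice G ?D)"
      using ev_closed by (intro homI) (auto simp: ev_def hom_def)
    fix g x assume gx: "g \<in> carrier G" "x \<in> carrier M"
    show "ev (act M g x) = act (dual_lattice G ?D) g (ev x)"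
    proof
      fix f
      show "ev (act M g x) f = act (dual_lattice G ?D) g (ev x) f"
        using DG[of "inv\<^bsub>G\<^esub> g" f] gx by (cases "f \<in> carrier ?D") (auto simp: ev_def)
    qed
  qed
  show "bij_betw ev (carrier M) (carrier (dual_lattice G ?D))"
  proof (rule bij_betw_imageI)
    show "inj_on ev (carrier M)"
      by (rule inj_onI) (metis coord_eqI ev_dv)
    show "ev ` carrier M = carrier (dual_lattice G ?D)"
    proof (intro equalityI subsetI)
      fix \<phi> assume \<phi>: "\<phi> \<in> carrier (dual_lattice G ?D)"
      let ?x = "finprod M (\<lambda>b. b [^]\<^bsub>M\<^esub> \<phi> (dual_vector M B b)) B"
      have x: "?x \<in> carrier M" by (auto intro!: M.finprod_closed)
      have "ev ?x f = \<phi> f" if f: "f \<in> carrier ?D" for f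
      proof (rule D.hom_eqI[OF abelian_integer_group, where h = "ev ?x" and k = \<phi>])
        show "ev ?x \<in> hom ?D integer_group" "\<phi> \<in> hom ?D integer_group"
          using ev_closed[OF x] \<phi> by auto
        show "ev ?x d = \<phi> d" if "d \<in> dual_vector M B ` B" for d
          using that ev_dv[OF x] coord_finprod[of _ "\<lambda>b. \<phi> (dual_vector M B b)"] by auto
      qed (use f in auto)
      note eq = this
      have e1: "ev ?x \<in> extensional (carrier ?D)"
        unfolding ev_def by (rule restrict_extensional)
      have e2: "\<phi> \<in> extensional (carrier ?D)"
        using \<phi> by (simp only: dual_lattice_simps Int_iff)
      have "ev ?x = \<phi>" by (rule extensionalityI[OF e1 e2 eq])
      then show "\<phi> \<in> ev ` carrier M" using x by (rule image_eqI[OF sym])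
    next
      fix \<phi> assume "\<phi> \<in> ev ` carrier M"
      then show "\<phi> \<in> carrier (dual_lattice G ?D)"
        by (elim imageE) (simp only: ev_closed)
    qed
  qed
qed


lemma (in comm_group) mult_inv_cancel_middle:
  assumes "x \<in> carrier G" "y \<in> carrier G" "z \<in> carrier G"
  shows "x \<otimes> inv z \<otimes> (y \<otimes> inv x) = y \<otimes> inv z"
proof -
  have "x \<otimes> inv z \<otimes> (y \<otimes> inv x) = (x \<otimes> inv x) \<otimes> (y \<otimes> inv z)"
    using assms by (simp only: m_ac inv_closed m_closed)
  also have "x \<otimes> inv x = \<one>" using assms by simp
  finally show ?thesis using assms by simp
qed

section \<open>Vanishing of the first cohomology\<close>

text \<open>
  The vanishing of \<open>H\<^sup>1\<close> for all subgroups in the form in which it is produced and consumed below: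
  every crossed homomorphism is principal.
\<close>

definition cocycles_split :: "('g, 'a) monoid_scheme \<Rightarrow> ('g, 'm) gmodule \<Rightarrow> bool" where
  "cocycles_split G M \<longleftrightarrow> (\<forall>H f. subgroup H G \<longrightarrow> f \<in> carrier (cocycle_group G H M) \<longrightarrow>
     (\<exists>m\<in>carrier M. \<forall>h\<in>H. f h = act M h m \<otimes>\<^bsub>M\<^esub> inv\<^bsub>M\<^esub> m))"

lemma cocycle_iff:
  "f \<in> carrier (cocycle_group G H M) \<longleftrightarrow> f \<in> H \<rightarrow>\<^sub>E carrier M \<and>
     (\<forall>g\<in>H. \<forall>h\<in>H. f (g \<otimes>\<^bsub>G\<^esub> h) = f g \<otimes>\<^bsub>M\<^esub> act M g (f h))"
  by (simp add: cocycle_group_def)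

lemma coflasqueI:
  assumes M: "is_G_lattice G M" and split: "cocycles_split G M"
  shows "coflasque G M"
  unfolding coflasque_def
proof (intro conjI allI impI)
  interpret G_lattice G M by unfold_locales fact
  fix H assume H: "subgroup H G"
  interpret H: subgroup H G by fact
  let ?Z = "cocycle_group G H M"
  note Z_simps = cocycle_iff cocycle_group_def
  have Zgroup: "group ?Z"
  proof (rule groupI)
    fix f assume f: "f \<in> carrier ?Z"
    then have fc: "f h \<in> carrier M" if "h \<in> H" for h using that by (auto simp: cocycle_iff)
    show "\<one>\<^bsub>?Z\<^esub> \<otimes>\<^bsub>?Z\<^esub> f = f"
      using f fc by (auto simp: cocycle_group_def extensional_def PiE_def)
    let ?k = "\<lambda>h\<in>H. inv\<^bsub>M\<^esub> f h"
    have "?k \<in> carrier ?Z"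
      using f fc by (auto simp: cocycle_iff act_inv M.inv_mult)
    moreover have "?k \<otimes>\<^bsub>?Z\<^esub> f = \<one>\<^bsub>?Z\<^esub>"
      using fc by (auto simp: cocycle_group_def)
    ultimately show "\<exists>k\<in>carrier ?Z. k \<otimes>\<^bsub>?Z\<^esub> f = \<one>\<^bsub>?Z\<^esub>" by blast
  next
    fix f k assume fk: "f \<in> carrier ?Z" "k \<in> carrier ?Z"
    then have fc: "f h \<in> carrier M" "k h \<in> carrier M" if "h \<in> H" for h
      using that by (auto simp: cocycle_iff)
    show "f \<otimes>\<^bsub>?Z\<^esub> k \<in> carrier ?Z"
      using fk fc by (auto simp: Z_simps act_mult M.m_ac)
  next
    fix f k l assume "f \<in> carrier ?Z" "k \<in> carrier ?Z" "l \<in> carrier ?Z"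
    then have "f h \<in> carrier M" "k h \<in> carrier M" "l h \<in> carrier M" if "h \<in> H" for h
      using that by (auto simp: cocycle_iff)
    then show "f \<otimes>\<^bsub>?Z\<^esub> k \<otimes>\<^bsub>?Z\<^esub> l = f \<otimes>\<^bsub>?Z\<^esub> (k \<otimes>\<^bsub>?Z\<^esub> l)"
      by (auto simp: cocycle_group_def M.m_assoc intro!: restrict_ext)
  qed (auto simp: Z_simps)
  interpret Z: group ?Z by fact
  have "coboundaries H M = carrier ?Z"
  proof (intro equalityI subsetI)
    fix f assume "f \<in> coboundaries H M"
    then obtain m where m: "m \<in> carrier M" and f: "f = (\<lambda>g\<in>H. act M g m \<otimes>\<^bsub>M\<^esub> inv\<^bsub>M\<^esub> m)"
      by (auto simp: coboundaries_def)
    have "act M g (act M h m) \<otimes>\<^bsub>M\<^esub> inv\<^bsub>M\<^esub> m =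
        act M g m \<otimes>\<^bsub>M\<^esub> inv\<^bsub>M\<^esub> m \<otimes>\<^bsub>M\<^esub> (act M g (act M h m) \<otimes>\<^bsub>M\<^esub> inv\<^bsub>M\<^esub> act M g m)"
      if gh: "g \<in> H" "h \<in> H" for g h
    proof -
      have c: "act M g m \<in> carrier M" "act M g (act M h m) \<in> carrier M" using gh m by auto
      show ?thesis using M.mult_inv_cancel_middle[OF c m] ..
    qed
    then show "f \<in> carrier ?Z"
      using m by (auto simp: cocycle_iff f act_mult act_inv act_comp)
  next
    fix f assume f: "f \<in> carrier ?Z"
    then obtain m where m: "m \<in> carrier M" "\<And>h. h \<in> H \<Longrightarrow> f h = act M h m \<otimes>\<^bsub>M\<^esub> inv\<^bsub>M\<^esub> m"
      using split H unfolding cocycles_split_def by blast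
    then have "f = (\<lambda>h\<in>H. act M h m \<otimes>\<^bsub>M\<^esub> inv\<^bsub>M\<^esub> m)"
      using f by (intro extensionalityI[of _ H]) (auto simp: cocycle_iff PiE_def)
    then show "f \<in> coboundaries H M" using m by (auto simp: coboundaries_def)
  qed
  moreover have "group (?Z Mod carrier ?Z)"
    using normal.factorgroup_is_group[OF Z.normal_self] .
  moreover have "carrier (?Z Mod carrier ?Z) = {carrier ?Z}"
  proof -
    have "carrier ?Z #>\<^bsub>?Z\<^esub> f = carrier ?Z" if "f \<in> carrier ?Z" for f
      using Z.coset_join2[OF that Z.subgroup_self that] .
    then have "carrier (?Z Mod carrier ?Z) = (\<lambda>f. carrier ?Z) ` carrier ?Z"
      unfolding carrier_FactGroup by (rule image_cong[OF refl])
    also have "\<dots> = {carrier ?Z}" by (rule image_constant[OF Z.one_closed])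
    finally show ?thesis .
  qed
  ultimately show "trivial_group (H1 G H M)"
    unfolding H1_def trivial_group_def by (simp only: one_FactGroup simp_thms)
qed (fact M)

text \<open>
  For a permutation lattice, averaging a cocycle \<open>f\<close> gives a solution of the coboundary equation
  with coefficients in \<open>(1/|H|) \<int>\<close>. The equation says that the coefficients of this solution
  along an orbit differ by integers, so rounding all of them down leaves the differences unchanged.
\<close>

lemma cocycles_split_permutation_lattice:
  assumes perm: "permutation_lattice G M" and fin: "finite (carrier G)"
  shows "cocycles_split G M"
  unfolding cocycles_split_def
proof (intro allI impI)
  obtain B where M: "is_G_lattice G M" and B: "lattice_basis M B"
    and act_B: "\<And>g. g \<in> carrier G \<Longrightarrow> act M g ` B = B"
    using perm by (auto simp: permutation_lattice_def)
  interpret G_lattice G M by unfold_locales fact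
  interpret based_lattice M B
    using B by (simp add: based_lattice_def based_lattice_axioms_def M.comm_group_axioms)
  fix H f assume H: "subgroup H G" and f: "f \<in> carrier (cocycle_group G H M)"
  interpret H: subgroup H G by fact
  have finH: "finite H" using fin H.subset finite_subset by blast
  then have cardH: "int (card H) > 0" using H.one_closed card_gt_0_iff[of H] by fastforce
  have "f \<in> H \<rightarrow>\<^sub>E carrier M"
    and f_mult: "f (h \<otimes>\<^bsub>G\<^esub> k) = f h \<otimes>\<^bsub>M\<^esub> act M h (f k)" if "h \<in> H" "k \<in> H" for h k
    using f that unfolding cocycle_iff by blast+
  then have fc: "f h \<in> carrier M" if "h \<in> H" for h using that by blast
  have gB: "act M g b \<in> B" if "g \<in> H" "b \<in> B" for g b
    using act_B[OF H.mem_carrier[OF that(1)]] that(2) by blast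
  define S where "S b = - (\<Sum>k\<in>H. coord M B (f k) b)" for b
  define c where "c b = S b div int (card H)" for b
  define m where "m = finprod M (\<lambda>b. b [^]\<^bsub>M\<^esub> c b) B"
  have m: "m \<in> carrier M" by (auto simp: m_def intro!: M.finprod_closed)
  have S: "S (act M (inv\<^bsub>G\<^esub> h) b) = S b + coord M B (f h) b * int (card H)"
    if h: "h \<in> H" and b: "b \<in> B" for h b
  proof -
    have hi: "inv\<^bsub>G\<^esub> h \<in> H" using h by simp
    have "coord M B (f k) (act M (inv\<^bsub>G\<^esub> h) b) = coord M B (f (h \<otimes>\<^bsub>G\<^esub> k)) b - coord M B (f h) b"
      if k: "k \<in> H" for k
    proof -
      have "coord M B (f k) (act M (inv\<^bsub>G\<^esub> h) b) = coord M B (act M h (f k)) b"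
        using coord_act[OF M B act_B, of h "f k" "act M (inv\<^bsub>G\<^esub> h) b"] h k b fc gB[OF hi b] by simp
      moreover note f_mult[OF h k]
      ultimately show ?thesis using h k b fc by (simp add: coord_mult)
    qed
    then have "S (act M (inv\<^bsub>G\<^esub> h) b) =
        - (\<Sum>k\<in>H. coord M B (f (h \<otimes>\<^bsub>G\<^esub> k)) b) + coord M B (f h) b * int (card H)"
      by (simp add: S_def sum_subtractf)
    also have "(\<Sum>k\<in>H. coord M B (f (h \<otimes>\<^bsub>G\<^esub> k)) b) = (\<Sum>k\<in>H. coord M B (f k) b)"
      by (rule sum.reindex_bij_witness[of _ "\<lambda>k. inv\<^bsub>G\<^esub> h \<otimes>\<^bsub>G\<^esub> k" "\<lambda>k. h \<otimes>\<^bsub>G\<^esub> k"])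
        (use h in \<open>auto simp: G.m_assoc[symmetric] H.mem_carrier\<close>)
    finally show ?thesis by (simp add: S_def)
  qed
  have "f h = act M h m \<otimes>\<^bsub>M\<^esub> inv\<^bsub>M\<^esub> m" if h: "h \<in> H" for h
  proof (rule coord_eqI)
    fix b assume b: "b \<in> B"
    have b': "act M (inv\<^bsub>G\<^esub> h) b \<in> B" using gB h b by simp
    have "coord M B (act M h m) b = c (act M (inv\<^bsub>G\<^esub> h) b)"
      using coord_act[OF M B act_B, of h m "act M (inv\<^bsub>G\<^esub> h) b"] h b m b' coord_finprod[OF b', of c]
      by (simp add: m_def)
    also have "\<dots> = c b + coord M B (f h) b"
      using S[OF h b] cardH by (simp add: c_def)
    finally show "coord M B (f h) b = coord M B (act M h m \<otimes>\<^bsub>M\<^esub> inv\<^bsub>M\<^esub> m) b"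
      using b h m coord_finprod[OF b, of c] by (simp add: coord_mult coord_inv) (simp add: m_def)
  qed (use h m fc in auto)
  then show "\<exists>m\<in>carrier M. \<forall>h\<in>H. f h = act M h m \<otimes>\<^bsub>M\<^esub> inv\<^bsub>M\<^esub> m"
    by (intro bexI[OF _ m] ballI)
qed

lemma cocycles_split_iso:
  assumes M: "is_G_lattice G M" and N: "is_G_lattice G N"
    and e: "e \<in> equivariant_hom G M N" and bij: "bij_betw e (carrier M) (carrier N)"
    and split: "cocycles_split G M"
  shows "cocycles_split G N"
  unfolding cocycles_split_def
proof (intro allI impI)
  interpret M: G_lattice G M by unfold_locales fact
  interpret N: G_lattice G N by unfold_locales fact
  interpret group_hom M N e
    by unfold_locales (use e in \<open>simp add: equivariant_hom_def\<close>)
  have eact: "e (act M g x) = act N g (e x)" if "g \<in> carrier G" "x \<in> carrier M" for g x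
    using e that by (simp add: equivariant_hom_def)
  fix H f assume H: "subgroup H G" and f: "f \<in> carrier (cocycle_group G H N)"
  interpret H: subgroup H G by fact
  define k where "k = (\<lambda>h\<in>H. the_inv_into (carrier M) e (f h))"
  have inj: "inj_on e (carrier M)" and im: "e ` carrier M = carrier N"
    using bij by (auto simp: bij_betw_def)
  have k: "k h \<in> carrier M" "e (k h) = f h" if "h \<in> H" for h
  proof -
    have "f h \<in> e ` carrier M" using f that im by (auto simp: cocycle_iff)
    then show "k h \<in> carrier M" "e (k h) = f h"
      using the_inv_into_into[OF inj _ subset_refl] f_the_inv_into_f[OF inj] that by (auto simp: k_def)
  qed
  have "k (g \<otimes>\<^bsub>G\<^esub> h) = k g \<otimes>\<^bsub>M\<^esub> act M g (k h)" if gh: "g \<in> H" "h \<in> H" for g h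
  proof (rule inj_onD[OF inj])
    show "e (k (g \<otimes>\<^bsub>G\<^esub> h)) = e (k g \<otimes>\<^bsub>M\<^esub> act M g (k h))"
      using f gh k by (simp add: cocycle_iff eact)
  qed (use gh k in auto)
  then have "k \<in> carrier (cocycle_group G H M)"
    using k by (auto simp: cocycle_iff k_def)
  then obtain m where m: "m \<in> carrier M" "\<And>h. h \<in> H \<Longrightarrow> k h = act M h m \<otimes>\<^bsub>M\<^esub> inv\<^bsub>M\<^esub> m"
    using split H unfolding cocycles_split_def by blast
  have "f h = act N h (e m) \<otimes>\<^bsub>N\<^esub> inv\<^bsub>N\<^esub> e m" if h: "h \<in> H" for h
    using k(2)[OF h] m h by (simp add: eact)
  then show "\<exists>m\<in>carrier N. \<forall>h\<in>H. f h = act N h m \<otimes>\<^bsub>N\<^esub> inv\<^bsub>N\<^esub> m"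
    by (intro bexI[of _ "e m"] ballI) (use m(1) in simp_all)
qed

text \<open>
  Flasqueness of a dual is a statement about the double dual, to which cocycles are carried over by
  evaluation.
\<close>

corollary flasque_dual:
  assumes "is_G_lattice G M" "cocycles_split G M"
  shows "flasque G (dual_lattice G M)"
  unfolding flasque_def
proof (intro conjI coflasqueI)
  show D: "is_G_lattice G (dual_lattice G M)" by (rule is_G_lattice_dual[OF assms(1)])
  show DD: "is_G_lattice G (dual_lattice G (dual_lattice G M))" by (rule is_G_lattice_dual[OF D])
  show "cocycles_split G (dual_lattice G (dual_lattice G M))"
    by (rule cocycles_split_iso[OF assms(1) DD double_dual_iso[OF assms(1)] assms(2)])
qed


section \<open>Resolutions from surjections that lift invariants\<close>

lemma exact_lattices_precomp:
  assumes ex: "exact_lattices G A f B h C" and A': "is_G_lattice G A'"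
    and e: "e \<in> equivariant_hom G A' A" and bij: "bij_betw e (carrier A') (carrier A)"
    and f': "\<And>x. x \<in> carrier A' \<Longrightarrow> f' x = f (e x)"
  shows "exact_lattices G A' f' B h C"
proof -
  interpret A': G_lattice G A' by unfold_locales fact
  have f: "f \<in> equivariant_hom G A B" and inj: "inj_on f (carrier A)"
    and im: "f ` carrier A = kernel B C h"
    using ex by (auto simp: exact_lattices_def)
  have ec: "e x \<in> carrier A" if "x \<in> carrier A'" for x using bij that by (auto simp: bij_betw_def)
  have "f' \<in> equivariant_hom G A' B"
    using f e ec f' by (auto simp: equivariant_hom_def hom_def)
  moreover have "inj_on f' (carrier A')"
  proof (rule inj_onI)
    fix x y assume xy: "x \<in> carrier A'" "y \<in> carrier A'" "f' x = f' y"
    then have "e x = e y" using inj_onD[OF inj, of "e x" "e y"] ec f' by simp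
    then show "x = y" using inj_onD[OF bij_betw_imp_inj_on[OF bij]] xy by blast
  qed
  moreover have "f' ` carrier A' = kernel B C h"
  proof -
    have "f' ` carrier A' = f ` (e ` carrier A')" using f' by (simp add: image_image)
    then show ?thesis using bij im by (simp add: bij_betw_def)
  qed
  ultimately show ?thesis using ex A' by (simp add: exact_lattices_def)
qed

text \<open>
  A surjection of a permutation lattice \<open>P\<close> onto \<open>N\<close> which sends part \<open>A\<close> of the basis \<open>B\<close> of \<open>P\<close>
  bijectively onto a basis of \<open>N\<close>, so that the kernel visibly has a basis indexed by \<open>B - A\<close>, and
  under which every element of \<open>N\<close> has a preimage with (at least) the same symmetries.
\<close>

locale invariant_lifting =
  fixes G :: "('g, 'a) monoid_scheme" and P :: "('g, 'm) gmodule" and N :: "('g, 'n) gmodule"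
    and \<pi> :: "'m \<Rightarrow> 'n" and A B :: "'m set"
  assumes P: "is_G_lattice G P" and N: "is_G_lattice G N"
    and finite_group: "finite (carrier G)"
    and basis_P: "lattice_basis P B" and act_B: "\<And>g. g \<in> carrier G \<Longrightarrow> act P g ` B = B"
    and A_B: "A \<subseteq> B" and inj_A: "inj_on \<pi> A" and basis_N: "lattice_basis N (\<pi> ` A)"
    and \<pi>: "\<pi> \<in> equivariant_hom G P N"
    and lift: "\<And>x. x \<in> carrier N \<Longrightarrow>
      \<exists>p\<in>carrier P. \<pi> p = x \<and> (\<forall>g\<in>carrier G. act N g x = x \<longrightarrow> act P g p = p)"
begin

sublocale P: G_lattice G P by unfold_locales (fact P)
sublocale N: G_lattice G N by unfold_locales (fact N)
sublocale BP: based_lattice P B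
  by unfold_locales (fact basis_P)
sublocale BN: based_lattice N "\<pi> ` A"
  by unfold_locales (fact basis_N)
sublocale \<pi>: group_hom P N \<pi>
  by unfold_locales (use \<pi> in \<open>simp add: equivariant_hom_def\<close>)

abbreviation F :: "('g, 'm) gmodule" where "F \<equiv> P\<lparr>carrier := kernel P N \<pi>\<rparr>"

lemma \<pi>_act: "g \<in> carrier G \<Longrightarrow> x \<in> carrier P \<Longrightarrow> \<pi> (act P g x) = act N g (\<pi> x)"
  using \<pi> by (simp add: equivariant_hom_def)

lemma A_carrier [simp]: "a \<in> A \<Longrightarrow> a \<in> carrier P"
  using A_B BP.basis_carrier by blast

lemma permutation_P: "permutation_lattice G P"
  using P basis_P act_B by (auto simp: permutation_lattice_def)

lemma surj: "\<pi> ` carrier P = carrier N"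
  using lift by force

text \<open>A section of \<open>\<pi>\<close>, in general not equivariant.\<close>

definition sect :: "'n \<Rightarrow> 'm" where
  "sect = (SOME s. s \<in> hom N P \<and> (\<forall>a\<in>A. s (\<pi> a) = a))"

lemma sect_hom: "sect \<in> hom N P" and sect_A: "a \<in> A \<Longrightarrow> sect (\<pi> a) = a"
proof -
  obtain s where "s \<in> hom N P" "\<And>y. y \<in> \<pi> ` A \<Longrightarrow> s y = the_inv_into A \<pi> y"
    by (rule BN.hom_of_basis[OF P.M.comm_group_axioms, of "the_inv_into A \<pi>"])
      (auto simp: the_inv_into_f_f[OF inj_A])
  then have "s \<in> hom N P \<and> (\<forall>a\<in>A. s (\<pi> a) = a)"
    by (auto simp: the_inv_into_f_f[OF inj_A])
  then have "sect \<in> hom N P \<and> (\<forall>a\<in>A. sect (\<pi> a) = a)"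
    unfolding sect_def by (rule someI[where P = "\<lambda>s. s \<in> hom N P \<and> (\<forall>a\<in>A. s (\<pi> a) = a)"])
  then show "sect \<in> hom N P" "a \<in> A \<Longrightarrow> sect (\<pi> a) = a" by auto
qed

sublocale sect: group_hom N P sect
  by unfold_locales (fact sect_hom)

lemma \<pi>_sect: "y \<in> carrier N \<Longrightarrow> \<pi> (sect y) = y"
  by (rule BN.hom_eqI[OF N.M.comm_group_axioms, where h = "\<lambda>y. \<pi> (sect y)" and k = "\<lambda>y. y"])
    (auto simp: hom_def sect_A)

text \<open>The projection of \<open>P\<close> onto the kernel along the section.\<close>

definition retr :: "'m \<Rightarrow> 'm" where
  "retr x = x \<otimes>\<^bsub>P\<^esub> inv\<^bsub>P\<^esub> sect (\<pi> x)"

lemma retr_kernel: "x \<in> carrier P \<Longrightarrow> retr x \<in> kernel P N \<pi>"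
  by (simp add: retr_def kernel_def \<pi>_sect)

lemma retr_id: "x \<in> kernel P N \<pi> \<Longrightarrow> retr x = x"
  by (simp add: retr_def kernel_def)

lemma retr_mult: "x \<in> carrier P \<Longrightarrow> y \<in> carrier P \<Longrightarrow> retr (x \<otimes>\<^bsub>P\<^esub> y) = retr x \<otimes>\<^bsub>P\<^esub> retr y"
  by (simp add: retr_def P.M.inv_mult P.M.m_ac)

lemma kernel_in: "x \<in> kernel P N \<pi> \<Longrightarrow> x \<in> carrier P"
  by (simp add: kernel_def)

lemma comm_group_F: "comm_group F"
proof -
  have "group F" using P.M.subgroup_imp_group[OF \<pi>.subgroup_kernel] .
  then show ?thesis
    by (rule group.group_comm_groupI) (auto simp: P.M.m_comm kernel_def)
qed

lemma inv_F: "x \<in> kernel P N \<pi> \<Longrightarrow> inv\<^bsub>F\<^esub> x = inv\<^bsub>P\<^esub> x"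
  using P.M.m_inv_consistent[OF \<pi>.subgroup_kernel] .

lemma coord_sect:
  assumes "y \<in> carrier N" "b \<in> B - A"
  shows "coord P B (sect y) b = 0"
  by (rule BN.hom_eqI[OF abelian_integer_group, where h = "\<lambda>y. coord P B (sect y) b" and k = "\<lambda>y. 0"])
    (use assms A_B in \<open>auto simp: hom_def BP.coord_mult sect_A BP.coord_basis subset_iff\<close>)

text \<open>
  Projecting the remaining basis vectors \<open>B - A\<close> to the kernel changes only their coordinates in \<open>A\<close>,
  so the coordinates at \<open>B - A\<close> remain dual to them; an element of the kernel whose coordinates
  there vanish is in the image of the section, hence trivial.
\<close>

lemma lattice_basis_F: "lattice_basis F (retr ` (B - A))"
proof (rule lattice_basisI[where d = "\<lambda>b x. coord P B x b"])
  show "comm_group F" by (fact comm_group_F)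
  show "finite (B - A)" by simp
  show "retr b \<in> carrier F" if "b \<in> B - A" for b using that retr_kernel by simp
  show "(\<lambda>x. coord P B x b) \<in> hom F integer_group" if "b \<in> B - A" for b
    using that by (auto simp: hom_def BP.coord_mult kernel_def)
  show "coord P B (retr b') b = (if b = b' then 1 else 0)" if "b \<in> B - A" "b' \<in> B - A" for b b'
    using that by (simp add: retr_def BP.coord_mult BP.coord_inv coord_sect BP.coord_basis)
next
  fix x assume x: "x \<in> carrier F" and 0: "\<And>b. b \<in> B - A \<Longrightarrow> coord P B x b = 0"
  from x have xP: "x \<in> carrier P" and x1: "\<pi> x = \<one>\<^bsub>N\<^esub>" by (simp_all add: kernel_def)
  have hom: "(\<lambda>x. sect (\<pi> x)) \<in> hom P P" by (auto simp: hom_def)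
  have "x = finprod P (\<lambda>b. b [^]\<^bsub>P\<^esub> coord P B x b) B"
    using BP.coord_expand[OF xP] by simp
  also have "\<dots> = finprod P (\<lambda>b. sect (\<pi> b) [^]\<^bsub>P\<^esub> coord P B x b) B"
  proof (rule P.M.finprod_cong')
    fix b assume "b \<in> B"
    then show "b [^]\<^bsub>P\<^esub> coord P B x b = sect (\<pi> b) [^]\<^bsub>P\<^esub> coord P B x b"
      by (cases "b \<in> A") (simp_all add: 0 sect_A)
  qed auto
  also have "\<dots> = sect (\<pi> x)"
    using BP.hom_expand[OF P.M.comm_group_axioms hom xP] by simp
  finally show "x = \<one>\<^bsub>F\<^esub>" using x1 by simp
qed

lemma is_G_lattice_F: "is_G_lattice G F"
  unfolding is_G_lattice_def
proof (intro conjI ballI)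
  show "\<exists>B. lattice_basis F B" using lattice_basis_F by blast
  show "act F g \<in> hom F F" if "g \<in> carrier G" for g
    using that by (auto simp: hom_def kernel_def P.act_mult \<pi>_act)
qed (auto simp: P.G.group_axioms comm_group_F P.act_comp kernel_in)

text \<open>
  A cocycle with values in the kernel is the coboundary of some \<open>p\<close> in the permutation lattice;
  then \<open>\<pi> p\<close> is invariant, and correcting \<open>p\<close> by an invariant preimage moves it into the kernel.
\<close>

lemma cocycles_split_F: "cocycles_split G F"
  unfolding cocycles_split_def
proof (intro allI impI)
  fix H f assume H: "subgroup H G" and f: "f \<in> carrier (cocycle_group G H F)"
  interpret H: subgroup H G by fact
  have fF: "f h \<in> kernel P N \<pi>" if "h \<in> H" for h
    using f that by (auto simp: cocycle_iff)
  have "f \<in> carrier (cocycle_group G H P)"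
    using f by (auto simp: cocycle_iff kernel_def)
  then obtain p where p: "p \<in> carrier P" and fp: "\<And>h. h \<in> H \<Longrightarrow> f h = act P h p \<otimes>\<^bsub>P\<^esub> inv\<^bsub>P\<^esub> p"
    using cocycles_split_permutation_lattice[OF permutation_P finite_group] H
    unfolding cocycles_split_def by blast
  have inv_p: "act N h (\<pi> p) = \<pi> p" if h: "h \<in> H" for h
  proof -
    have "\<one>\<^bsub>N\<^esub> = \<pi> (f h)" using fF[OF h] by (simp add: kernel_def)
    also have "\<dots> = act N h (\<pi> p) \<otimes>\<^bsub>N\<^esub> inv\<^bsub>N\<^esub> \<pi> p" using fp h p by (simp add: \<pi>_act)
    finally show ?thesis using h p by (metis H.mem_carrier N.M.inv_equality N.M.inv_inv N.M.inv_closed N.act_closed \<pi>.hom_closed)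
  qed
  obtain q where q: "q \<in> carrier P" "\<pi> q = \<pi> p" and q_inv: "\<And>h. h \<in> H \<Longrightarrow> act P h q = q"
    using lift[of "\<pi> p"] p inv_p H.mem_carrier by (metis \<pi>.hom_closed)
  let ?m = "p \<otimes>\<^bsub>P\<^esub> inv\<^bsub>P\<^esub> q"
  have m: "?m \<in> kernel P N \<pi>" using p q by (simp add: kernel_def)
  have "f h = act F h ?m \<otimes>\<^bsub>F\<^esub> inv\<^bsub>F\<^esub> ?m" if h: "h \<in> H" for h
  proof -
    have hp: "act P h p \<in> carrier P" using h p by simp
    have "act P h ?m \<otimes>\<^bsub>P\<^esub> inv\<^bsub>P\<^esub> ?m = (act P h p \<otimes>\<^bsub>P\<^esub> inv\<^bsub>P\<^esub> q) \<otimes>\<^bsub>P\<^esub> (q \<otimes>\<^bsub>P\<^esub> inv\<^bsub>P\<^esub> p)"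
      using h p q q_inv[OF h] by (simp add: P.act_mult P.act_inv P.M.inv_mult P.M.m_comm)
    also have "\<dots> = act P h p \<otimes>\<^bsub>P\<^esub> inv\<^bsub>P\<^esub> p"
      using P.M.mult_inv_cancel_middle[of q "act P h p" q] hp p q
      by (metis P.M.inv_closed P.M.m_assoc P.M.m_closed P.M.l_inv P.M.l_one)
    finally show ?thesis using fp[OF h] inv_F[OF m] by simp
  qed
  then show "\<exists>m\<in>carrier F. \<forall>h\<in>H. f h = act F h m \<otimes>\<^bsub>F\<^esub> inv\<^bsub>F\<^esub> m"
    by (intro bexI[of _ ?m] ballI) (use m in simp_all)
qed

theorem coflasque_resolution_kernel: "coflasque_resolution G F (\<lambda>f. f) P \<pi> N"
proof -
  have "(\<lambda>f. f) \<in> equivariant_hom G F P"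
    by (auto simp: equivariant_hom_def hom_def kernel_in)
  then show ?thesis
    unfolding coflasque_resolution_def exact_lattices_def
    using is_G_lattice_F P N \<pi> surj permutation_P coflasqueI[OF is_G_lattice_F cocycles_split_F]
    by simp
qed

text \<open>
  The sequence splits as a sequence of groups: the section and the projection onto the kernel extend
  functions from the kernel to \<open>P\<close> and push functions that vanish on the kernel down to \<open>N\<close>.
\<close>

lemma exact_dual:
  "exact_lattices G (dual_lattice G N) (\<lambda>f. \<lambda>p\<in>carrier P. f (\<pi> p)) (dual_lattice G P)
     (\<lambda>f. restrict f (carrier F)) (dual_lattice G F)"
  (is "exact_lattices G ?N' ?i ?P' ?r ?F'")
  unfolding exact_lattices_def
proof (intro conjI)
  show "is_G_lattice G ?N'" "is_G_lattice G ?P'" "is_G_lattice G ?F'"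
    using is_G_lattice_dual P N is_G_lattice_F by blast+
  have i: "?i f \<in> carrier ?P'" if "f \<in> carrier ?N'" for f
    using that by (auto simp: hom_def)
  have r: "?r f \<in> carrier ?F'" if "f \<in> carrier ?P'" for f
  proof -
    have "x \<otimes>\<^bsub>P\<^esub> y \<in> kernel P N \<pi>" if "x \<in> kernel P N \<pi>" "y \<in> kernel P N \<pi>" for x y
      using that by (auto simp: kernel_def)
    then show ?thesis using that by (auto simp: hom_def kernel_in)
  qed
  show "?i \<in> equivariant_hom G ?N' ?P'"
    unfolding equivariant_hom_def
  proof (intro CollectI conjI ballI)
    show "?i \<in> hom ?N' ?P'"
      by (rule homI) (use i in \<open>auto intro!: restrict_ext\<close>)
    fix g f assume "g \<in> carrier G" "f \<in> carrier ?N'"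
    then show "?i (act ?N' g f) = act ?P' g (?i f)"
      by (auto intro!: restrict_ext simp: \<pi>_act)
  qed
  show "?r \<in> equivariant_hom G ?P' ?F'"
    unfolding equivariant_hom_def
  proof (intro CollectI conjI ballI)
    show "?r \<in> hom ?P' ?F'"
    proof (rule homI)
      fix f f' assume "f \<in> carrier ?P'" "f' \<in> carrier ?P'"
      show "?r (f \<otimes>\<^bsub>?P'\<^esub> f') = ?r f \<otimes>\<^bsub>?F'\<^esub> ?r f'"
        by (rule ext) (simp add: kernel_in)
    qed (fact r)
    fix g f assume g: "g \<in> carrier G" and "f \<in> carrier ?P'"
    have "act P (inv\<^bsub>G\<^esub> g) x \<in> kernel P N \<pi>" if "x \<in> kernel P N \<pi>" for x
      using that g by (simp add: kernel_def \<pi>_act)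
    then show "?r (act ?P' g f) = act ?F' g (?r f)"
      by (intro ext) (simp add: kernel_in)
  qed
  show "inj_on ?i (carrier ?N')"
  proof (rule inj_onI)
    fix f f' assume f: "f \<in> carrier ?N'" "f' \<in> carrier ?N'" and eq: "?i f = ?i f'"
    have "f y = f' y" if "y \<in> carrier N" for y
      using fun_cong[OF eq, of "sect y"] that by (simp add: \<pi>_sect)
    then show "f = f'" using f by (intro extensionalityI[of f "carrier N"]) simp_all
  qed
  show "?i ` carrier ?N' = kernel ?P' ?F' ?r"
  proof (intro equalityI subsetI)
    fix \<phi> assume "\<phi> \<in> ?i ` carrier ?N'"
    then obtain f where f: "f \<in> carrier ?N'" and \<phi>: "\<phi> = ?i f" by blast
    interpret f: group_hom N integer_group f
      using f by (simp add: group_hom_def group_hom_axioms_def N.M.group_axioms)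
    have "f \<one>\<^bsub>N\<^esub> = 0" using f.hom_one by simp
    then have "?r \<phi> = \<one>\<^bsub>?F'\<^esub>"
      unfolding \<phi> by (auto intro!: restrict_ext simp: kernel_def)
    then show "\<phi> \<in> kernel ?P' ?F' ?r" using i[OF f] unfolding kernel_def \<phi> by simp
  next
    fix \<phi> assume "\<phi> \<in> kernel ?P' ?F' ?r"
    then have \<phi>: "\<phi> \<in> carrier ?P'" and \<phi>0: "?r \<phi> = (\<lambda>x\<in>carrier F. 0)"
      by (simp_all add: kernel_def)
    have \<phi>F: "\<phi> x = 0" if "x \<in> kernel P N \<pi>" for x
      using fun_cong[OF \<phi>0, of x] that by simp
    interpret \<phi>: group_hom P integer_group \<phi>
      using \<phi> by (simp add: group_hom_def group_hom_axioms_def P.M.group_axioms)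
    let ?f = "\<lambda>y\<in>carrier N. \<phi> (sect y)"
    have f: "?f \<in> carrier ?N'" using \<phi>.hom_mult by (auto simp: hom_def)
    have if_eq: "?i ?f = \<phi>"
    proof (rule extensionalityI[of _ "carrier P"])
      fix x assume x: "x \<in> carrier P"
      have "0 = \<phi> (retr x)" using \<phi>F[OF retr_kernel[OF x]] by simp
      also have "\<dots> = \<phi> x - \<phi> (sect (\<pi> x))"
        unfolding retr_def using x \<phi>.hom_mult[of x "inv\<^bsub>P\<^esub> sect (\<pi> x)"] by (simp add: \<phi>.hom_inv)
      finally show "?i ?f x = \<phi> x" using x by simp
    qed (use \<phi> in simp_all)
    show "\<phi> \<in> ?i ` carrier ?N'"
      by (rule image_eqI[where f = ?i, OF if_eq[symmetric] f])
  qed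
  show "?r ` carrier ?P' = carrier ?F'"
  proof (intro equalityI subsetI)
    fix f assume f: "f \<in> carrier ?F'"
    let ?\<phi> = "\<lambda>x\<in>carrier P. f (retr x)"
    have "f (x \<otimes>\<^bsub>P\<^esub> y) = f x + f y" if "x \<in> kernel P N \<pi>" "y \<in> kernel P N \<pi>" for x y
      using f that by (auto simp: hom_def)
    then have \<phi>: "?\<phi> \<in> carrier ?P'"
      using retr_kernel by (auto simp: hom_def retr_mult)
    have r\<phi>: "?r ?\<phi> = f"
      by (rule extensionalityI[of _ "carrier F", OF restrict_extensional])
        (use f in \<open>simp_all add: retr_id kernel_in\<close>)
    show "f \<in> ?r ` carrier ?P'"
      by (rule image_eqI[where f = ?r, OF r\<phi>[symmetric] \<phi>])
  next
    fix f assume "f \<in> ?r ` carrier ?P'"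
    then show "f \<in> carrier ?F'" by (elim imageE) (simp only: r)
  qed
qed

text \<open>The dual resolution, with the dual of \<open>N\<close> presented as some isomorphic lattice \<open>L\<close>.\<close>

theorem flasque_resolution_dual:
  assumes L: "is_G_lattice G L"
    and e: "e \<in> equivariant_hom G L (dual_lattice G N)"
    and bij: "bij_betw e (carrier L) (carrier (dual_lattice G N))"
    and i: "\<And>l. l \<in> carrier L \<Longrightarrow> i l = (\<lambda>p\<in>carrier P. e l (\<pi> p))"
  shows "flasque_resolution G L i (dual_lattice G P) (\<lambda>f. restrict f (carrier F)) (dual_lattice G F)"
  unfolding flasque_resolution_def
proof (intro conjI)
  show "exact_lattices G L i (dual_lattice G P) (\<lambda>f. restrict f (carrier F)) (dual_lattice G F)"
    by (rule exact_lattices_precomp[OF exact_dual L e bij]) (simp add: i)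
  show "permutation_lattice G (dual_lattice G P)"
    by (rule permutation_lattice_dual[OF permutation_P])
  show "flasque G (dual_lattice G F)"
    by (rule flasque_dual[OF is_G_lattice_F cocycles_split_F])
qed

end


section \<open>Signed permutations of the coordinates\<close>

lemma UNIV_5: "(UNIV :: 5 set) = {0, 1, 2, 3, 4}"
proof -
  have "x \<in> {0, 1, 2, 3, 4}" for x :: 5
  proof (induct x)
    case (of_int z)
    then have "z = 0 \<or> z = 1 \<or> z = 2 \<or> z = 3 \<or> z = 4" by fastforce
    then show ?case by auto
  qed
  then show ?thesis by auto
qed

lemma forall_5: "(\<forall>i::5. P i) \<longleftrightarrow> P 0 \<and> P 1 \<and> P 2 \<and> P 3 \<and> P 4"
proof -
  have "(\<forall>i::5. P i) \<longleftrightarrow> (\<forall>i\<in>UNIV. P i)" by simp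
  then show ?thesis unfolding UNIV_5 by simp
qed

lemma sum_5: "sum f (UNIV :: 5 set) = f 0 + f 1 + f 2 + f 3 + f 4"
  unfolding UNIV_5 by (simp add: add.assoc)

lemma evec_nth: "evec i $ j = (if of_nat i = j then 1 else 0)"
  by (simp add: evec_def axis_def)

lemma bij_perm: "p permutes (UNIV :: 5 set) \<longleftrightarrow> bij p"
  by (rule iffI, erule permutes_bij, rule bij_imp_permutes) auto

definition sperm :: "real \<Rightarrow> (5 \<Rightarrow> 5) \<Rightarrow> real^5 \<Rightarrow> real^5" where
  "sperm e p x = e *\<^sub>R perm_map p x"

lemma sperm_nth: "sperm e p x $ i = e * x $ inv' p i"
  by (simp add: sperm_def perm_map_def)

lemma sperm_nth': "bij p \<Longrightarrow> sperm e p x $ p i = e * x $ i"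
  by (simp add: sperm_nth bij_is_inj)

lemma sperm_comp: "bij p \<Longrightarrow> bij q \<Longrightarrow> sperm e p (sperm f q x) = sperm (e * f) (p \<circ> q) x"
  by (simp add: vec_eq_iff sperm_nth o_inv_distrib)

lemma sperm_1_id [simp]: "sperm 1 id = id" "sperm 1 (\<lambda>x. x) = id"
  by (auto simp: vec_eq_iff sperm_nth inv_id[unfolded id_def] fun_eq_iff)

lemma sperm_inverse:
  assumes "bij p" "e \<in> {1, -1}"
  shows "sperm e p (sperm e (inv' p) x) = x" "sperm e (inv' p) (sperm e p x) = x"
proof -
  have "bij (inv' p)" "p \<circ> inv' p = id" "inv' p \<circ> p = id"
    using assms(1) by (auto simp: bij_imp_bij_inv bij_is_surj bij_is_inj fun_eq_iff surj_f_inv_f)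
  then show "sperm e p (sperm e (inv' p) x) = x" "sperm e (inv' p) (sperm e p x) = x"
    using assms by (auto simp: sperm_comp)
qed

lemma sperm_inj: "sperm e p = sperm f q \<Longrightarrow> bij p \<Longrightarrow> bij q \<Longrightarrow> e \<in> {1, -1} \<Longrightarrow> f \<in> {1, -1} \<Longrightarrow>
    e = f \<and> p = q"
proof (intro conjI ext)
  assume eq: "sperm e p = sperm f q" and bij: "bij p" "bij q" and ef: "e \<in> {1, -1}" "f \<in> {1, -1}"
  have *: "e * (if i = j then 1 else 0) = f * (if q i = p j then 1 else 0)" for i j
  proof -
    have "sperm e p (axis i 1) $ p j = sperm f q (axis i 1) $ p j" by (simp add: eq)
    moreover have "j = i \<longleftrightarrow> i = j" "inv' q (p j) = i \<longleftrightarrow> q i = p j"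
      using bij(2) bij_inv_eq_iff[of q i "p j"] by auto
    ultimately show ?thesis using bij by (simp add: sperm_nth axis_def bij_is_inj)
  qed
  show "e = f" using *[of 0 0] ef by (auto split: if_splits)
  show "p i = q i" for i using *[of i i] ef by (auto split: if_splits)
qed

lemma sperm_bij: "bij p \<Longrightarrow> e \<in> {1, -1} \<Longrightarrow> bij (sperm e p)"
  by (rule bij_betw_byWitness[where f' = "sperm e (inv' p)"]) (auto simp: sperm_inverse)

lemma sperm_linear: "linear (sperm e p)"
  by (rule linearI) (auto simp: vec_eq_iff sperm_nth algebra_simps)

lemma sperm_inner:
  assumes "bij p" "e \<in> {1, -1}"
  shows "inner (sperm e p x) (sperm e p y) = inner x y"
proof -
  have "inner (sperm e p x) (sperm e p y) = (\<Sum>i\<in>UNIV. x $ inv' p i * y $ inv' p i)"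
    using assms(2) by (auto simp: inner_vec_def sperm_nth)
  also have "\<dots> = (\<Sum>i\<in>UNIV. x $ i * y $ i)"
    by (rule sum.reindex_bij_betw) (rule bij_imp_bij_inv[OF assms(1)])
  finally show ?thesis by (simp add: inner_vec_def)
qed

lemma sum_nth_perm:
  assumes "bij p"
  shows "(\<Sum>i\<in>UNIV. f (x $ inv' p i)) = (\<Sum>i\<in>UNIV. f (x $ (i::5)))"
  by (rule sum.reindex_bij_betw[where h = "inv' p" and g = "\<lambda>i. f (x $ i)"])
    (rule bij_imp_bij_inv[OF assms(1)])


subsection \<open>The automorphism group of the root system\<close>

lemma BijGroup_UNIV_simps:
  "carrier (BijGroup UNIV) = {f. bij f}"
  "\<one>\<^bsub>BijGroup UNIV\<^esub> = id"
  "bij f \<Longrightarrow> bij g \<Longrightarrow> f \<otimes>\<^bsub>BijGroup UNIV\<^esub> g = f \<circ> g"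
  by (auto simp: BijGroup_def Bij_def compose_def fun_eq_iff)

lemma inv_BijGroup_UNIV: "bij f \<Longrightarrow> inv\<^bsub>BijGroup UNIV\<^esub> f = inv' f"
  by (subst inv_BijGroup) (auto simp: Bij_def)

text \<open>
  Signed permutations are closed under composition and inversion because the sign commutes with
  permutations, so the generated group contains nothing else.
\<close>

lemma carrier_Aut: "carrier Aut_A4 = {sperm e p | e p. e \<in> {1, -1} \<and> bij p}" (is "_ = ?S")
proof -
  let ?B = "BijGroup UNIV :: (real^5 \<Rightarrow> real^5) monoid"
  let ?gen = "perm_map ` {p. p permutes UNIV} \<union> {uminus}"
  interpret B: group ?B by (rule group_BijGroup)
  have pm: "perm_map p = sperm 1 p" for p by (auto simp: sperm_def fun_eq_iff)
  have um: "uminus = sperm (-1) id" by (auto simp: vec_eq_iff sperm_nth fun_eq_iff)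
  have gen: "?gen \<subseteq> ?S"
    unfolding pm um by (auto simp: bij_perm) 
  have comp: "sperm e p \<circ> sperm f q = sperm (e * f) (p \<circ> q)" if "bij p" "bij q" for e f p q
    using that by (auto simp: sperm_comp)
  have "subgroup ?S ?B"
  proof (rule B.subgroupI)
    show "?S \<subseteq> carrier ?B" by (auto simp: BijGroup_UNIV_simps sperm_bij)
    show "?S \<noteq> {}" using bij_id by blast
    fix a assume "a \<in> ?S"
    then obtain e p where a: "a = sperm e p" "e \<in> {1, -1}" "bij p" by blast
    have "inv' a = sperm e (inv' p)"
      using a sperm_inverse[of p e] by (intro inv_unique_comp) (auto simp: fun_eq_iff)
    moreover have "inv\<^bsub>?B\<^esub> a = inv' a" using a by (simp only: inv_BijGroup_UNIV sperm_bij)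
    ultimately show "inv\<^bsub>?B\<^esub> a \<in> ?S" using a(2) bij_imp_bij_inv[OF a(3)] by auto
  next
    fix a b assume "a \<in> ?S" "b \<in> ?S"
    then obtain e p f q where a: "a = sperm e p" "e \<in> {1, -1}" "bij p"
      and b: "b = sperm f q" "f \<in> {1, -1}" "bij q" by blast
    then have "a \<otimes>\<^bsub>?B\<^esub> b = sperm (e * f) (p \<circ> q)" "e * f \<in> {1, -1}" "bij (p \<circ> q)"
      by (auto simp: BijGroup_UNIV_simps sperm_bij comp bij_comp)
    then show "a \<otimes>\<^bsub>?B\<^esub> b \<in> ?S" by blast
  qed
  then have "generate ?B ?gen \<subseteq> ?S" using B.generate_subgroup_incl[OF gen] by blast
  moreover have "?S \<subseteq> generate ?B ?gen"
  proof
    fix a assume "a \<in> ?S"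
    then obtain e p where a: "a = sperm e p" "e \<in> {1, -1}" "bij p" by blast
    have p: "sperm 1 p \<in> generate ?B ?gen"
      using a(3) by (intro generate.incl) (auto simp: pm bij_perm)
    have "sperm (-1) id \<otimes>\<^bsub>?B\<^esub> sperm 1 p \<in> generate ?B ?gen"
      by (rule generate.eng[OF _ p], rule generate.incl) (simp add: um)
    then show "a \<in> generate ?B ?gen"
      using a p by (auto simp: BijGroup_UNIV_simps sperm_bij comp)
  qed
  ultimately show ?thesis by (simp add: Aut_A4_def)
qed

lemma AutE:
  assumes "g \<in> carrier Aut_A4"
  obtains e p where "g = sperm e p" "e \<in> {1, -1}" "bij p"
  using assms by (auto simp: carrier_Aut)

lemma sperm_in_Aut: "e \<in> {1, -1} \<Longrightarrow> bij p \<Longrightarrow> sperm e p \<in> carrier Aut_A4"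
  by (auto simp: carrier_Aut)

lemma Aut_bij: "g \<in> carrier Aut_A4 \<Longrightarrow> bij g"
  by (auto elim!: AutE intro: sperm_bij)

lemma group_Aut: "group Aut_A4"
proof -
  interpret B: group "BijGroup UNIV :: (real^5 \<Rightarrow> real^5) monoid" by (rule group_BijGroup)
  show ?thesis unfolding Aut_A4_def
    by (rule B.subgroup_imp_group, rule B.generate_is_subgroup)
      (auto simp: BijGroup_UNIV_simps bij_perm sperm_bij[of _ 1, unfolded sperm_def, simplified] bij_uminus)
qed

lemma Aut_mult: "g \<in> carrier Aut_A4 \<Longrightarrow> h \<in> carrier Aut_A4 \<Longrightarrow> g \<otimes>\<^bsub>Aut_A4\<^esub> h = g \<circ> h"
  using Aut_bij by (simp add: Aut_A4_def BijGroup_UNIV_simps)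

lemma Aut_one: "\<one>\<^bsub>Aut_A4\<^esub> = id"
  by (simp add: Aut_A4_def BijGroup_UNIV_simps)

lemma Aut_inv: "g \<in> carrier Aut_A4 \<Longrightarrow> (inv\<^bsub>Aut_A4\<^esub> g) (g x) = x" "g \<in> carrier Aut_A4 \<Longrightarrow> g ((inv\<^bsub>Aut_A4\<^esub> g) x) = x"
proof -
  assume g: "g \<in> carrier Aut_A4"
  interpret group Aut_A4 by (rule group_Aut)
  show "(inv\<^bsub>Aut_A4\<^esub> g) (g x) = x" "g ((inv\<^bsub>Aut_A4\<^esub> g) x) = x"
    using l_inv[OF g] r_inv[OF g] g by (simp_all add: Aut_mult Aut_one fun_eq_iff)
qed

lemma Aut_linear: "g \<in> carrier Aut_A4 \<Longrightarrow> linear g"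
  by (auto elim!: AutE intro: sperm_linear)

lemma Aut_inner: "g \<in> carrier Aut_A4 \<Longrightarrow> inner (g x) (g y) = inner x y"
  by (auto elim!: AutE simp: sperm_inner)

lemma finite_Aut: "finite (carrier Aut_A4)"
proof -
  have "carrier Aut_A4 \<subseteq> (\<lambda>(e, p). sperm e p) ` ({1, -1} \<times> {p. p permutes UNIV})"
    by (auto simp: carrier_Aut bij_perm)
  then show ?thesis
    by (rule finite_subset) (intro finite_imageI finite_cartesian_product finite_permutations finite, auto)
qed


section \<open>The root lattice and the weight lattice\<close>

lemma vec_group_simps [simp]:
  "carrier (vec_group S) = S" "x \<otimes>\<^bsub>vec_group S\<^esub> y = x + y" "\<one>\<^bsub>vec_group S\<^esub> = 0"
  by (simp_all add: vec_group_def)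

lemma with_act_simps [simp]:
  "carrier (with_act M a) = carrier M" "x \<otimes>\<^bsub>with_act M a\<^esub> y = x \<otimes>\<^bsub>M\<^esub> y"
  "\<one>\<^bsub>with_act M a\<^esub> = \<one>\<^bsub>M\<^esub>" "act (with_act M a) = a"
  by (simp_all add: with_act_def)

lemma comm_group_vec:
  assumes "0 \<in> carrier M" "\<And>x y. x \<in> carrier M \<Longrightarrow> y \<in> carrier M \<Longrightarrow> x + y \<in> carrier M"
    "\<And>x. x \<in> carrier M \<Longrightarrow> - x \<in> carrier M"
    and "\<And>x y. x \<otimes>\<^bsub>M\<^esub> y = x + y" "\<one>\<^bsub>M\<^esub> = (0 :: real^5)"
  shows "comm_group M"
proof (rule comm_groupI)
  fix x assume "x \<in> carrier M"
  then show "\<exists>y\<in>carrier M. y \<otimes>\<^bsub>M\<^esub> x = \<one>\<^bsub>M\<^esub>"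
    using assms by (intro bexI[of _ "- x"]) auto
qed (use assms in \<open>auto simp: add_ac\<close>)

lemma group_vec_UNIV: "group (vec_group UNIV)"
  by (rule comm_group.axioms(2), rule comm_group_vec) auto

lemma inv_vec_UNIV: "inv\<^bsub>vec_group UNIV\<^esub> x = - x"
  by (rule group.inv_equality[OF group_vec_UNIV]) auto

definition intvec :: "(real^5) set" where
  "intvec = {x. (\<forall>i. x $ i \<in> \<int>) \<and> (\<Sum>i\<in>UNIV. x $ i) = 0}"

text \<open>The roots \<open>e\<^sub>k - e\<^sub>5\<close>, in which vectors have their own coordinates; the residue of \<open>5\<close> is \<open>0\<close>.\<close>

definition basis_root :: "5 \<Rightarrow> real^5" where
  "basis_root k = axis k 1 - axis 0 1"

lemma roots_eq: "roots_A4 = {axis i 1 - axis j 1 | i j. i \<noteq> j}"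
proof -
  have ev: "evec ` {1..5} = range (\<lambda>i. axis i 1)"
  proof -
    have "{1..5::nat} = {1, 2, 3, 4, 5}" by auto
    moreover have "axis (5 :: 5) (1 :: real) = axis 0 1" by (simp add: axis_eq_axis)
    ultimately show ?thesis unfolding UNIV_5 by (auto simp: evec_def)
  qed
  have inj: "evec i = evec j \<longleftrightarrow> i = j" if "i \<in> {1..5}" "j \<in> {1..5}" for i j
  proof -
    have "of_nat i = (of_nat j :: 5) \<longleftrightarrow> i = j"
    proof -
      have "i = 1 \<or> i = 2 \<or> i = 3 \<or> i = 4 \<or> i = 5" "j = 1 \<or> j = 2 \<or> j = 3 \<or> j = 4 \<or> j = 5"
        using that unfolding atLeastAtMost_iff by presburger+
      then show ?thesis by auto
    qed
    then show ?thesis by (auto simp: evec_def axis_eq_axis)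
  qed
  show ?thesis
  proof (intro equalityI subsetI)
    fix x assume "x \<in> roots_A4"
    then obtain i j where "x = evec i - evec j" "i \<in> {1..5}" "j \<in> {1..5}" "i \<noteq> j"
      by (auto simp: roots_A4_def)
    moreover from this have "evec i \<noteq> evec j" using inj by simp
    ultimately show "x \<in> {axis i 1 - axis j 1 | i j. i \<noteq> j}"
      by (intro CollectI exI[of _ "of_nat i"] exI[of _ "of_nat j"]) (auto simp: evec_def)
  next
    fix x :: "real^5" assume "x \<in> {axis i 1 - axis j 1 | i j. i \<noteq> (j::5)}"
    then obtain i j :: 5 where x: "x = axis i 1 - axis j 1" "i \<noteq> j" by blast
    have "axis i 1 \<in> evec ` {1..5}" "axis j 1 \<in> evec ` {1..5}" unfolding ev by (rule rangeI)+
    then obtain k l where kl: "k \<in> {1..5}" "axis i 1 = evec k" "l \<in> {1..5}" "axis j 1 = evec l"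
      by blast
    then have "axis i (1 :: real) = axis j 1" if "k = l" using that by simp
    then have "k \<noteq> l" using x(2) by (auto simp: axis_eq_axis)
    then show "x \<in> roots_A4" unfolding roots_A4_def using x kl by auto
  qed
qed

lemma basis_root_in: "k \<noteq> 0 \<Longrightarrow> basis_root k \<in> roots_A4"
  by (auto simp: roots_eq basis_root_def)

lemma sum_axis [simp]: "(\<Sum>i\<in>UNIV. axis k (c::real) $ i) = c"
  by (simp add: axis_def if_distrib cong: if_cong)

lemma intvec_expand:
  assumes "(\<Sum>i\<in>UNIV. x $ i) = 0"
  shows "x = (\<Sum>k\<in>UNIV - {0}. x $ k *\<^sub>R basis_root k)"
proof -
  have U: "UNIV - {0} = {1, 2, 3, 4 :: 5}" unfolding UNIV_5 by auto
  show ?thesis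
    using assms unfolding U vec_eq_iff forall_5 sum_5
    by (simp add: basis_root_def axis_def)
qed

lemma carrier_ZA4: "carrier ZA4 = intvec"
proof -
  let ?V = "vec_group UNIV :: (real^5) monoid"
  interpret V: group ?V by (rule group_vec_UNIV)
  have S: "subgroup intvec ?V"
    by (rule V.subgroupI)
      (auto simp: intvec_def inv_vec_UNIV sum_negf sum.distrib intro!: exI[of _ 0])
  have "roots_A4 \<subseteq> intvec"
    by (auto simp: roots_eq intvec_def sum_subtractf) (auto simp: axis_def)
  then have "generate ?V roots_A4 \<subseteq> intvec"
    by (rule V.generate_subgroup_incl[OF _ S])
  moreover have "intvec \<subseteq> generate ?V roots_A4"
  proof
    have gen: "subgroup (generate ?V roots_A4) ?V" by (rule V.generate_is_subgroup) simp
    then have add: "x + y \<in> generate ?V roots_A4"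
      if "x \<in> generate ?V roots_A4" "y \<in> generate ?V roots_A4" for x y
      using subgroup.m_closed[OF gen that] by simp
    have neg: "- x \<in> generate ?V roots_A4" if "x \<in> generate ?V roots_A4" for x
      using subgroup.m_inv_closed[OF gen that] by (simp add: inv_vec_UNIV)
    have zero: "0 \<in> generate ?V roots_A4" using subgroup.one_closed[OF gen] by simp
    have nmult: "real n *\<^sub>R x \<in> generate ?V roots_A4" if "x \<in> generate ?V roots_A4" for n x
      by (induction n) (use that add zero in \<open>auto simp: scaleR_add_left\<close>)
    have zmult: "c *\<^sub>R x \<in> generate ?V roots_A4" if "x \<in> generate ?V roots_A4" "c \<in> \<int>" for c x
    proof -
      from that(2) obtain z where c: "c = of_int z" by (auto elim: Ints_cases)
      show ?thesis
      proof (cases z)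
        case (nonneg n) then show ?thesis using nmult[OF that(1), of n] c by simp
      next
        case (neg n)
        then have "c *\<^sub>R x = - (real (Suc n) *\<^sub>R x)" unfolding c neg
          by (metis of_int_minus of_int_of_nat_eq scaleR_minus_left)
        then show ?thesis using \<open>\<And>x. x \<in> generate ?V roots_A4 \<Longrightarrow> - x \<in> generate ?V roots_A4\<close>
          nmult[OF that(1), of "Suc n"] by simp
      qed
    qed
    fix x assume x: "x \<in> intvec"
    have "(\<Sum>k\<in>K. x $ k *\<^sub>R basis_root k) \<in> generate ?V roots_A4" if "K \<subseteq> UNIV - {0}" for K
      using finite[of K] that
    proof (induction K rule: finite_induct)
      case (insert k K)
      then have "basis_root k \<in> generate ?V roots_A4"
        by (intro generate.incl basis_root_in) auto
      with insert show ?case using x by (auto intro!: add zmult simp: intvec_def)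
    qed (simp add: zero)
    then show "x \<in> generate ?V roots_A4"
      using x by (subst intvec_expand) (auto simp: intvec_def)
  qed
  ultimately show ?thesis by (simp add: ZA4_def)
qed

lemma ZA4_simps [simp]: "x \<otimes>\<^bsub>ZA4\<^esub> y = x + y" "\<one>\<^bsub>ZA4\<^esub> = 0" "act ZA4 g = g"
  by (simp_all add: ZA4_def)

lemma intvec_closed:
  "0 \<in> intvec" "x \<in> intvec \<Longrightarrow> y \<in> intvec \<Longrightarrow> x + y \<in> intvec" "x \<in> intvec \<Longrightarrow> - x \<in> intvec"
  "x \<in> intvec \<Longrightarrow> y \<in> intvec \<Longrightarrow> x - y \<in> intvec"
  by (auto simp: intvec_def sum_negf sum.distrib sum_subtractf)

lemma intvec_scale: "c \<in> \<int> \<Longrightarrow> x \<in> intvec \<Longrightarrow> c *\<^sub>R x \<in> intvec"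
  by (auto simp: intvec_def simp flip: sum_distrib_left)

lemma basis_root_intvec: "basis_root k \<in> intvec"
  by (simp add: intvec_def basis_root_def sum_subtractf) (simp add: axis_def)

lemma Aut_intvec: "g \<in> carrier Aut_A4 \<Longrightarrow> x \<in> intvec \<Longrightarrow> g x \<in> intvec"
  by (auto elim!: AutE simp: intvec_def sperm_nth sum_negf sum_nth_perm[where f = "\<lambda>x. x"])

lemma comm_group_ZA4: "comm_group ZA4"
  by (rule comm_group_vec) (auto simp: carrier_ZA4 intvec_closed)

lemma lattice_basis_ZA4: "lattice_basis ZA4 (basis_root ` (UNIV - {0}))"
proof (rule lattice_basisI[where d = "\<lambda>k x. \<lfloor>x $ k\<rfloor>"])
  show "(\<lambda>x. \<lfloor>x $ k\<rfloor>) \<in> hom ZA4 integer_group" for k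
    by (auto simp: hom_def carrier_ZA4 intvec_def elim!: Ints_cases dest!: spec[of _ k])
  show "x = \<one>\<^bsub>ZA4\<^esub>" if x: "x \<in> carrier ZA4" and 0: "\<And>k. k \<in> UNIV - {0} \<Longrightarrow> \<lfloor>x $ k\<rfloor> = 0" for x
  proof -
    have "x $ k = 0" if "k \<noteq> 0" for k
      using 0[of k] x that by (auto simp: carrier_ZA4 intvec_def elim!: Ints_cases dest!: spec[of _ k])
    then show ?thesis
      using x intvec_expand[of x] by (auto simp: carrier_ZA4 intvec_def)
  qed
  show "basis_root k \<in> carrier ZA4" for k by (simp add: carrier_ZA4 basis_root_intvec)
  show "\<lfloor>basis_root j $ i\<rfloor> = (if i = j then 1 else 0)"
    if "i \<in> UNIV - {0}" "j \<in> UNIV - {0}" for i j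
    using that by (simp add: basis_root_def axis_def)
qed (auto simp: comm_group_ZA4)

lemma is_G_lattice_ZA4: "is_G_lattice Aut_A4 ZA4"
  unfolding is_G_lattice_def
proof (intro conjI ballI)
  show "\<exists>B. lattice_basis ZA4 B" using lattice_basis_ZA4 by blast
  show "act ZA4 g \<in> hom ZA4 ZA4" if "g \<in> carrier Aut_A4" for g
    using that by (auto simp: hom_def carrier_ZA4 Aut_intvec linear_add[OF Aut_linear])
qed (auto simp: group_Aut comm_group_ZA4 Aut_one Aut_mult)

lemma span_roots: "span roots_A4 = {x. (\<Sum>i\<in>UNIV. x $ i) = 0}"
proof (intro equalityI subsetI)
  fix x assume "x \<in> span roots_A4"
  then show "x \<in> {x. (\<Sum>i\<in>UNIV. x $ i) = 0}"
    by (induction rule: span_induct)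
      (auto simp: subspace_def sum.distrib roots_eq sum_subtractf simp flip: sum_distrib_left)
next
  fix x :: "real^5" assume "x \<in> {x. (\<Sum>i\<in>UNIV. x $ i) = 0}"
  then have "x = (\<Sum>k\<in>UNIV - {0}. x $ k *\<^sub>R basis_root k)" by (simp add: intvec_expand)
  also have "\<dots> \<in> span roots_A4"
    by (intro span_sum span_scale span_base basis_root_in) auto
  finally show "x \<in> span roots_A4" .
qed

text \<open>The basis of the weight lattice dual to \<open>e\<^sub>k - e\<^sub>5\<close>.\<close>

definition weight :: "5 \<Rightarrow> real^5" where
  "weight k = (\<chi> i. (if i = k then 1 else 0) - 1 / 5)"

lemma weight_sum: "(\<Sum>i\<in>UNIV. weight k $ i) = 0"
  by (simp add: weight_def sum_subtractf)

lemma inner_weight: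
  assumes "(\<Sum>i\<in>UNIV. y $ i) = 0"
  shows "inner (weight k) y = y $ k"
proof -
  have "inner (weight k) y = (\<Sum>i\<in>UNIV. (if i = k then 1 else 0) * y $ i - 1 / 5 * y $ i)"
    by (simp add: inner_vec_def weight_def algebra_simps)
  also have "\<dots> = (\<Sum>i\<in>UNIV. if i = k then y $ i else 0) - 1 / 5 * (\<Sum>i\<in>UNIV. y $ i)"
    unfolding sum_subtractf sum_distrib_left by (intro arg_cong2[of _ _ _ _ "(-)"] sum.cong) auto
  finally show ?thesis using assms by simp
qed

lemma carrier_Lambda: "x \<in> carrier Lambda_A4 \<longleftrightarrow>
    (\<Sum>i\<in>UNIV. x $ i) = 0 \<and> (\<forall>y\<in>intvec. inner x y \<in> \<int>)"
  by (simp add: Lambda_A4_def span_roots carrier_ZA4)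

lemma Lambda_simps [simp]: "x \<otimes>\<^bsub>Lambda_A4\<^esub> y = x + y" "\<one>\<^bsub>Lambda_A4\<^esub> = 0" "act Lambda_A4 g = g"
  by (simp_all add: Lambda_A4_def)

lemma comm_group_Lambda: "comm_group Lambda_A4"
  by (rule comm_group_vec) (auto simp: carrier_Lambda sum.distrib inner_add_left sum_negf)

lemma weight_Lambda: "weight k \<in> carrier Lambda_A4"
  by (auto simp: carrier_Lambda weight_sum inner_weight intvec_def)

lemma inner_basis_roots_eq_0:
  assumes x: "(\<Sum>i\<in>UNIV. x $ i) = 0" and 0: "\<And>k. k \<noteq> 0 \<Longrightarrow> inner x (basis_root k) = 0"
  shows "x = 0"
proof -
  have "inner x x = inner x (\<Sum>k\<in>UNIV - {0}. x $ k *\<^sub>R basis_root k)"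
    using intvec_expand[OF x] by simp
  also have "\<dots> = 0" using 0 by (simp add: inner_sum_right)
  finally show ?thesis by simp
qed

lemma Aut_sum_0: "g \<in> carrier Aut_A4 \<Longrightarrow> (\<Sum>i\<in>UNIV. x $ i) = 0 \<Longrightarrow> (\<Sum>i\<in>UNIV. g x $ i) = 0"
  by (auto elim!: AutE simp: sperm_nth sum_negf sum_nth_perm[where f = "\<lambda>x. x"])

lemma floor_inner_hom: "y \<in> intvec \<Longrightarrow> (\<lambda>l. \<lfloor>inner l y\<rfloor>) \<in> hom Lambda_A4 integer_group"
  by (auto simp: hom_def carrier_Lambda inner_add_left elim!: Ints_cases dest!: bspec[of _ _ y])

lemma lattice_basis_Lambda: "lattice_basis Lambda_A4 (weight ` (UNIV - {0}))"
proof (rule lattice_basisI[where d = "\<lambda>k x. \<lfloor>inner x (basis_root k)\<rfloor>"])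
  show "x = \<one>\<^bsub>Lambda_A4\<^esub>" if x: "x \<in> carrier Lambda_A4"
    and 0: "\<And>k. k \<in> UNIV - {0} \<Longrightarrow> \<lfloor>inner x (basis_root k)\<rfloor> = 0" for x
  proof -
    have "inner x (basis_root k) = 0" if "k \<noteq> 0" for k
    proof -
      have "inner x (basis_root k) \<in> \<int>" using x basis_root_intvec by (simp add: carrier_Lambda)
      then show ?thesis using 0[of k] that by (auto elim!: Ints_cases)
    qed
    with inner_basis_roots_eq_0[of x] x show ?thesis by (simp add: carrier_Lambda)
  qed
  show "\<lfloor>inner (weight j) (basis_root i)\<rfloor> = (if i = j then 1 else 0)"
    if "i \<in> UNIV - {0}" "j \<in> UNIV - {0}" for i j
    using that basis_root_intvec[of i] by (simp add: inner_weight intvec_def) (simp add: basis_root_def axis_def)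
qed (auto simp: comm_group_Lambda weight_Lambda floor_inner_hom basis_root_intvec)

lemma is_G_lattice_Lambda: "is_G_lattice Aut_A4 Lambda_A4"
  unfolding is_G_lattice_def
proof (intro conjI ballI)
  show "\<exists>B. lattice_basis Lambda_A4 B" using lattice_basis_Lambda by blast
  fix g assume g: "g \<in> carrier Aut_A4"
  have "inner (g x) y \<in> \<int>" if x: "x \<in> carrier Lambda_A4" and y: "y \<in> intvec" for x y
  proof -
    have gi: "inv\<^bsub>Aut_A4\<^esub> g \<in> carrier Aut_A4" using group.inv_closed[OF group_Aut g] .
    have "inner (g x) y = inner x ((inv\<^bsub>Aut_A4\<^esub> g) y)"
      using Aut_inner[OF g, of x "(inv\<^bsub>Aut_A4\<^esub> g) y"] by (simp add: Aut_inv[OF g])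
    then show ?thesis using x Aut_intvec[OF gi y] by (simp add: carrier_Lambda)
  qed
  then show "act Lambda_A4 g \<in> hom Lambda_A4 Lambda_A4"
    using g by (auto simp: hom_def carrier_Lambda linear_add[OF Aut_linear] Aut_sum_0)
qed (auto simp: group_Aut comm_group_Lambda Aut_one Aut_mult)

text \<open>The scalar product identifies the weight lattice with the dual of the root lattice.\<close>

definition pairing :: "real^5 \<Rightarrow> real^5 \<Rightarrow> int" where
  "pairing l = (\<lambda>x\<in>carrier ZA4. \<lfloor>inner l x\<rfloor>)"

lemma pairing_dual: "l \<in> carrier Lambda_A4 \<Longrightarrow> pairing l \<in> carrier (dual_lattice Aut_A4 ZA4)"
  by (auto simp: pairing_def hom_def carrier_ZA4 carrier_Lambda inner_add_right intvec_closed)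

lemma pairing_equivariant: "pairing \<in> equivariant_hom Aut_A4 Lambda_A4 (dual_lattice Aut_A4 ZA4)"
  unfolding equivariant_hom_def
proof (intro CollectI conjI ballI)
  show "pairing \<in> hom Lambda_A4 (dual_lattice Aut_A4 ZA4)"
  proof (rule homI)
    fix l l' assume l: "l \<in> carrier Lambda_A4" "l' \<in> carrier Lambda_A4"
    have "\<lfloor>inner (l + l') x\<rfloor> = \<lfloor>inner l x\<rfloor> + \<lfloor>inner l' x\<rfloor>" if "x \<in> intvec" for x
      using floor_inner_hom[OF that] l by (auto simp: hom_def)
    then show "pairing (l \<otimes>\<^bsub>Lambda_A4\<^esub> l') = pairing l \<otimes>\<^bsub>dual_lattice Aut_A4 ZA4\<^esub> pairing l'"
      by (auto simp: pairing_def carrier_ZA4 intro!: restrict_ext)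
  qed (fact pairing_dual)
  fix g l assume g: "g \<in> carrier Aut_A4"
  have gi: "inv\<^bsub>Aut_A4\<^esub> g \<in> carrier Aut_A4" using group.inv_closed[OF group_Aut g] .
  have "inner (g l) x = inner l ((inv\<^bsub>Aut_A4\<^esub> g) x)" for x
    using Aut_inner[OF g, of l "(inv\<^bsub>Aut_A4\<^esub> g) x"] by (simp add: Aut_inv[OF g])
  then show "pairing (act Lambda_A4 g l) = act (dual_lattice Aut_A4 ZA4) g (pairing l)"
    using Aut_intvec[OF gi] by (auto simp: pairing_def carrier_ZA4 intro!: restrict_ext)
qed

lemma pairing_bij: "bij_betw pairing (carrier Lambda_A4) (carrier (dual_lattice Aut_A4 ZA4))"
proof (rule bij_betw_imageI)
  interpret based_lattice ZA4 "basis_root ` (UNIV - {0})"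
    by (simp add: based_lattice_def based_lattice_axioms_def comm_group_ZA4 lattice_basis_ZA4)
  interpret L: based_lattice Lambda_A4 "weight ` (UNIV - {0})"
    by (simp add: based_lattice_def based_lattice_axioms_def comm_group_Lambda lattice_basis_Lambda)
  have Lint: "inner l y \<in> \<int>" if "l \<in> carrier Lambda_A4" "y \<in> intvec" for l y
    using that by (simp add: carrier_Lambda)
  show "inj_on pairing (carrier Lambda_A4)"
  proof (rule inj_onI)
    fix l l' assume l: "l \<in> carrier Lambda_A4" "l' \<in> carrier Lambda_A4" and eq: "pairing l = pairing l'"
    have "inner (l - l') (basis_root k) = 0" for k
    proof -
      have "\<lfloor>inner l (basis_root k)\<rfloor> = \<lfloor>inner l' (basis_root k)\<rfloor>"
        using fun_cong[OF eq, of "basis_root k"] basis_root_intvec[of k]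
        by (simp add: pairing_def carrier_ZA4)
      then show ?thesis
        using Lint[OF l(1) basis_root_intvec[of k]] Lint[OF l(2) basis_root_intvec[of k]]
        by (auto simp: inner_diff_left elim!: Ints_cases)
    qed
    then show "l = l'"
      using inner_basis_roots_eq_0[of "l - l'"] l by (simp add: carrier_Lambda sum_subtractf)
  qed
  show "pairing ` carrier Lambda_A4 = carrier (dual_lattice Aut_A4 ZA4)"
  proof (intro equalityI subsetI)
    fix f assume f: "f \<in> carrier (dual_lattice Aut_A4 ZA4)"
    define l where "l = (\<Sum>k\<in>UNIV - {0}. real_of_int (f (basis_root k)) *\<^sub>R weight k)"
    have inner_l: "inner l y = (\<Sum>k\<in>UNIV - {0}. real_of_int (f (basis_root k)) * y $ k)"
      if "y \<in> intvec" for y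
      using that by (simp add: l_def inner_sum_left inner_weight intvec_def)
    have l: "l \<in> carrier Lambda_A4"
    proof -
      have "(\<Sum>i\<in>UNIV. l $ i) = (\<Sum>k\<in>UNIV - {0}. \<Sum>i\<in>UNIV. real_of_int (f (basis_root k)) * weight k $ i)"
        unfolding l_def by (simp add: sum.swap[of _ UNIV])
      also have "\<dots> = 0" by (simp add: weight_sum flip: sum_distrib_left)
      finally show ?thesis
        using inner_l by (auto simp: carrier_Lambda intvec_def intro!: Ints_sum Ints_mult)
    qed
    have "pairing l x = f x" if "x \<in> carrier ZA4" for x
    proof (rule hom_eqI[OF abelian_integer_group, where h = "pairing l" and k = f])
      show "pairing l \<in> hom ZA4 integer_group" "f \<in> hom ZA4 integer_group"
        using pairing_dual[OF l] f by simp_all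
      fix b assume "b \<in> basis_root ` (UNIV - {0})"
      then obtain j where j: "j \<noteq> 0" "b = basis_root j" by auto
      have "inner l b = (\<Sum>k\<in>UNIV - {0}. if k = j then real_of_int (f (basis_root k)) else 0)"
        unfolding inner_l[of b, unfolded j(2), OF basis_root_intvec, folded j(2)]
        by (rule sum.cong) (use j in \<open>auto simp: basis_root_def axis_def\<close>)
      also have "\<dots> = f b" using j by simp
      finally show "pairing l b = f b"
        using basis_root_intvec[of j] j by (simp add: pairing_def carrier_ZA4)
    qed (fact that)
    moreover have "f \<in> extensional (carrier ZA4)" using f by simp
    moreover have "pairing l \<in> extensional (carrier ZA4)" by (simp add: pairing_def)
    ultimately have "pairing l = f" by (intro extensionalityI[of _ "carrier ZA4"])
    with l show "f \<in> pairing ` carrier Lambda_A4" by blast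
  qed (use pairing_dual in blast)
qed


section \<open>Direct sums of coset lattices\<close>

lemma coset_lattice_simps [simp]:
  "carrier (coset_lattice G H) = {c. Poly_Mapping.keys c \<subseteq> lcosets\<^bsub>G\<^esub> H}"
  "x \<otimes>\<^bsub>coset_lattice G H\<^esub> y = x + y" "\<one>\<^bsub>coset_lattice G H\<^esub> = 0"
  "act (coset_lattice G H) g = frag_extend (\<lambda>C. frag_of (g <#\<^bsub>G\<^esub> C))"
  by (simp_all add: coset_lattice_def free_Abelian_group_def with_act_def)

lemma comm_group_with_act:
  assumes "comm_group M"
  shows "comm_group (with_act M a)"
proof -
  interpret comm_group M by fact
  show ?thesis
  proof (rule comm_groupI)
    fix x assume "x \<in> carrier (with_act M a)"
    then show "\<exists>y\<in>carrier (with_act M a). y \<otimes>\<^bsub>with_act M a\<^esub> x = \<one>\<^bsub>with_act M a\<^esub>"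
      using l_inv_ex by simp
  qed (simp_all add: m_ac)
qed

lemma comm_group_coset_lattice: "comm_group (coset_lattice G H)"
  unfolding coset_lattice_def by (rule comm_group_with_act[OF abelian_free_Abelian_group])

text \<open>
  A basis of the direct sum is indexed by pairs \<open>(i, C)\<close> of a summand and a coset, on which the group
  acts by left translation of the coset.
\<close>

locale coset_sum =
  fixes G :: "('g, 'a) monoid_scheme" and I :: "'i set" and H :: "'i \<Rightarrow> 'g set"
  assumes group_G: "group G" and finite_G: "finite (carrier G)" and finite_I: "finite I"
    and H: "\<And>i. i \<in> I \<Longrightarrow> subgroup (H i) G"
begin

sublocale G: group G by (fact group_G)

abbreviation M :: "('g, 'i \<Rightarrow> ('g set \<Rightarrow>\<^sub>0 int)) gmodule" where
  "M \<equiv> direct_sum_lattice I (\<lambda>i. coset_lattice G (H i))"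

lemma M_simps [simp]:
  "carrier M = (\<Pi>\<^sub>E i\<in>I. {c. Poly_Mapping.keys c \<subseteq> lcosets\<^bsub>G\<^esub> (H i)})"
  "f \<otimes>\<^bsub>M\<^esub> f' = (\<lambda>i\<in>I. f i + f' i)" "\<one>\<^bsub>M\<^esub> = (\<lambda>i\<in>I. 0)"
  "act M g f = (\<lambda>i\<in>I. frag_extend (\<lambda>C. frag_of (g <#\<^bsub>G\<^esub> C)) (f i))"
proof -
  have "group (coset_lattice G (H i))" for i
    using comm_group_coset_lattice by (rule comm_group.axioms(2))
  then show "carrier M = (\<Pi>\<^sub>E i\<in>I. {c. Poly_Mapping.keys c \<subseteq> lcosets\<^bsub>G\<^esub> (H i)})"
    using finite_I by (simp add: direct_sum_lattice_def with_act_def carrier_sum_group)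
qed (simp_all add: direct_sum_lattice_def with_act_def)

lemma lcosets_eq: "lcosets\<^bsub>G\<^esub> (H i) = (\<lambda>a. a <#\<^bsub>G\<^esub> H i) ` carrier G"
  by (auto simp: LCOSETS_def)

lemma l_coset_assoc:
  "i \<in> I \<Longrightarrow> g \<in> carrier G \<Longrightarrow> a \<in> carrier G \<Longrightarrow> g <#\<^bsub>G\<^esub> (a <#\<^bsub>G\<^esub> H i) = (g \<otimes>\<^bsub>G\<^esub> a) <#\<^bsub>G\<^esub> H i"
  using G.lcos_m_assoc[OF subgroup.subset[OF H]] .

lemma l_coset_lcosets: "i \<in> I \<Longrightarrow> g \<in> carrier G \<Longrightarrow> C \<in> lcosets\<^bsub>G\<^esub> (H i) \<Longrightarrow> g <#\<^bsub>G\<^esub> C \<in> lcosets\<^bsub>G\<^esub> (H i)"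
  by (auto simp: lcosets_eq l_coset_assoc)

definition index :: "('i \<times> 'g set) set" where
  "index = (SIGMA i:I. lcosets\<^bsub>G\<^esub> (H i))"

definition bvec :: "'i \<times> 'g set \<Rightarrow> 'i \<Rightarrow> ('g set \<Rightarrow>\<^sub>0 int)" where
  "bvec = (\<lambda>(i, C). \<lambda>j\<in>I. if j = i then frag_of C else 0)"

lemma finite_index: "finite index"
  using finite_G finite_I by (auto simp: index_def lcosets_eq)

lemma bvec_carrier: "iC \<in> index \<Longrightarrow> bvec iC \<in> carrier M"
  by (auto simp: index_def bvec_def split: if_splits)

lemma comm_group_M: "comm_group M"
proof (rule comm_groupI)
  fix f f' assume f: "f \<in> carrier M" "f' \<in> carrier M"
  have "Poly_Mapping.keys (f i + f' i) \<subseteq> lcosets\<^bsub>G\<^esub> (H i)" if "i \<in> I" for i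
    using keys_add[of "f i" "f' i"] PiE_mem[of f I _ i] PiE_mem[of f' I _ i] f that by fastforce
  then show "f \<otimes>\<^bsub>M\<^esub> f' \<in> carrier M" by auto
next
  fix f assume f: "f \<in> carrier M"
  then have "Poly_Mapping.keys (f i) \<subseteq> lcosets\<^bsub>G\<^esub> (H i)" if "i \<in> I" for i using that by auto
  then show "\<exists>f'\<in>carrier M. f' \<otimes>\<^bsub>M\<^esub> f = \<one>\<^bsub>M\<^esub>"
    by (intro bexI[of _ "\<lambda>i\<in>I. - f i"]) auto
  from f show "\<one>\<^bsub>M\<^esub> \<otimes>\<^bsub>M\<^esub> f = f" by (auto simp: PiE_def extensional_def)
qed (auto simp: add_ac)

lemma lattice_basis_M: "lattice_basis M (bvec ` index)"
proof (rule lattice_basisI[where d = "\<lambda>(i, C) f. Poly_Mapping.lookup (f i) C"])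
  fix iC assume "iC \<in> index"
  then show "(case iC of (i, C) \<Rightarrow> \<lambda>f. Poly_Mapping.lookup (f i) C) \<in> hom M integer_group"
    by (auto simp: index_def hom_def lookup_add)
next
  fix f assume f: "f \<in> carrier M"
    and 0: "\<And>iC. iC \<in> index \<Longrightarrow> (case iC of (i, C) \<Rightarrow> \<lambda>f. Poly_Mapping.lookup (f i) C) f = 0"
  have "f i = 0" if i: "i \<in> I" for i
  proof (rule poly_mapping_eqI)
    fix C
    have "C \<in> Poly_Mapping.keys (f i) \<Longrightarrow> (i, C) \<in> index"
      using f i by (auto simp: index_def)
    then show "Poly_Mapping.lookup (f i) C = Poly_Mapping.lookup 0 C"
      using 0[of "(i, C)"] by (cases "C \<in> Poly_Mapping.keys (f i)") (auto simp: in_keys_iff)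
  qed
  with f show "f = \<one>\<^bsub>M\<^esub>" by (auto simp: PiE_def extensional_def)
next
  fix iC jD assume "iC \<in> index" "jD \<in> index"
  then show "(case iC of (i, C) \<Rightarrow> \<lambda>f. Poly_Mapping.lookup (f i) C) (bvec jD) = (if iC = jD then 1 else 0)"
    by (auto simp: index_def bvec_def lookup_frag_of)
qed (auto simp: comm_group_M finite_index bvec_carrier simp del: M_simps)

lemma act_bvec: "g \<in> carrier G \<Longrightarrow> (i, C) \<in> index \<Longrightarrow> act M g (bvec (i, C)) = bvec (i, g <#\<^bsub>G\<^esub> C)"
  by (auto simp: bvec_def intro!: restrict_ext)

lemma index_act: "g \<in> carrier G \<Longrightarrow> (i, C) \<in> index \<Longrightarrow> (i, g <#\<^bsub>G\<^esub> C) \<in> index"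
  by (auto simp: index_def l_coset_lcosets)

lemma index_subset: "(i, C) \<in> index \<Longrightarrow> C \<subseteq> carrier G"
  using H by (auto simp: index_def dest: subgroup.lcosets_carrier[OF _ group_G])

lemma is_G_lattice_M: "is_G_lattice G M"
  unfolding is_G_lattice_def
proof (intro conjI ballI)
  show "\<exists>B. lattice_basis M B" using lattice_basis_M by blast
  have sub: "C \<subseteq> carrier G" if "f \<in> carrier M" "i \<in> I" "C \<in> Poly_Mapping.keys (f i)" for f i C
    using that by (intro index_subset[of i]) (auto simp: index_def)
  fix g assume g: "g \<in> carrier G"
  show "act M g \<in> hom M M"
  proof (rule homI)
    fix f assume f: "f \<in> carrier M"
    have "Poly_Mapping.keys (frag_extend (\<lambda>C. frag_of (g <#\<^bsub>G\<^esub> C)) (f i)) \<subseteq> lcosets\<^bsub>G\<^esub> (H i)"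
      if i: "i \<in> I" for i
    proof -
      have "Poly_Mapping.keys (f i) \<subseteq> lcosets\<^bsub>G\<^esub> (H i)" using f i by auto
      then show ?thesis
        using keys_frag_extend[of "\<lambda>C. frag_of (g <#\<^bsub>G\<^esub> C)" "f i"] l_coset_lcosets[OF i g] by fastforce
    qed
    then show "act M g f \<in> carrier M" by auto
  qed (auto simp: frag_extend_add intro!: restrict_ext)
  fix h assume h: "h \<in> carrier G"
  fix f assume f: "f \<in> carrier M"
  have "frag_extend (\<lambda>C. frag_of (g \<otimes>\<^bsub>G\<^esub> h <#\<^bsub>G\<^esub> C)) (f i) =
      frag_extend (\<lambda>C. frag_of (g <#\<^bsub>G\<^esub> C)) (frag_extend (\<lambda>C. frag_of (h <#\<^bsub>G\<^esub> C)) (f i))"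
    if i: "i \<in> I" for i
  proof -
    have "frag_extend (\<lambda>C. frag_of (g \<otimes>\<^bsub>G\<^esub> h <#\<^bsub>G\<^esub> C)) (f i) =
        frag_extend (frag_extend (\<lambda>C. frag_of (g <#\<^bsub>G\<^esub> C)) \<circ> (\<lambda>C. frag_of (h <#\<^bsub>G\<^esub> C))) (f i)"
      by (rule frag_extend_eq) (use sub[OF f i] g h in \<open>auto simp: G.lcos_m_assoc\<close>)
    also have "\<dots> = frag_extend (\<lambda>C. frag_of (g <#\<^bsub>G\<^esub> C)) (frag_extend (\<lambda>C. frag_of (h <#\<^bsub>G\<^esub> C)) (f i))"
      using frag_extend_compose[of "frag_extend (\<lambda>C. frag_of (g <#\<^bsub>G\<^esub> C)) \<circ> frag_of" "\<lambda>C. h <#\<^bsub>G\<^esub> C"]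
      by (simp add: fun_eq_iff comp_def)
    finally show ?thesis .
  qed
  then show "act M (g \<otimes>\<^bsub>G\<^esub> h) f = act M g (act M h f)"
    by (auto intro!: restrict_ext)
next
  fix f assume f: "f \<in> carrier M"
  have "frag_extend (\<lambda>C. frag_of (\<one>\<^bsub>G\<^esub> <#\<^bsub>G\<^esub> C)) (f i) = f i" if i: "i \<in> I" for i
  proof -
    have "C \<subseteq> carrier G" if "C \<in> Poly_Mapping.keys (f i)" for C
      using f i that by (intro index_subset[of i]) (auto simp: index_def)
    then have "frag_extend (\<lambda>C. frag_of (\<one>\<^bsub>G\<^esub> <#\<^bsub>G\<^esub> C)) (f i) = frag_extend frag_of (f i)"
      by (intro frag_extend_eq) (simp add: G.lcos_mult_one)
    then show ?thesis by (simp add: frag_expansion[symmetric])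
  qed
  with f show "act M \<one>\<^bsub>G\<^esub> f = f" by (auto simp: PiE_def extensional_def)
qed (auto simp: group_G comm_group_M simp del: M_simps)

lemma act_basis:
  assumes g: "g \<in> carrier G"
  shows "act M g ` (bvec ` index) = bvec ` index"
proof -
  interpret M: G_lattice G M by unfold_locales (fact is_G_lattice_M)
  have sub: "act M h ` (bvec ` index) \<subseteq> bvec ` index" if "h \<in> carrier G" for h
    using index_act[OF that] act_bvec[OF that] by (auto simp del: M_simps)
  moreover have "bvec ` index \<subseteq> act M g ` (bvec ` index)"
  proof
    fix b assume b: "b \<in> bvec ` index"
    then have "act M (inv\<^bsub>G\<^esub> g) b \<in> bvec ` index" using sub[of "inv\<^bsub>G\<^esub> g"] g by blast
    moreover have "b = act M g (act M (inv\<^bsub>G\<^esub> g) b)"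
      using b g bvec_carrier by (auto simp del: M_simps)
    ultimately show "b \<in> act M g ` (bvec ` index)" by blast
  qed
  ultimately show ?thesis using g by blast
qed

end


section \<open>The ray generators\<close>

text \<open>The fifth coordinate is the one at the residue \<open>0\<close>.\<close>

definition vec5 :: "real \<Rightarrow> real \<Rightarrow> real \<Rightarrow> real \<Rightarrow> real \<Rightarrow> real^5" where
  "vec5 a b c d e = (\<chi> i. if i = 1 then a else if i = 2 then b else if i = 3 then c else if i = 4 then d else e)"

lemma vec5_nth [simp]:
  "vec5 a b c d e $ 1 = a" "vec5 a b c d e $ 2 = b" "vec5 a b c d e $ 3 = c" "vec5 a b c d e $ 4 = d"
  "vec5 a b c d e $ 0 = e"
  by (simp_all add: vec5_def)

lemma vec5_eq: "x = vec5 a b c d e \<longleftrightarrow> x $ 1 = a \<and> x $ 2 = b \<and> x $ 3 = c \<and> x $ 4 = d \<and> x $ 0 = e"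
  by (auto simp: vec_eq_iff forall_5)

lemma nat_intervals:
  "{1..1::nat} = {1}" "{1..2::nat} = {1, 2}" "{1..3::nat} = {1, 2, 3}"
  "{2..2::nat} = {2}" "{2..3::nat} = {2, 3}" "{2..4::nat} = {2, 3, 4}" "{2..5::nat} = {2, 3, 4, 5}"
  "{3..3::nat} = {3}" "{3..4::nat} = {3, 4}" "{3..5::nat} = {3, 4, 5}"
  by auto

lemma srt_eq:
  "srt 1 1 = vec5 1 (-1) 0 0 0" "srt 1 2 = vec5 2 (-1) (-1) 0 0"
  "srt 1 3 = vec5 3 (-1) (-1) (-1) 0" "srt 1 4 = vec5 4 (-1) (-1) (-1) (-1)"
  "srt 2 2 = vec5 1 1 (-1) (-1) 0" "srt 2 3 = vec5 3 3 (-2) (-2) (-2)"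
proof -
  have [simp]: "1 + 1 = (2::nat)" "1 + 2 = (3::nat)" "1 + 3 = (4::nat)" "1 + 4 = (5::nat)"
    "2 + 1 = (3::nat)" "2 + 2 = (4::nat)" "2 + 3 = (5::nat)" by simp_all
  show "srt 1 1 = vec5 1 (-1) 0 0 0" "srt 1 2 = vec5 2 (-1) (-1) 0 0"
    "srt 1 3 = vec5 3 (-1) (-1) (-1) 0" "srt 1 4 = vec5 4 (-1) (-1) (-1) (-1)"
    "srt 2 2 = vec5 1 1 (-1) (-1) 0" "srt 2 3 = vec5 3 3 (-2) (-2) (-2)"
    unfolding svec_def vec5_eq
    by (simp_all only: nat_intervals \<open>1 + 1 = (2::nat)\<close> \<open>1 + 2 = (3::nat)\<close> \<open>1 + 3 = (4::nat)\<close>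
        \<open>1 + 4 = (5::nat)\<close> \<open>2 + 1 = (3::nat)\<close> \<open>2 + 2 = (4::nat)\<close> \<open>2 + 3 = (5::nat)\<close>)
      (simp_all add: evec_nth gcd.commute[of 2])
qed

lemma v_eq:
  "v1 = vec5 1 2 (-1) (-1) (-1)" "v2 = vec5 2 2 (-2) (-1) (-1)" "v3 = vec5 2 3 (-2) (-2) (-1)"
  by (simp_all add: vec5_eq v1_def v2_def v3_def evec_nth)

lemma s_reps_eq: "s_reps = {srt 1 1, srt 1 2, srt 1 3, srt 1 4, srt 2 2, srt 2 3}"
proof (intro equalityI subsetI)
  fix x assume "x \<in> s_reps"
  then obtain r t where rt: "x = srt r t" "1 \<le> r" "r \<le> t" "r + t \<le> 5" by (auto simp: s_reps_def)
  then have "r = 1 \<and> (t = 1 \<or> t = 2 \<or> t = 3 \<or> t = 4) \<or> r = 2 \<and> (t = 2 \<or> t = 3)" by arith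
  then show "x \<in> {srt 1 1, srt 1 2, srt 1 3, srt 1 4, srt 2 2, srt 2 3}" unfolding rt(1) by blast
next
  have "srt r t \<in> s_reps" if "1 \<le> r" "r \<le> t" "r + t \<le> 5" for r t
    unfolding s_reps_def using that by blast
  note this[of 1 1] this[of 1 2] this[of 1 3] this[of 1 4] this[of 2 2] this[of 2 3]
  then have "srt 1 1 \<in> s_reps" "srt 1 2 \<in> s_reps" "srt 1 3 \<in> s_reps" "srt 1 4 \<in> s_reps"
      "srt 2 2 \<in> s_reps" "srt 2 3 \<in> s_reps" by simp_all
  then show "x \<in> s_reps" if "x \<in> {srt 1 1, srt 1 2, srt 1 3, srt 1 4, srt 2 2, srt 2 3}" for x
    using that by blast
qed

lemma Omega_eq: "Omega = {vec5 1 (-1) 0 0 0, vec5 2 (-1) (-1) 0 0, vec5 3 (-1) (-1) (-1) 0,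
    vec5 4 (-1) (-1) (-1) (-1), vec5 1 1 (-1) (-1) 0, vec5 3 3 (-2) (-2) (-2),
    vec5 1 2 (-1) (-1) (-1), vec5 2 2 (-2) (-1) (-1), vec5 2 3 (-2) (-2) (-1)}"
  unfolding Omega_def s_reps_eq v_reps_def srt_eq v_eq by blast

lemma vec5_inject [simp]:
  "vec5 a b c d e = vec5 a' b' c' d' e' \<longleftrightarrow> a = a' \<and> b = b' \<and> c = c' \<and> d = d' \<and> e = e'"
  unfolding vec5_eq by simp

lemma card_reps: "card s_reps = 6" "card v_reps = 3" "s_reps \<inter> v_reps = {}"
  unfolding s_reps_eq v_reps_def srt_eq v_eq by simp_all

lemma finite_Omega: "finite Omega"
  by (simp add: Omega_eq)

lemma Omega_intvec: "x \<in> Omega \<Longrightarrow> x \<in> intvec"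
  by (auto simp: Omega_eq intvec_def forall_5 sum_5)

lemma Omega_nonzero: "x \<in> Omega \<Longrightarrow> x \<noteq> 0"
  by (auto simp: Omega_eq vec_eq_iff forall_5)

text \<open>
  A divisor of a lattice vector divides all integral combinations of its coordinates, and in each case
  a coordinate or the sum of the first and third one is a unit.
\<close>

lemma primitive_Omega: "x \<in> Omega \<Longrightarrow> primitive_vector (carrier ZA4) x"
proof -
  assume x: "x \<in> Omega"
  have unit: "\<bar>n\<bar> = 1" if y: "y \<in> intvec" "x = of_int n *\<^sub>R y" for y and n :: int
  proof -
    have "\<bar>x $ 1\<bar> = 1 \<or> \<bar>x $ 2\<bar> = 1 \<or> \<bar>x $ 3\<bar> = 1 \<or> \<bar>x $ 4\<bar> = 1 \<or> \<bar>x $ 0\<bar> = 1 \<or> \<bar>x $ 1 + x $ 3\<bar> = 1"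
      using x unfolding Omega_eq by auto
    then have "\<exists>i j. \<bar>x $ i\<bar> = 1 \<or> \<bar>x $ i + x $ j\<bar> = 1" by blast
    then obtain z where z: "z \<in> \<int>" "\<bar>of_int n * z\<bar> = (1::real)"
    proof (elim exE disjE)
      fix i assume "\<bar>x $ i\<bar> = 1"
      then show thesis using y that[of "y $ i"] by (simp add: intvec_def)
    next
      fix i j assume "\<bar>x $ i + x $ j\<bar> = 1"
      then show thesis using y that[of "y $ i + y $ j"] by (simp add: intvec_def algebra_simps)
    qed
    then obtain m where "z = of_int m" by (auto elim: Ints_cases)
    with z(2) have "\<bar>of_int (n * m)\<bar> = (1::real)" by simp
    then have "\<bar>n * m\<bar> = 1" by linarith
    then show ?thesis by (metis abs_mult abs_zmult_eq_1)
  qed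
  then show ?thesis
    using Omega_intvec[OF x] Omega_nonzero[OF x] by (simp add: primitive_vector_def carrier_ZA4)
qed

text \<open>
  The ratio of the squares of the \<open>l\<^sup>1\<close> and \<open>l\<^sup>2\<close> norms is constant on orbits and on rays. Its values at
  the nine representatives are 2, 8/3, 3, 16/5, 4, 24/5, 9/2, 32/7 and 50/11, so it separates them.
\<close>

definition shape :: "real^5 \<Rightarrow> real" where
  "shape x = (\<Sum>i\<in>UNIV. \<bar>x $ i\<bar>)\<^sup>2 / (\<Sum>i\<in>UNIV. (x $ i)\<^sup>2)"

lemma shape_Aut: "g \<in> carrier Aut_A4 \<Longrightarrow> shape (g x) = shape x"
  by (auto elim!: AutE simp: shape_def sperm_nth sum_nth_perm[where f = abs] sum_nth_perm[where f = "\<lambda>x. x\<^sup>2"])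

lemma shape_scale: "c \<noteq> 0 \<Longrightarrow> shape (c *\<^sub>R x) = shape x"
  by (simp add: shape_def abs_mult power_mult_distrib flip: sum_distrib_left)

lemma shape_vec5: "shape (vec5 a b c d e) =
    (\<bar>a\<bar> + \<bar>b\<bar> + \<bar>c\<bar> + \<bar>d\<bar> + \<bar>e\<bar>)\<^sup>2 / (a\<^sup>2 + b\<^sup>2 + c\<^sup>2 + d\<^sup>2 + e\<^sup>2)"
  unfolding shape_def sum_5 by (simp add: add_ac)

lemma Omega_shape_inj: "x \<in> Omega \<Longrightarrow> y \<in> Omega \<Longrightarrow> shape x = shape y \<Longrightarrow> x = y"
  unfolding Omega_eq by (elim insertE emptyE; simp add: shape_vec5)

definition rayvecs :: "(real^5) set" where
  "rayvecs = {g x | g x. g \<in> carrier Aut_A4 \<and> x \<in> Omega}"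

lemma finite_rayvecs: "finite rayvecs"
proof -
  have "rayvecs = (\<lambda>(g, x). g x) ` (carrier Aut_A4 \<times> Omega)" by (auto simp: rayvecs_def)
  moreover have "finite \<dots>" by (intro finite_imageI finite_cartesian_product finite_Aut finite_Omega)
  ultimately show ?thesis by metis
qed

lemma rayvecs_Aut: "g \<in> carrier Aut_A4 \<Longrightarrow> w \<in> rayvecs \<Longrightarrow> g w \<in> rayvecs"
proof -
  assume g: "g \<in> carrier Aut_A4" and "w \<in> rayvecs"
  then obtain h x where "h \<in> carrier Aut_A4" "x \<in> Omega" "w = h x" by (auto simp: rayvecs_def)
  moreover have "g \<otimes>\<^bsub>Aut_A4\<^esub> h \<in> carrier Aut_A4"
    using g calculation group.subgroup_self[OF group_Aut] by (simp add: subgroup.m_closed)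
  ultimately show "g w \<in> rayvecs" using g by (auto simp: rayvecs_def Aut_mult intro!: exI[of _ "g \<circ> h"] exI[of _ x])
qed

lemma rayvecs_intvec: "w \<in> rayvecs \<Longrightarrow> w \<in> intvec"
  by (auto simp: rayvecs_def Omega_intvec Aut_intvec)


subsection \<open>Vectors with two blocks of equal coordinates\<close>

definition blockvec :: "5 set \<Rightarrow> 5 set \<Rightarrow> real \<Rightarrow> real \<Rightarrow> real^5" where
  "blockvec I J a b = (\<chi> i. if i \<in> I then a else if i \<in> J then b else 0)"

lemma ex_bij_blocks:
  fixes I J I' J' :: "'a::finite set"
  assumes disj: "I \<inter> J = {}" "I' \<inter> J' = {}"
    and card: "card I' = card I" "card J' = card J"
  obtains p where "bij p" "p ` I = I'" "p ` J = J'"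
proof -
  have fin: "finite A" for A :: "'a set" by simp
  obtain f where f: "bij_betw f I I'" using finite_same_card_bij[OF fin fin card(1)[symmetric]] by blast
  obtain g where g: "bij_betw g J J'" using finite_same_card_bij[OF fin fin card(2)[symmetric]] by blast
  have "card (- (I \<union> J)) = card (- (I' \<union> J'))"
    using disj card by (simp add: Compl_eq_Diff_UNIV card_Diff_subset fin card_Un_disjoint)
  then obtain h where h: "bij_betw h (- (I \<union> J)) (- (I' \<union> J'))"
    using finite_same_card_bij[OF fin fin] by blast
  let ?p = "\<lambda>x. if x \<in> I then f x else if x \<in> J then g x else h x"
  have pI: "bij_betw ?p I I'" using f by (rule bij_betw_cong[THEN iffD1, rotated]) simp
  have pJ: "bij_betw ?p J J'" using g by (rule bij_betw_cong[THEN iffD1, rotated]) (use disj in auto)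
  have pK: "bij_betw ?p (- (I \<union> J)) (- (I' \<union> J'))"
    using h by (rule bij_betw_cong[THEN iffD1, rotated]) auto
  have "bij_betw ?p (I \<union> J) (I' \<union> J')" by (rule bij_betw_combine[OF pI pJ disj(2)])
  then have "bij_betw ?p ((I \<union> J) \<union> - (I \<union> J)) ((I' \<union> J') \<union> - (I' \<union> J'))"
    by (rule bij_betw_combine[OF _ pK]) auto
  then have "bij ?p" by (simp only: Compl_partition)
  with pI pJ show thesis using that[of ?p] by (simp add: bij_betw_def)
qed

text \<open>
  The shape of a block vector is determined by the sizes of its blocks, since a permutation can move
  the blocks of one position to those of another.
\<close>

lemma blockvec_orbit:
  assumes "I \<inter> J = {}" "I' \<inter> J' = {}" "card I' = card I" "card J' = card J"
    and "blockvec I J a b \<in> Omega"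
  shows "blockvec I' J' a b \<in> rayvecs"
proof -
  obtain p where p: "bij p" "p ` I = I'" "p ` J = J'"
    by (rule ex_bij_blocks[OF assms(1-4)])
  have "inv' p i \<in> K \<longleftrightarrow> i \<in> p ` K" for i K
    using p(1) by (auto simp: bij_is_surj surj_f_inv_f bij_is_inj intro: image_eqI[of _ p "inv' p i"])
  then have "sperm 1 p (blockvec I J a b) = blockvec I' J' a b"
    using p by (simp add: vec_eq_iff sperm_nth blockvec_def)
  then show ?thesis
    unfolding rayvecs_def using assms(5) sperm_in_Aut[of 1 p] p(1)
    by (intro CollectI exI[of _ "sperm 1 p"] exI[of _ "blockvec I J a b"]) simp
qed

lemma block_rayvecs:
  assumes "I \<inter> J = {}"
  shows "card I = 1 \<Longrightarrow> card J = 1 \<Longrightarrow> blockvec I J 1 (-1) \<in> rayvecs"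
    and "card I = 2 \<Longrightarrow> card J = 2 \<Longrightarrow> blockvec I J 1 (-1) \<in> rayvecs"
    and "card I = 2 \<Longrightarrow> card J = 3 \<Longrightarrow> blockvec I J 3 (-2) \<in> rayvecs"
proof -
  show "card I = 1 \<Longrightarrow> card J = 1 \<Longrightarrow> blockvec I J 1 (-1) \<in> rayvecs"
    by (rule blockvec_orbit[of "{1}" "{2}"]) (use assms in \<open>auto simp: Omega_eq vec5_eq blockvec_def\<close>)
  show "card I = 2 \<Longrightarrow> card J = 2 \<Longrightarrow> blockvec I J 1 (-1) \<in> rayvecs"
    by (rule blockvec_orbit[of "{1, 2}" "{3, 4}"]) (use assms in \<open>auto simp: Omega_eq vec5_eq blockvec_def\<close>)
  show "card I = 2 \<Longrightarrow> card J = 3 \<Longrightarrow> blockvec I J 3 (-2) \<in> rayvecs"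
    by (rule blockvec_orbit[of "{1, 2}" "{3, 4, 0}"]) (use assms in \<open>auto simp: Omega_eq vec5_eq blockvec_def\<close>)
qed

lemma root_rayvecs:
  assumes "i \<noteq> j"
  shows "axis i 1 - axis j 1 \<in> rayvecs"
proof -
  have "blockvec {i} {j} 1 (-1) = axis i 1 - axis j 1"
    using assms by (auto simp: vec_eq_iff blockvec_def axis_def)
  then show ?thesis using block_rayvecs(1)[of "{i}" "{j}"] assms by simp
qed


subsection \<open>Invariant expansions\<close>

text \<open>The integral combinations of ray generators that have all the symmetries of their value.\<close>

definition symmetric_expansion :: "(real^5 \<Rightarrow> int) \<Rightarrow> real^5 \<Rightarrow> bool" where
  "symmetric_expansion c x \<longleftrightarrow> (\<Sum>w\<in>rayvecs. of_int (c w) *\<^sub>R w) = x \<and>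
     (\<forall>g\<in>carrier Aut_A4. g x = x \<longrightarrow> (\<forall>w. c (g w) = c w))"

lemma symmetric_expansionI:
  assumes W: "W \<subseteq> rayvecs" and sum: "(\<Sum>w\<in>W. f w *\<^sub>R w) = x" and int: "\<And>w. w \<in> W \<Longrightarrow> f w \<in> \<int>"
    and inv: "\<And>g w. g \<in> carrier Aut_A4 \<Longrightarrow> g x = x \<Longrightarrow> w \<in> W \<Longrightarrow> g w \<in> W \<and> f (g w) = f w"
  shows "\<exists>c. symmetric_expansion c x"
proof
  let ?c = "\<lambda>w. if w \<in> W then \<lfloor>f w\<rfloor> else 0"
  have "(\<Sum>w\<in>rayvecs. of_int (?c w) *\<^sub>R w) = (\<Sum>w\<in>W. of_int (?c w) *\<^sub>R w)"
    by (rule sum.mono_neutral_right) (use W finite_rayvecs in auto)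
  also have "\<dots> = (\<Sum>w\<in>W. f w *\<^sub>R w)"
    by (rule sum.cong) (use int in \<open>auto elim!: Ints_cases dest!: int\<close>)
  finally have "(\<Sum>w\<in>rayvecs. of_int (?c w) *\<^sub>R w) = x" using sum by simp
  moreover have "?c (g w) = ?c w" if g: "g \<in> carrier Aut_A4" "g x = x" for g w
  proof (cases "w \<in> W")
    case True then show ?thesis using inv[OF g True] by simp
  next
    case False
    interpret group Aut_A4 by (rule group_Aut)
    let ?h = "inv\<^bsub>Aut_A4\<^esub> g"
    have "?h x = x" using Aut_inv(1)[OF g(1), of x] g(2) by simp
    then have "w \<in> W" if "g w \<in> W"
      using inv[of ?h "g w"] that g by (simp add: Aut_inv[OF g(1)])
    with False show ?thesis by auto
  qed
  ultimately show "symmetric_expansion ?c x" by (simp add: symmetric_expansion_def)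
qed

lemma expand_at:
  fixes x :: "real^5"
  assumes "(\<Sum>i\<in>UNIV. x $ i) = 0"
  shows "(\<Sum>j\<in>UNIV - {i}. x $ j *\<^sub>R (axis j 1 - axis i 1)) = x"
proof -
  have 1: "(\<Sum>j\<in>UNIV - {i}. x $ j) = - x $ i"
    using assms by (simp add: sum_diff1)
  have 2: "(\<Sum>j\<in>UNIV - {i}. x $ j *\<^sub>R (axis j 1 - axis i 1)) =
      (\<Sum>j\<in>UNIV - {i}. x $ j *\<^sub>R axis j 1) - (\<Sum>j\<in>UNIV - {i}. x $ j) *\<^sub>R axis i 1"
    by (simp add: scaleR_diff_right sum_subtractf scaleR_sum_left)
  have 3: "(\<Sum>j\<in>UNIV - {i}. x $ j *\<^sub>R axis j 1) = (\<Sum>j\<in>UNIV. x $ j *\<^sub>R axis j 1) - x $ i *\<^sub>R axis i 1"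
    by (simp add: sum_diff1)
  have 4: "(\<Sum>j\<in>UNIV. x $ j *\<^sub>R axis j 1) = x"
    by (simp add: vec_eq_iff axis_def if_distrib cong: if_cong)
  show ?thesis unfolding 2 unfolding 1 3 4 by simp
qed

text \<open>
  A coordinate value taken only at \<open>i\<close>: permutations that fix the vector fix \<open>i\<close>, so they permute
  the roots \<open>e\<^sub>j - e\<^sub>i\<close>, in terms of which the vector has its own coordinates as coefficients.
\<close>

lemma symmetric_expansion_isolated:
  assumes x: "x \<in> intvec" and i: "\<And>j. j \<noteq> i \<Longrightarrow> x $ j \<noteq> x $ i"
    and pos: "\<And>p. bij p \<Longrightarrow> sperm (-1) p x \<noteq> x"
  shows "\<exists>c. symmetric_expansion c x"
proof (rule symmetric_expansionI)
  let ?r = "\<lambda>j. axis j 1 - axis i 1 :: real^5"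
  let ?W = "?r ` (UNIV - {i})"
  \<comment> \<open>In terms of the scalar product, the invariance of the coefficients is that of the scalar product.\<close>
  let ?f = "\<lambda>w. inner x w + x $ i"
  have f: "?f (?r j) = x $ j" for j by (simp add: inner_diff_right inner_axis)
  have inj: "inj_on ?r (UNIV - {i})" by (auto simp: inj_on_def axis_eq_axis)
  show "?W \<subseteq> rayvecs" using root_rayvecs by auto
  show "(\<Sum>w\<in>?W. ?f w *\<^sub>R w) = x"
    using x expand_at[of x i] by (simp add: sum.reindex[OF inj] f intvec_def del: scaleR_diff_right)
  show "?f w \<in> \<int>" if "w \<in> ?W" for w
  proof -
    obtain j where "w = ?r j" using \<open>w \<in> ?W\<close> by auto
    then have "?f w = x $ j" by (simp only: f)
    then show ?thesis using x by (simp only: intvec_def mem_Collect_eq)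
  qed
  fix g w assume g: "g \<in> carrier Aut_A4" "g x = x" and w: "w \<in> ?W"
  obtain p where gp: "g = sperm 1 p" and p: "bij p"
    using g pos by (auto elim!: AutE)
  have xp: "x $ p j = x $ j" for j
    using g(2) sperm_nth'[OF p, of 1 x j] gp by simp
  have pi: "p i = i" using i[of "p i"] xp by metis
  obtain j where j: "j \<noteq> i" "w = ?r j" using w by auto
  have ax: "sperm 1 p (axis k 1) = axis (p k) 1" for k
    using p by (auto simp: vec_eq_iff sperm_nth axis_def bij_inv_eq_iff bij_is_surj surj_f_inv_f bij_is_inj)
  have "g w = ?r (p j)"
    using j ax by (simp add: gp linear_diff[OF sperm_linear] pi)
  moreover have "p j \<noteq> i" using j(1) pi p by (metis bij_inv_eq_iff)
  ultimately show "g w \<in> ?W \<and> ?f (g w) = ?f w"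
    using Aut_inner[OF g(1), of x w] g(2) by simp
qed

text \<open>
  A vector that is mapped to itself by a permutation followed by a change of sign has as many
  coordinates equal to \<open>a\<close> as to \<open>-a\<close>, hence at most two if \<open>a \<noteq> 0\<close>. It is the sum over \<open>a > 0\<close> of
  \<open>a\<close> times the difference of the indicator functions of these two sets of coordinates.
\<close>

lemma symmetric_expansion_balanced:
  assumes x: "x \<in> intvec" and q: "bij q" "sperm (-1) q x = x"
  shows "\<exists>c. symmetric_expansion c x"
proof (rule symmetric_expansionI)
  define T where "T = {a. a > 0 \<and> (\<exists>i. x $ i = a)}"
  define h :: "real \<Rightarrow> real \<Rightarrow> real" where "h a t = (if t = a then 1 else if t = - a then - 1 else 0)" for a t
  define w where "w a = (\<chi> i. h a (x $ i))" for a
  \<comment> \<open>The vectors \<open>w a\<close> are orthogonal, so these are the coefficients of \<open>x\<close>.\<close>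
  let ?f = "\<lambda>v. inner x v / inner v v"
  have T: "finite T"
    by (rule finite_subset[of _ "range (\<lambda>i. x $ i)"]) (auto simp: T_def)
  have inv: "g (w a) = w a" if "g \<in> carrier Aut_A4" "g x = x" "a \<in> T" for g a
  proof -
    obtain e p where gp: "g = sperm e p" "e \<in> {1, -1}" "bij p"
      by (rule AutE[OF \<open>g \<in> carrier Aut_A4\<close>])
    have xe: "x $ i = e * x $ inv' p i" for i
      using that(2) sperm_nth[of e p x i] gp(1) by simp
    have odd: "h a (e * t) = e * h a t" for t
      using gp(2) \<open>a \<in> T\<close> by (auto simp: h_def T_def)
    have "e * h a (x $ inv' p i) = h a (x $ i)" for i
      using odd[of "x $ inv' p i"] by (simp only: xe[of i, symmetric])
    then show ?thesis by (simp add: w_def gp(1) vec_eq_iff sperm_nth)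
  qed
  have xq: "x $ q i = - x $ i" for i
    using sperm_nth'[OF q(1), of "-1" x i] q(2) by simp
  have cards: "card {i. x $ i = - a} = card {i. x $ i = a}" for a
  proof (rule bij_betw_same_card[symmetric])
    show "bij_betw q {i. x $ i = a} {i. x $ i = - a}"
    proof (rule bij_betw_imageI)
      show "inj_on q {i. x $ i = a}" using bij_is_inj[OF q(1)] by (rule inj_on_subset) simp
      show "q ` {i. x $ i = a} = {i. x $ i = - a}"
      proof (intro equalityI subsetI)
        fix j assume j: "j \<in> {i. x $ i = - a}"
        obtain i where i: "j = q i" using bij_is_surj[OF q(1)] by (auto elim: surjE)
        with j xq[of i] have "x $ i = a" by simp
        with i show "j \<in> q ` {i. x $ i = a}" by simp
      qed (auto simp: xq)
    qed
  qed
  have w_ray: "w a \<in> rayvecs" if a: "a \<in> T" for a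
  proof -
    let ?I = "{i. x $ i = a}" and ?J = "{i. x $ i = - a}"
    have disj: "?I \<inter> ?J = {}" using a by (auto simp: T_def)
    have "card ?I + card ?J = card (?I \<union> ?J)" using disj by (simp add: card_Un_disjoint)
    also have "\<dots> \<le> card (UNIV :: 5 set)" by (rule card_mono) auto
    finally have "card ?I \<le> 2" using cards[of a] by simp
    moreover have "card ?I \<noteq> 0" using a by (auto simp: T_def)
    ultimately have "card ?I = 1 \<or> card ?I = 2" by linarith
    then have "blockvec ?I ?J 1 (-1) \<in> rayvecs"
      using block_rayvecs(1,2)[OF disj] cards[of a] by auto
    moreover have "blockvec ?I ?J 1 (-1) = w a"
      by (simp add: vec_eq_iff blockvec_def w_def h_def)
    ultimately show ?thesis by simp
  qed
  have f_w: "?f (w a) = a" if a: "a \<in> T" for a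
  proof -
    have "inner x (w a) = (\<Sum>i\<in>UNIV. a * (h a (x $ i) * h a (x $ i)))"
      unfolding inner_vec_def w_def by (rule sum.cong) (auto simp: h_def)
    also have "\<dots> = a * inner (w a) (w a)" by (simp add: inner_vec_def w_def sum_distrib_left)
    finally have *: "inner x (w a) = a * inner (w a) (w a)" .
    obtain i where "x $ i = a" using a by (auto simp: T_def)
    then have "w a $ i \<noteq> 0" by (simp add: w_def h_def)
    then have "w a \<noteq> 0" by auto
    then show ?thesis using * by simp
  qed
  have inj: "inj_on w T" by (rule inj_on_inverseI[of _ ?f]) (rule f_w)
  show "w ` T \<subseteq> rayvecs" using w_ray by auto
  show "?f v \<in> \<int>" if "v \<in> w ` T" for v
  proof -
    obtain a where "a \<in> T" "v = w a" using \<open>v \<in> w ` T\<close> by blast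
    then have "?f v = a" using f_w by (simp only:)
    moreover have "a \<in> \<int>" using x \<open>a \<in> T\<close> by (auto simp: T_def intvec_def)
    ultimately show ?thesis by (simp only:)
  qed
  show "g v \<in> w ` T \<and> ?f (g v) = ?f v" if "g \<in> carrier Aut_A4" "g x = x" "v \<in> w ` T" for g v
  proof -
    have "g v = v" using inv[OF \<open>g \<in> carrier Aut_A4\<close> \<open>g x = x\<close>] \<open>v \<in> w ` T\<close> by blast
    then show ?thesis using \<open>v \<in> w ` T\<close> by simp
  qed
  have "(\<Sum>v\<in>w ` T. ?f v *\<^sub>R v) = (\<Sum>a\<in>T. a *\<^sub>R w a)"
    by (simp add: sum.reindex[OF inj] f_w)
  also have "\<dots> = x"
  proof (rule vec_eq_iff[THEN iffD2], rule allI)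
    fix i
    have "(\<Sum>a\<in>T. a *\<^sub>R w a) $ i = (\<Sum>a\<in>T. if a = \<bar>x $ i\<bar> then x $ i else 0)"
      unfolding sum_component by (rule sum.cong) (auto simp: w_def h_def T_def)
    also have "\<dots> = x $ i"
    proof (cases "x $ i = 0")
      case False
      have "\<bar>x $ i\<bar> \<in> T"
        using False xq[of i] by (auto simp: T_def abs_if)
      then show ?thesis using T by simp
    next
      case True
      then show ?thesis by (simp only: if_cancel sum.neutral_const)
    qed
    finally show "(\<Sum>a\<in>T. a *\<^sub>R w a) $ i = x $ i" .
  qed
  finally show "(\<Sum>v\<in>w ` T. ?f v *\<^sub>R v) = x" .
qed

text \<open>
  Otherwise every coordinate value is taken at least twice, which leaves the zero vector and the
  multiples of vectors with blocks of sizes 2 and 3.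
\<close>

lemma symmetric_expansion_two_blocks:
  assumes x: "x \<in> intvec" and dup: "\<And>i. \<exists>j. j \<noteq> i \<and> x $ j = x $ i"
  shows "\<exists>c. symmetric_expansion c x"
proof (cases "x = 0")
  case True
  then show ?thesis by (intro symmetric_expansionI[of "{}"]) auto
next
  case False
  define L where "L i = {j. x $ j = x $ i}" for i
  have L2: "2 \<le> card (L i)" for i
  proof -
    obtain j where "j \<noteq> i" "x $ j = x $ i" using dup by blast
    then have "card {i, j} \<le> card (L i)" by (intro card_mono) (auto simp: L_def)
    then show ?thesis using \<open>j \<noteq> i\<close> by simp
  qed
  have disj: "L i \<inter> L j = {}" if "j \<notin> L i" for i j using that by (auto simp: L_def)
  have "L 0 \<noteq> UNIV"
  proof
    assume "L 0 = UNIV"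
    then have const: "x $ i = x $ 0" for i by (auto simp: L_def)
    have "5 * x $ 0 = (\<Sum>i\<in>(UNIV :: 5 set). x $ 0)" by simp
    also have "\<dots> = (\<Sum>i\<in>UNIV. x $ i)" by (intro sum.cong refl) (rule const[symmetric])
    finally have "x $ 0 = 0" using x by (simp add: intvec_def)
    with const False show False by (simp add: vec_eq_iff)
  qed
  then obtain k where k: "k \<notin> L 0" by auto
  have un: "L 0 \<union> L k = UNIV"
  proof (rule ccontr)
    assume "L 0 \<union> L k \<noteq> UNIV"
    then obtain m where m: "m \<notin> L 0" "m \<notin> L k" by auto
    have "(L 0 \<union> L k) \<inter> L m = {}" using disj[OF m(1)] disj[OF m(2)] by auto
    then have "card (L 0) + card (L k) + card (L m) = card (L 0 \<union> L k \<union> L m)"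
      using disj[OF k] by (simp add: card_Un_disjoint)
    also have "\<dots> \<le> card (UNIV :: 5 set)" by (rule card_mono) auto
    finally show False using L2[of 0] L2[of k] L2[of m] by simp
  qed
  have "card (L 0 \<union> L k) = card (L 0) + card (L k)"
    using disj[OF k] by (intro card_Un_disjoint) auto
  then have "card (L 0) + card (L k) = 5" unfolding un by simp
  then have "card (L 0) = 2 \<and> card (L k) = 3 \<or> card (L k) = 2 \<and> card (L 0) = 3"
    using L2[of 0] L2[of k] by linarith
  then obtain i j where ij: "card (L i) = 2" "card (L j) = 3" "L i \<inter> L j = {}" "L i \<union> L j = UNIV"
    using disj[OF k] un by blast
  have "(\<Sum>m\<in>UNIV. x $ m) = (\<Sum>m\<in>L i. x $ m) + (\<Sum>m\<in>L j. x $ m)"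
    unfolding ij(4)[symmetric] by (rule sum.union_disjoint) (auto simp: ij)
  also have "(\<Sum>m\<in>L i. x $ m) = (\<Sum>m\<in>L i. x $ i)" by (rule sum.cong) (auto simp: L_def)
  also have "(\<Sum>m\<in>L j. x $ m) = (\<Sum>m\<in>L j. x $ j)" by (rule sum.cong) (auto simp: L_def)
  finally have eq: "2 * x $ i + 3 * x $ j = 0" using x ij by (simp add: intvec_def)
  have "x $ i \<in> \<int>" "x $ j \<in> \<int>" using x by (simp_all add: intvec_def)
  then obtain a b where ab: "x $ i = of_int a" "x $ j = of_int b" by (elim Ints_cases)
  define c where "c = a + b"
  have "2 * a + 3 * b = 0" using eq unfolding ab by linarith
  then have c: "a = 3 * c" "b = - 2 * c" unfolding c_def by auto
  let ?s = "blockvec (L i) (L j) 3 (-2)"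
  have xs: "x = of_int c *\<^sub>R ?s"
  proof -
    have "x $ m = of_int c * ?s $ m" for m
    proof (cases "m \<in> L i")
      case True then show ?thesis using ab c by (simp add: blockvec_def L_def)
    next
      case F: False
      then have m: "m \<in> L j" using ij by auto
      then have "x $ m = x $ j" by (simp add: L_def)
      then show ?thesis using F m ab c by (simp add: blockvec_def)
    qed
    then show ?thesis by (simp add: vec_eq_iff)
  qed
  show ?thesis
  proof (rule symmetric_expansionI[of "{?s}" "\<lambda>_. of_int c"])
    show "{?s} \<subseteq> rayvecs" using block_rayvecs(3)[OF ij(3,1,2)] by simp
    fix g w assume g: "g \<in> carrier Aut_A4" "g x = x" "w \<in> {?s}"
    have "of_int c *\<^sub>R g ?s = of_int c *\<^sub>R ?s"
      using g(2) unfolding xs by (simp add: linear_scale[OF Aut_linear[OF g(1)]])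
    moreover have "c \<noteq> 0" using xs False by auto
    ultimately show "g w \<in> {?s} \<and> real_of_int c = real_of_int c" using g(3) by simp
  qed (use xs in auto)
qed

text \<open>
  If no sign change is involved in the symmetries of \<open>x\<close>, they preserve the sets of equal coordinates,
  and either some coordinate value is taken only once or each of them is taken at least twice.
\<close>

theorem symmetric_expansion_exists:
  assumes x: "x \<in> intvec"
  shows "\<exists>c. symmetric_expansion c x"
proof (cases "\<exists>q. bij q \<and> sperm (-1) q x = x")
  case True
  then show ?thesis using symmetric_expansion_balanced[OF x] by blast
next
  case False
  show ?thesis
  proof (cases "\<exists>i. \<forall>j. j \<noteq> i \<longrightarrow> x $ j \<noteq> x $ i")
    case True
    then show ?thesis using symmetric_expansion_isolated[OF x] False by blast
  qed (use symmetric_expansion_two_blocks[OF x] in blast)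
qed


section \<open>Faces of finitely generated cones\<close>

lemma Cone_eq_sums:
  assumes "finite S"
  shows "Cone S = {\<Sum>w\<in>S. c w *\<^sub>R w | c. \<forall>w\<in>S. 0 \<le> c w}" (is "_ = ?R")
proof (intro equalityI subsetI)
  have "convex_cone ?R"
    unfolding convex_cone_iff
  proof (intro conjI ballI allI impI)
    show "0 \<in> ?R" by (intro CollectI exI[of _ "\<lambda>_. 0"]) simp
    fix x y assume "x \<in> ?R" "y \<in> ?R"
    then obtain c d where "x = (\<Sum>w\<in>S. c w *\<^sub>R w)" "y = (\<Sum>w\<in>S. d w *\<^sub>R w)" "\<forall>w\<in>S. 0 \<le> c w" "\<forall>w\<in>S. 0 \<le> d w"
      by blast
    then show "x + y \<in> ?R"
      by (intro CollectI exI[of _ "\<lambda>w. c w + d w"]) (simp add: scaleR_add_left sum.distrib)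
  next
    fix x t assume "x \<in> ?R" "0 \<le> (t :: real)"
    then obtain c where "x = (\<Sum>w\<in>S. c w *\<^sub>R w)" "\<forall>w\<in>S. 0 \<le> c w" by blast
    with \<open>0 \<le> t\<close> show "t *\<^sub>R x \<in> ?R"
      by (intro CollectI exI[of _ "\<lambda>w. t * c w"]) (simp add: scaleR_sum_right)
  qed
  moreover have "S \<subseteq> ?R"
  proof
    fix v assume "v \<in> S"
    then have "(\<Sum>w\<in>S. (if w = v then 1 else 0) *\<^sub>R w) = v"
      using assms by (simp add: if_distrib[of "\<lambda>t. t *\<^sub>R _"] cong: if_cong)
    then show "v \<in> ?R" by (intro CollectI exI[of _ "\<lambda>w. if w = v then 1 else 0"]) auto
  qed
  ultimately have "Cone S \<subseteq> ?R" by (intro hull_minimal)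
  then show "x \<in> ?R" if "x \<in> Cone S" for x using that by blast
next
  fix x assume "x \<in> ?R"
  then obtain c where x: "x = (\<Sum>w\<in>S. c w *\<^sub>R w)" and c: "\<forall>w\<in>S. 0 \<le> c w" by blast
  have "(\<Sum>w\<in>T. c w *\<^sub>R w) \<in> Cone S" if "T \<subseteq> S" for T
    using finite_subset[OF that assms] that
    by (induction T rule: finite_induct)
      (use c in \<open>simp_all add: convex_cone_hull_add convex_cone_hull_mul hull_inc convex_cone_hull_contains_0\<close>)
  then show "x \<in> Cone S" using x by blast
qed

lemma Cone_singleton: "Cone {w} = {t *\<^sub>R w | t. 0 \<le> t}"
  by (auto simp: Cone_eq_sums intro: exI[of _ "\<lambda>_. _"])

lemma dim_Cone_singleton: "w \<noteq> 0 \<Longrightarrow> dim (Cone {w}) = 1"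
proof -
  assume w: "w \<noteq> 0"
  have "Cone {w} \<subseteq> span {w}"
    unfolding Cone_singleton by (auto intro: span_scale span_base)
  then have "dim (Cone {w}) \<le> dim {w}" by (metis dim_span dim_subset)
  moreover have "dim {w} \<le> dim (Cone {w})" by (rule dim_subset) (simp add: hull_subset)
  ultimately show ?thesis using w by simp
qed

context
  fixes F C :: "(real^5) set"
  assumes face: "F face_of C" and C: "convex_cone C"
begin

lemma face_segment: "a \<in> C \<Longrightarrow> b \<in> C \<Longrightarrow> x \<in> F \<Longrightarrow> x \<in> open_segment a b \<Longrightarrow> a \<in> F \<and> b \<in> F"
  using face unfolding face_of_def by blast

lemma face_scale:
  assumes z: "z \<in> F" and t: "0 \<le> t"
  shows "t *\<^sub>R z \<in> F"
proof (cases "z = 0")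
  case True
  then show ?thesis using z by simp
next
  case False
  have zC: "z \<in> C" using z face face_of_imp_subset by blast
  have 0: "0 \<in> C" using C by (rule convex_cone_contains_0)
  have ray: "0 \<in> F \<and> s *\<^sub>R z \<in> F" if s: "1 < s" for s
  proof (rule face_segment[OF 0 _ z])
    show "s *\<^sub>R z \<in> C" using convex_cone_scaleR[OF C _ zC] s by simp
    show "z \<in> open_segment 0 (s *\<^sub>R z)"
      unfolding in_segment(2) using s False by (intro conjI exI[of _ "1 / s"]) auto
  qed
  have "t *\<^sub>R z \<in> F" if "t \<le> 1"
  proof -
    have "convex F" using face by (rule face_of_imp_convex)
    then have "(1 - t) *\<^sub>R 0 + t *\<^sub>R z \<in> F"
      using ray[of 2] z t that by (intro convexD) auto
    then show ?thesis by simp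
  qed
  then show ?thesis using ray[of t] by fastforce
qed

lemma face_add: "x \<in> F \<Longrightarrow> y \<in> F \<Longrightarrow> x + y \<in> F"
proof -
  assume "x \<in> F" "y \<in> F"
  then have "(1 / 2) *\<^sub>R x + (1 / 2) *\<^sub>R y \<in> F"
    using face_of_imp_convex[OF face] by (intro convexD) auto
  from face_scale[OF this, of 2] show ?thesis by (simp add: scaleR_add_right)
qed

lemma face_summand:
  assumes "a \<in> C" "b \<in> C" "a + b \<in> F"
  shows "a \<in> F"
proof (cases "a = b")
  case True
  then have "a = (1 / 2) *\<^sub>R (a + b)" by (simp flip: scaleR_2)
  then show ?thesis using face_scale[OF assms(3), of "1 / 2"] by simp
next
  case False
  have "a + b \<in> open_segment (2 *\<^sub>R a) (2 *\<^sub>R b)"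
    unfolding in_segment(2) using False by (intro conjI exI[of _ "1 / 2"]) auto
  moreover have "2 *\<^sub>R a \<in> C" "2 *\<^sub>R b \<in> C"
    using convex_cone_scaleR[OF C _ assms(1), of 2] convex_cone_scaleR[OF C _ assms(2), of 2] by simp_all
  ultimately have "2 *\<^sub>R a \<in> F" using face_segment[OF _ _ assms(3)] by blast
  from face_scale[OF this, of "1 / 2"] show ?thesis by simp
qed

end

text \<open>
  If a nonnegative combination of generators is in a face, so is each of its summands, hence each
  generator that occurs.
\<close>

lemma face_of_Cone:
  assumes S: "finite S" and F: "F face_of Cone S" "F \<noteq> {}"
  shows "F = Cone (S \<inter> F)"
proof (intro equalityI subsetI)
  note cone = convex_cone_convex_cone_hull[of S]
  fix y assume y: "y \<in> F"
  then obtain c where yc: "y = (\<Sum>w\<in>S. c w *\<^sub>R w)" and c: "\<forall>w\<in>S. 0 \<le> c w"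
    using F(1) face_of_imp_subset Cone_eq_sums[OF S] by blast
  have pos: "w \<in> F" if w: "w \<in> S" "0 < c w" for w
  proof -
    have sum: "y = c w *\<^sub>R w + (\<Sum>w\<in>S - {w}. c w *\<^sub>R w)" unfolding yc by (rule sum.remove[OF S w(1)])
    have "(\<Sum>w\<in>S - {w}. c w *\<^sub>R w) = (\<Sum>v\<in>S. (if v = w then 0 else c v) *\<^sub>R v)"
      by (rule sum.mono_neutral_cong_left) (use S in auto)
    also have "\<dots> \<in> Cone S" unfolding Cone_eq_sums[OF S] using c by fastforce
    finally have "c w *\<^sub>R w \<in> F"
      using face_summand[OF F(1) cone, of "c w *\<^sub>R w"] w y unfolding sum
      by (simp add: convex_cone_hull_mul hull_inc)
    from face_scale[OF F(1) cone this, of "1 / c w"] show ?thesis using w(2) by simp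
  qed
  have "y = (\<Sum>w\<in>S \<inter> F. c w *\<^sub>R w)"
    unfolding yc by (rule sum.mono_neutral_right) (use S c pos in \<open>force simp: order_le_less\<close>)+
  then show "y \<in> Cone (S \<inter> F)"
    using Cone_eq_sums[of "S \<inter> F"] S c by blast
next
  note cone = convex_cone_convex_cone_hull[of S]
  have "convex_cone F"
    unfolding convex_cone_iff using face_add[OF F(1) cone] face_scale[OF F(1) cone] F(2)
    by (metis all_not_in_conv order_refl scaleR_zero_left)
  then have "Cone (S \<inter> F) \<subseteq> F" by (intro hull_minimal) auto
  then show "y \<in> F" if "y \<in> Cone (S \<inter> F)" for y using that by blast
qed

lemma inner_Cone_nonneg:
  assumes "\<And>w. w \<in> S \<Longrightarrow> 0 \<le> inner u w" "y \<in> Cone S"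
  shows "0 \<le> inner u y"
proof -
  have "Cone S \<subseteq> {x. inner u x \<ge> 0}"
    by (rule hull_minimal) (use assms(1) convex_cone_halfspace_ge in auto)
  then show ?thesis using assms(2) by blast
qed

lemma ray_of_Cone:
  assumes S: "finite S" and u: "\<And>w. w \<in> S \<Longrightarrow> 0 < inner u w"
    and F: "F face_of Cone S" "dim F = 1"
  obtains w where "w \<in> S" "F = Cone {w}"
proof -
  have ne: "F \<noteq> {}" using F(2) by auto
  note FS = face_of_Cone[OF S F(1) ne]
  have "S \<inter> F \<noteq> {}"
  proof
    assume "S \<inter> F = {}"
    then have "F = {0}" using FS by simp
    then show False using F(2) by simp
  qed
  then obtain w where w: "w \<in> S" "w \<in> F" by blast
  then have w0: "w \<noteq> 0" using u[of w] by auto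
  have sp: "F \<subseteq> span {w}"
    by (rule card_ge_dim_independent) (use w w0 F(2) in auto)
  have "F = Cone {w}"
  proof (intro equalityI subsetI)
    fix y assume y: "y \<in> F"
    then obtain t where t: "y = t *\<^sub>R w" using sp by (auto simp: span_singleton)
    have yS: "y \<in> Cone S" using y F(1) face_of_imp_subset by blast
    have "0 \<le> inner u y" by (rule inner_Cone_nonneg[OF _ yS]) (rule less_imp_le[OF u])
    then have "0 \<le> t" using u[OF w(1)] unfolding t by (simp add: zero_le_mult_iff)
    then show "y \<in> Cone {w}" unfolding Cone_singleton t by blast
  next
    fix y assume "y \<in> Cone {w}"
    moreover have "Cone {w} \<subseteq> Cone (S \<inter> F)" using w by (intro hull_mono) simp
    ultimately show "y \<in> F" using FS by blast
  qed
  with w(1) show thesis by (rule that)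
qed

lemma Cone_insert_Cone: "Cone (insert v (Cone T)) = Cone (insert v T)"
proof (intro equalityI)
  have "insert v (Cone T) \<subseteq> Cone (insert v T)"
    by (metis hull_inc hull_mono insertI1 insert_subset subset_insertI)
  then show "Cone (insert v (Cone T)) \<subseteq> Cone (insert v T)"
    by (rule hull_minimal) (rule convex_cone_convex_cone_hull)
  show "Cone (insert v T) \<subseteq> Cone (insert v (Cone T))"
    by (intro hull_mono insert_mono hull_subset)
qed

text \<open>
  In a nonnegative combination of generators that lies on a supporting hyperplane, the terms off the
  hyperplane vanish, so the hyperplane cuts out the cone of the generators on it.
\<close>

lemma Cone_subset_face:
  assumes S: "finite S" and T: "T \<subseteq> S" and zero: "\<And>w. w \<in> T \<Longrightarrow> inner u w = 0"
    and pos: "\<And>w. w \<in> S - T \<Longrightarrow> 0 < inner u w"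
  shows "Cone T face_of Cone S"
  unfolding face_of_def
proof (intro conjI ballI impI)
  show "Cone T \<subseteq> Cone S" using T by (rule hull_mono)
  show "convex (Cone T)" by (rule convex_convex_cone_hull)
  have nonneg: "0 \<le> inner u y" if "y \<in> Cone S" for y
    by (rule inner_Cone_nonneg[OF _ that]) (metis Diff_iff order_le_less zero pos)
  have in_T: "y \<in> Cone T" if y: "y \<in> Cone S" "inner u y = 0" for y
  proof -
    obtain c where yc: "y = (\<Sum>w\<in>S. c w *\<^sub>R w)" and c: "\<forall>w\<in>S. 0 \<le> c w"
      using y(1) Cone_eq_sums[OF S] by blast
    have terms: "0 \<le> c w * inner u w" if "w \<in> S" for w
      using c that zero pos by (cases "w \<in> T") (simp_all add: less_imp_le)
    have "(\<Sum>w\<in>S. c w * inner u w) = 0" using y(2) unfolding yc by (simp add: inner_sum_right)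
    then have "c w * inner u w = 0" if "w \<in> S" for w
      using sum_nonneg_eq_0_iff[OF S, of "\<lambda>w. c w * inner u w"] terms that by blast
    then have "c w = 0" if "w \<in> S - T" for w using pos[OF that] that by (metis DiffD1 less_irrefl mult_eq_0_iff)
    then have "y = (\<Sum>w\<in>T. c w *\<^sub>R w)" unfolding yc by (intro sum.mono_neutral_right) (use S T in auto)
    then show ?thesis using Cone_eq_sums[OF finite_subset[OF T S]] c T by blast
  qed
  have zero_T: "inner u y = 0" if "y \<in> Cone T" for y
  proof -
    have "0 \<le> inner u y" by (rule inner_Cone_nonneg[OF _ that]) (simp add: zero)
    moreover have "0 \<le> inner (- u) y" by (rule inner_Cone_nonneg[OF _ that]) (simp add: zero)
    ultimately show ?thesis by simp
  qed
  fix a b y assume ab: "a \<in> Cone S" "b \<in> Cone S" and "y \<in> Cone T" "y \<in> open_segment a b"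
  then obtain t where t: "0 < t" "t < 1" "y = (1 - t) *\<^sub>R a + t *\<^sub>R b" by (auto simp: in_segment)
  have "(1 - t) * inner u a + t * inner u b = 0"
    using zero_T[OF \<open>y \<in> Cone T\<close>] unfolding t(3) by (simp add: inner_add_right)
  moreover have "0 \<le> (1 - t) * inner u a" "0 \<le> t * inner u b" using nonneg ab t by simp_all
  ultimately have "(1 - t) * inner u a = 0" "t * inner u b = 0" by linarith+
  then show "a \<in> Cone T" "b \<in> Cone T" using in_T ab t by simp_all
qed


section \<open>The rays of the fan\<close>

lemma gamma_paths:
  "gamma path0 = {vec5 1 (-1) 0 0 0, vec5 2 (-1) (-1) 0 0, vec5 3 (-1) (-1) (-1) 0, vec5 4 (-1) (-1) (-1) (-1)}"
  "gamma path1 = {vec5 0 1 (-1) 0 0, vec5 0 2 (-1) (-1) 0, vec5 0 3 (-1) (-1) (-1), vec5 3 3 (-2) (-2) (-2)}"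
  "gamma path2 = {vec5 0 1 (-1) 0 0, vec5 1 1 (-2) 0 0, vec5 1 1 (-1) (-1) 0, vec5 3 3 (-2) (-2) (-2)}"
  "gamma path3 = {vec5 0 1 (-1) 0 0, vec5 0 2 (-1) (-1) 0, vec5 1 1 (-1) (-1) 0, vec5 3 3 (-2) (-2) (-2)}"
proof -
  have 2: "1 + 1 = (2::nat)" "2 + 1 = (3::nat)" by simp_all
  have s: "svec {1} {2} = vec5 1 (-1) 0 0 0" "svec {1} {2, 3} = vec5 2 (-1) (-1) 0 0"
    "svec {1} {2, 3, 4} = vec5 3 (-1) (-1) (-1) 0" "svec {1} {2, 3, 4, 5} = vec5 4 (-1) (-1) (-1) (-1)"
    "svec {2} {3} = vec5 0 1 (-1) 0 0" "svec {2} {3, 4} = vec5 0 2 (-1) (-1) 0"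
    "svec {2} {3, 4, 5} = vec5 0 3 (-1) (-1) (-1)" "svec {1, 2} {3} = vec5 1 1 (-2) 0 0"
    "svec {1, 2} {3, 4} = vec5 1 1 (-1) (-1) 0" "svec {1, 2} {3, 4, 5} = vec5 3 3 (-2) (-2) (-2)"
    unfolding svec_def vec5_eq by (simp_all add: evec_nth gcd.commute[of 2])
  show "gamma path0 = {vec5 1 (-1) 0 0 0, vec5 2 (-1) (-1) 0 0, vec5 3 (-1) (-1) (-1) 0, vec5 4 (-1) (-1) (-1) (-1)}"
    "gamma path1 = {vec5 0 1 (-1) 0 0, vec5 0 2 (-1) (-1) 0, vec5 0 3 (-1) (-1) (-1), vec5 3 3 (-2) (-2) (-2)}"
    "gamma path2 = {vec5 0 1 (-1) 0 0, vec5 1 1 (-2) 0 0, vec5 1 1 (-1) (-1) 0, vec5 3 3 (-2) (-2) (-2)}"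
    "gamma path3 = {vec5 0 1 (-1) 0 0, vec5 0 2 (-1) (-1) 0, vec5 1 1 (-1) (-1) 0, vec5 3 3 (-2) (-2) (-2)}"
    unfolding gamma_def path0_def path1_def path2_def path3_def Let_def list.sel fst_conv list.set
      image_insert image_empty prod.case 2 nat_intervals s by (rule refl)+
qed

lemma sperm_eqI: "bij p \<Longrightarrow> (\<forall>i. y $ p i = e * x $ i) \<Longrightarrow> sperm e p x = y"
proof -
  assume p: "bij p" and eq: "\<forall>i. y $ p i = e * x $ i"
  have "sperm e p x $ j = y $ j" for j
    using spec[OF eq, of "inv' p j"] p by (simp add: sperm_nth bij_is_surj surj_f_inv_f)
  then show ?thesis by (simp add: vec_eq_iff)
qed

definition shift :: "5 \<Rightarrow> 5" where "shift i = i + 1"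

lemma bij_shift: "bij shift"
  by (rule bij_betw_byWitness[where f' = "\<lambda>i. i - 1"]) (auto simp: shift_def)

lemma shift_Aut: "sperm 1 shift \<in> carrier Aut_A4"
  by (simp add: sperm_in_Aut bij_shift)

lemma shift_vec5: "sperm 1 shift (vec5 a b c d e) = vec5 e a b c d"
proof (rule sperm_eqI[OF bij_shift])
  have "vec5 e a b c d $ 5 = d" by (simp add: vec5_def)
  then show "\<forall>i. vec5 e a b c d $ shift i = 1 * vec5 a b c d e $ i" by (simp add: forall_5 shift_def)
qed

lemma gamma_rayvecs: "C \<in> {path0, path1, path2, path3} \<Longrightarrow> w \<in> gamma C \<Longrightarrow> w \<in> rayvecs"
proof -
  have Om: "w \<in> rayvecs" if "w \<in> Omega" for w
    unfolding rayvecs_def using that sperm_in_Aut[of 1 id] by (auto intro!: exI[of _ id] exI[of _ w])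
  have sh: "sperm 1 shift w \<in> rayvecs" if "w \<in> Omega" for w
    unfolding rayvecs_def using that shift_Aut by blast
  have 1: "vec5 0 1 (-1) 0 0 \<in> rayvecs" "vec5 0 2 (-1) (-1) 0 \<in> rayvecs" "vec5 0 3 (-1) (-1) (-1) \<in> rayvecs"
    using sh[of "vec5 1 (-1) 0 0 0"] sh[of "vec5 2 (-1) (-1) 0 0"] sh[of "vec5 3 (-1) (-1) (-1) 0"]
    by (simp_all add: shift_vec5 Omega_eq)
  let ?p = "Transposition.transpose 1 (2::5) \<circ> Transposition.transpose 1 3"
  have bp: "bij ?p" by (intro bij_comp) simp_all
  have "sperm (-1) ?p (vec5 2 (-1) (-1) 0 0) = vec5 1 1 (-2) 0 0"
    by (rule sperm_eqI[OF bp]) (simp add: forall_5 Transposition.transpose_def)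
  moreover have "vec5 2 (-1) (-1) 0 0 \<in> Omega" by (simp add: Omega_eq)
  moreover have "sperm (-1) ?p \<in> carrier Aut_A4" using bp by (intro sperm_in_Aut) auto
  ultimately have 2: "vec5 1 1 (-2) 0 0 \<in> rayvecs" unfolding rayvecs_def by (metis (mono_tags, lifting) mem_Collect_eq)
  show "C \<in> {path0, path1, path2, path3} \<Longrightarrow> w \<in> gamma C \<Longrightarrow> w \<in> rayvecs"
    by (elim insertE emptyE; simp only: gamma_paths; elim insertE emptyE; simp only: 1 2 Om Omega_eq insert_iff simp_thms)
qed

lemma inner_vec5: "inner (vec5 a b c d e) (vec5 a' b' c' d' e') = a * a' + b * b' + c * c' + d * d' + e * e'"
  unfolding inner_vec_def sum_5 by simp

text \<open>
  The functional \<open>2 x\<^sub>1 + x\<^sub>2\<close> is positive on all generators, so the cones contain no line and the origin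
  is a face.
\<close>

lemma gamma_positive:
  "C \<in> {path0, path1, path2, path3} \<Longrightarrow> w \<in> gamma C \<union> v_reps \<Longrightarrow> 0 < inner (vec5 2 1 0 0 0) w"
  by (elim insertE emptyE; simp only: gamma_paths v_reps_def v_eq Un_insert_left Un_empty_left;
      elim insertE emptyE; simp add: inner_vec5)

lemma Aut_Cone: "g \<in> carrier Aut_A4 \<Longrightarrow> g ` Cone S = Cone (g ` S)"
  by (rule convex_cone_hull_linear_image[symmetric]) (rule Aut_linear)

text \<open>
  A face of a subdivided cone is spanned by some of its generators. So all cones of the fan are spanned
  by ray generators, and their one-dimensional faces by one of them.
\<close>

lemma rays_subset:
  assumes "\<rho> \<in> rays fan_Y_A4"
  obtains w where "w \<in> rayvecs" "\<rho> = Cone {w}"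
proof -
  have dim: "dim \<rho> = 1" and fan: "\<rho> \<in> fan_Y_A4" using assms by (auto simp: rays_def)
  have generated: "\<exists>S g C. \<rho> face_of Cone S \<and> S \<subseteq> g ` (gamma C \<union> v_reps) \<and> g \<in> carrier Aut_A4 \<and>
      C \<in> {path0, path1, path2, path3}"
  proof -
    consider "\<exists>\<sigma>\<in>simp_max_cones. \<rho> face_of \<sigma>"
      | \<sigma> v \<sigma>' where "(\<sigma>, v) \<in> subdivided" "\<sigma>' \<in> star_subdivision \<sigma> v" "\<rho> face_of \<sigma>'"
      using fan unfolding fan_Y_A4_def fan_of_def cone_faces_def by blast
    then show ?thesis
    proof cases
      case 1
      then obtain g C where gC: "g \<in> carrier Aut_A4" "C \<in> {path0, path1, path2, path3}" "\<rho> face_of g ` Cone (gamma C)"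
        unfolding simp_max_cones_def by blast
      then show ?thesis
        unfolding Aut_Cone[OF gC(1)] by (intro exI[of _ "g ` gamma C"] exI[of _ g] exI[of _ C]) blast
    next
      case 2
      then obtain g C v0 where gC: "g \<in> carrier Aut_A4" "(C, v0) \<in> {(path1, v1), (path2, v2), (path3, v3)}"
        and \<sigma>: "\<sigma> = Cone (g ` gamma C)" "v = g v0"
        unfolding subdivided_def using Aut_Cone by blast
      have C: "C \<in> {path0, path1, path2, path3}" "v0 \<in> v_reps" using gC(2) by (auto simp: v_reps_def)
      have fin: "finite (g ` gamma C)" using C(1) by (auto simp: gamma_paths)
      obtain \<tau> where \<tau>: "\<tau> face_of \<sigma>" "\<tau> \<noteq> {}" "\<sigma>' = Cone (insert v \<tau>)"
        using 2 unfolding star_subdivision_def cone_faces_def by blast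
      let ?T = "g ` gamma C \<inter> \<tau>"
      have "\<tau> = Cone ?T" using face_of_Cone[OF fin] \<tau> \<sigma> by blast
      then have "\<sigma>' = Cone (insert v ?T)" using \<tau>(3) Cone_insert_Cone[of v ?T] by metis
      moreover have "insert v ?T \<subseteq> g ` (gamma C \<union> v_reps)" using \<sigma>(2) C(2) by blast
      ultimately show ?thesis using 2(3) gC(1) C(1) by blast
    qed
  qed
  then obtain S g C where S: "\<rho> face_of Cone S" "S \<subseteq> g ` (gamma C \<union> v_reps)" and g: "g \<in> carrier Aut_A4"
    and C: "C \<in> {path0, path1, path2, path3}" by blast
  have "finite (gamma C \<union> v_reps)" using C by (auto simp: gamma_paths v_reps_def)
  then have fin: "finite S" using S(2) finite_surj by blast
  have "0 < inner (g (vec5 2 1 0 0 0)) w" if "w \<in> S" for w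
    using that S(2) Aut_inner[OF g] gamma_positive[OF C] by auto
  then obtain w where w: "w \<in> S" "\<rho> = Cone {w}" by (rule ray_of_Cone[OF fin _ S(1) dim])
  obtain w0 where w0: "w = g w0" "w0 \<in> gamma C \<union> v_reps" using w(1) S(2) by blast
  have "w0 \<in> rayvecs"
  proof (cases "w0 \<in> gamma C")
    case True then show ?thesis by (rule gamma_rayvecs[OF C])
  next
    case False
    then have "w0 \<in> Omega" using w0(2) by (simp add: Omega_def)
    then show ?thesis unfolding rayvecs_def using sperm_in_Aut[of 1 id] by (auto intro!: exI[of _ id] exI[of _ w0])
  qed
  then have "w \<in> rayvecs" using rayvecs_Aut[OF g] w0(1) by simp
  then show thesis using w(2) by (rule that)
qed

text \<open>
  The face \<open>{0}\<close> of a subdivided cone contributes the ray of the subdividing vector.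
\<close>

lemma ray_vI:
  assumes g: "g \<in> carrier Aut_A4" and C: "(C, v) \<in> {(path1, v1), (path2, v2), (path3, v3)}"
  shows "Cone {g v} \<in> rays fan_Y_A4"
proof -
  have C': "C \<in> {path0, path1, path2, path3}" "v \<in> v_reps" using C by (auto simp: v_reps_def)
  have v: "0 < inner (vec5 2 1 0 0 0) v" using gamma_positive[OF C'(1), of v] C'(2) by blast
  have "v \<noteq> 0" using v by auto
  then have gv: "g v \<noteq> 0" using Aut_inner[OF g, of v v] by auto
  have fin: "finite (g ` gamma C)" using C'(1) by (auto simp: gamma_paths)
  have "Cone {} face_of Cone (g ` gamma C)"
    by (rule Cone_subset_face[OF fin, where u = "g (vec5 2 1 0 0 0)"])
      (use Aut_inner[OF g] gamma_positive[OF C'(1)] in auto)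
  then have "{0} \<in> cone_faces (g ` Cone (gamma C))" by (simp add: cone_faces_def Aut_Cone[OF g])
  then have "Cone (insert (g v) {0}) \<in> star_subdivision (g ` Cone (gamma C)) (g v)"
    unfolding star_subdivision_def using gv by blast
  moreover have "Cone (insert (g v) {0}) = Cone {g v}" using Cone_insert_Cone[of "g v" "{}"] by simp
  moreover have "(g ` Cone (gamma C), g v) \<in> subdivided" unfolding subdivided_def using g C by blast
  ultimately have "Cone {g v} \<in> fan_Y_A4"
    unfolding fan_Y_A4_def fan_of_def cone_faces_def
    using face_of_refl[OF convex_convex_cone_hull] convex_cone_hull_nonempty by fastforce
  then show ?thesis using dim_Cone_singleton[OF gv] by (simp add: rays_def)
qed

text \<open>
  If a supporting hyperplane meets the generators and the subdividing vector \<open>v\<close> only in \<open>s\<close>, then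
  the ray of \<open>s\<close> is a face of the cone that does not contain \<open>v\<close>, and also a face of the cone spanned
  by \<open>s\<close> and \<open>v\<close>, which belongs to the star subdivision.
\<close>

lemma ray_sI:
  assumes g: "g \<in> carrier Aut_A4" and C: "(C, v) \<in> {(path1, v1), (path2, v2), (path3, v3)}"
    and s: "s \<in> gamma C" "inner u s = 0" and pos: "\<And>w. w \<in> insert v (gamma C - {s}) \<Longrightarrow> 0 < inner u w"
  shows "Cone {g s} \<in> rays fan_Y_A4"
proof -
  have C': "C \<in> {path0, path1, path2, path3}" using C by auto
  have "0 < inner (vec5 2 1 0 0 0) s" using gamma_positive[OF C', of s] s by blast
  then have "s \<noteq> 0" by auto
  then have gs: "g s \<noteq> 0" using Aut_inner[OF g, of s s] by (metis inner_eq_zero_iff)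
  have fin: "finite (g ` gamma C)" using C' by (auto simp: gamma_paths)
  have zero: "inner (g u) (g s) = 0" using Aut_inner[OF g] s(2) by simp
  have pos': "0 < inner (g u) (g w)" if "w \<in> insert v (gamma C - {s})" for w
    using Aut_inner[OF g] pos[OF that] by simp
  have face: "Cone {g s} face_of Cone (g ` gamma C)"
    by (rule Cone_subset_face[OF fin, where u = "g u"]) (use s(1) zero pos' in auto)
  then have "Cone {g s} \<in> cone_faces (g ` Cone (gamma C))"
    using convex_cone_hull_nonempty by (simp add: cone_faces_def Aut_Cone[OF g])
  moreover have "g v \<notin> Cone {g s}"
    unfolding Cone_singleton using pos'[of v] zero by auto
  ultimately have "Cone (insert (g v) (Cone {g s})) \<in> star_subdivision (g ` Cone (gamma C)) (g v)"
    unfolding star_subdivision_def by blast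
  then have star: "Cone {g v, g s} \<in> star_subdivision (g ` Cone (gamma C)) (g v)"
    by (simp add: Cone_insert_Cone)
  have "Cone {g s} face_of Cone {g v, g s}"
    by (rule Cone_subset_face[where u = "g u"]) (use zero pos' in auto)
  then have "Cone {g s} \<in> cone_faces (Cone {g v, g s})"
    using convex_cone_hull_nonempty by (simp add: cone_faces_def)
  moreover have "(g ` Cone (gamma C), g v) \<in> subdivided" unfolding subdivided_def using g C by blast
  ultimately have "Cone {g s} \<in> fan_Y_A4"
    unfolding fan_Y_A4_def fan_of_def using star by blast
  then show ?thesis using dim_Cone_singleton[OF gs] by (simp add: rays_def)
qed

text \<open>
  The generators of the subdivided cones have nonnegative first two and nonpositive last three
  coordinates; four coordinates of \<open>s\<^sub>1\<^sub>,\<^sub>4\<close> have the same strict sign, so \<open>s\<^sub>1\<^sub>,\<^sub>4\<close> and its images lie in none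
  of the three cones, and the cone of the first path is not subdivided.
\<close>

lemma s14_notin:
  assumes g: "g \<in> carrier Aut_A4" and C: "C \<in> {path1, path2, path3}"
  shows "g (vec5 4 (-1) (-1) (-1) (-1)) \<notin> Cone (gamma C)"
proof
  let ?s = "vec5 4 (-1) (-1) (-1) (-1)"
  assume in_Cone: "g ?s \<in> Cone (gamma C)"
  have "0 \<le> inner (axis i 1) (g ?s)" if i: "i \<in> {1, 2}" for i
  proof (rule inner_Cone_nonneg[OF _ in_Cone])
    fix w assume "w \<in> gamma C"
    then show "0 \<le> inner (axis i 1) w" using C i by (auto simp: gamma_paths inner_axis')
  qed
  then have up: "0 \<le> g ?s $ 1" "0 \<le> g ?s $ 2" by (simp_all add: inner_axis')
  have "0 \<le> inner (- axis i 1) (g ?s)" if i: "i \<in> {3, 4}" for i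
  proof (rule inner_Cone_nonneg[OF _ in_Cone])
    fix w assume "w \<in> gamma C"
    then show "0 \<le> inner (- axis i 1) w" using C i by (auto simp: gamma_paths inner_axis')
  qed
  then have down: "g ?s $ 3 \<le> 0" "g ?s $ 4 \<le> 0" by (simp_all add: inner_axis')
  obtain e p where gp: "g = sperm e p" "e \<in> {1, -1}" "bij p" using g by (rule AutE)
  have s: "?s $ i = (if i = 1 then 4 else - 1)" for i by (simp add: vec5_def)
  have ne: "inv' p i \<noteq> inv' p j" if "i \<noteq> j" for i j
    using gp(3) that by (metis bij_inv_eq_iff)
  show False
  proof (cases "e = 1")
    case True
    then have "inv' p 1 = 1" "inv' p 2 = 1"
      using up by (auto simp: gp(1) sperm_nth s split: if_splits)
    then show False using ne[of 1 2] by simp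
  next
    case False
    then have "inv' p 3 = 1" "inv' p 4 = 1"
      using down gp(2) by (auto simp: gp(1) sperm_nth s split: if_splits)
    then show False using ne[of 3 4] by simp
  qed
qed

lemma ray_s14I:
  assumes g: "g \<in> carrier Aut_A4"
  shows "Cone {g (vec5 4 (-1) (-1) (-1) (-1))} \<in> rays fan_Y_A4"
proof -
  let ?s = "vec5 4 (-1) (-1) (-1) (-1)" and ?u = "vec5 0 (-1) (-1) (-1) 3"
  have "?s \<noteq> 0" by (simp add: vec_eq_iff forall_5)
  then have gs: "g ?s \<noteq> 0" using Aut_inner[OF g, of ?s ?s] by (metis inner_eq_zero_iff)
  have s_in: "?s \<in> gamma path0" by (simp add: gamma_paths)
  have fin: "finite (g ` gamma path0)" by (simp add: gamma_paths)
  have face: "Cone {g ?s} face_of Cone (g ` gamma path0)"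
  proof (rule Cone_subset_face[OF fin, where u = "g ?u"])
    show "{g ?s} \<subseteq> g ` gamma path0" using s_in by blast
    show "inner (g ?u) w = 0" if "w \<in> {g ?s}" for w using that Aut_inner[OF g] by (simp add: inner_vec5)
    show "0 < inner (g ?u) w" if "w \<in> g ` gamma path0 - {g ?s}" for w
      using that Aut_inner[OF g] by (auto simp: gamma_paths inner_vec5)
  qed
  have "g ` Cone (gamma path0) \<in> simp_max_cones"
    unfolding simp_max_cones_def using g by blast
  moreover have "g ` Cone (gamma path0) \<notin> fst ` subdivided"
  proof
    assume "g ` Cone (gamma path0) \<in> fst ` subdivided"
    then obtain h C v where h: "h \<in> carrier Aut_A4" and Cv: "(C, v) \<in> {(path1, v1), (path2, v2), (path3, v3)}"
      and eq: "g ` Cone (gamma path0) = h ` Cone (gamma C)"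
      unfolding subdivided_def by (elim imageE CollectE exE conjE) (simp only: fst_conv)
    have C: "C \<in> {path1, path2, path3}" using Cv by auto
    have "g ?s \<in> h ` Cone (gamma C)" unfolding eq[symmetric] using s_in by (intro imageI hull_inc)
    then obtain y where y: "y \<in> Cone (gamma C)" "g ?s = h y" by blast
    interpret group Aut_A4 by (rule group_Aut)
    let ?k = "inv\<^bsub>Aut_A4\<^esub> h \<otimes>\<^bsub>Aut_A4\<^esub> g"
    have k: "?k \<in> carrier Aut_A4" using g h by simp
    have "?k ?s = (inv\<^bsub>Aut_A4\<^esub> h) (g ?s)" using g h by (simp add: Aut_mult)
    also have "\<dots> = y" unfolding y(2) by (rule Aut_inv(1)[OF h])
    finally show False using s14_notin[OF k C] y(1) by simp
  qed
  moreover have "Cone {g ?s} \<in> cone_faces (g ` Cone (gamma path0))"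
    using face convex_cone_hull_nonempty by (simp add: cone_faces_def Aut_Cone[OF g])
  ultimately have "Cone {g ?s} \<in> fan_Y_A4" unfolding fan_Y_A4_def fan_of_def by blast
  then show ?thesis using dim_Cone_singleton[OF gs] by (simp add: rays_def)
qed

text \<open>
  The first three vectors are turned into generators of the subdivided cone of \<open>v\<^sub>1\<close> by a cyclic shift.
  In each case the supporting functional solves the linear conditions that it vanish on the
  generator in question and be positive on the other three and on the subdividing vector.
\<close>

lemma Cone_Aut_ray:
  assumes "g \<in> carrier Aut_A4" "x \<in> Omega"
  shows "Cone {g x} \<in> rays fan_Y_A4"
proof -
  have sh: "Cone {g x} \<in> rays fan_Y_A4"
    if "\<And>g. g \<in> carrier Aut_A4 \<Longrightarrow> Cone {g (sperm 1 shift x)} \<in> rays fan_Y_A4" for x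
  proof -
    interpret group Aut_A4 by (rule group_Aut)
    let ?h = "g \<otimes>\<^bsub>Aut_A4\<^esub> inv\<^bsub>Aut_A4\<^esub> (sperm 1 shift)"
    have "?h (sperm 1 shift x) = g x"
      using assms(1) shift_Aut by (simp add: Aut_mult Aut_inv)
    then show ?thesis using that[of ?h] assms(1) shift_Aut by simp
  qed
  have "Cone {g (vec5 1 (-1) 0 0 0)} \<in> rays fan_Y_A4"
    by (rule sh, unfold shift_vec5, rule ray_sI[of _ path1 v1 _ "vec5 0 0 0 (-1) (-1)"])
      (auto simp: gamma_paths v_eq inner_vec5)
  moreover have "Cone {g (vec5 2 (-1) (-1) 0 0)} \<in> rays fan_Y_A4"
    by (rule sh, unfold shift_vec5, rule ray_sI[of _ path1 v1 _ "vec5 0 0 (-1) 1 (-2)"])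
      (auto simp: gamma_paths v_eq inner_vec5)
  moreover have "Cone {g (vec5 3 (-1) (-1) (-1) 0)} \<in> rays fan_Y_A4"
    by (rule sh, unfold shift_vec5, rule ray_sI[of _ path1 v1 _ "vec5 1 0 (-2) 0 2"])
      (auto simp: gamma_paths v_eq inner_vec5)
  moreover have "Cone {g (vec5 4 (-1) (-1) (-1) (-1))} \<in> rays fan_Y_A4"
    by (rule ray_s14I[OF assms(1)])
  moreover have "Cone {g (vec5 1 1 (-1) (-1) 0)} \<in> rays fan_Y_A4"
    by (rule ray_sI[OF assms(1), of path2 v2 _ "vec5 0 0 (-1) 1 (-1)"])
      (auto simp: gamma_paths v_eq inner_vec5)
  moreover have "Cone {g (vec5 3 3 (-2) (-2) (-2))} \<in> rays fan_Y_A4"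
    by (rule ray_sI[OF assms(1), of path1 v1 _ "vec5 (-1) 1 0 0 0"])
      (auto simp: gamma_paths v_eq inner_vec5)
  moreover have "Cone {g v1} \<in> rays fan_Y_A4" "Cone {g v2} \<in> rays fan_Y_A4" "Cone {g v3} \<in> rays fan_Y_A4"
    by (rule ray_vI[OF assms(1)], blast)+
  ultimately show ?thesis
    using assms(2) unfolding Omega_eq v_eq by (elim insertE emptyE) simp_all
qed

theorem ray_orbits:
  "bij_betw (\<lambda>x. orbit Aut_A4 (\<lambda>g \<rho>. g ` \<rho>) (Cone {x})) Omega
     (orbits Aut_A4 (rays fan_Y_A4) (\<lambda>g \<rho>. g ` \<rho>))"
proof (rule bij_betw_imageI)
  interpret group Aut_A4 by (rule group_Aut)
  let ?o = "orbit Aut_A4 (\<lambda>g \<rho>. g ` \<rho>)"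
  have orbit: "?o (Cone {x}) = {Cone {g x} | g. g \<in> carrier Aut_A4}" for x
    unfolding orbit_def using Aut_Cone[of _ "{x}"] by auto
  have orbit_eq: "?o (Cone {g x}) = ?o (Cone {x})" if g: "g \<in> carrier Aut_A4" for g x
  proof (intro equalityI subsetI)
    fix \<rho> assume "\<rho> \<in> ?o (Cone {g x})"
    then obtain h where h: "h \<in> carrier Aut_A4" "\<rho> = Cone {h (g x)}" unfolding orbit by blast
    then have "\<rho> = Cone {(h \<otimes>\<^bsub>Aut_A4\<^esub> g) x}" using g by (simp add: Aut_mult)
    then show "\<rho> \<in> ?o (Cone {x})" unfolding orbit using g h(1) m_closed by blast
  next
    fix \<rho> assume "\<rho> \<in> ?o (Cone {x})"
    then obtain h where h: "h \<in> carrier Aut_A4" "\<rho> = Cone {h x}" unfolding orbit by blast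
    let ?k = "h \<otimes>\<^bsub>Aut_A4\<^esub> inv\<^bsub>Aut_A4\<^esub> g"
    have "?k (g x) = h x" using g h by (simp add: Aut_mult Aut_inv)
    then have "\<rho> = Cone {?k (g x)}" using h(2) by simp
    then show "\<rho> \<in> ?o (Cone {g x})" unfolding orbit using g h(1) m_closed inv_closed by blast
  qed
  show "inj_on (\<lambda>x. ?o (Cone {x})) Omega"
  proof (rule inj_onI)
    fix x y assume x: "x \<in> Omega" and y: "y \<in> Omega" and eq: "?o (Cone {x}) = ?o (Cone {y})"
    have "Cone {\<one>\<^bsub>Aut_A4\<^esub> y} \<in> ?o (Cone {y})" unfolding orbit using one_closed by blast
    then have "Cone {y} \<in> ?o (Cone {x})" using eq by (simp add: Aut_one)
    then obtain g where g: "g \<in> carrier Aut_A4" "Cone {y} = Cone {g x}" unfolding orbit by blast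
    have "y \<in> Cone {g x}" unfolding g(2)[symmetric] by (simp add: hull_inc)
    then obtain t where t: "y = t *\<^sub>R g x" unfolding Cone_singleton by blast
    then have "t \<noteq> 0" using Omega_nonzero[OF y] by auto
    then have "shape y = shape x" unfolding t by (simp add: shape_scale shape_Aut[OF g(1)])
    then show "x = y" using Omega_shape_inj[OF x y] by simp
  qed
  show "(\<lambda>x. ?o (Cone {x})) ` Omega = orbits Aut_A4 (rays fan_Y_A4) (\<lambda>g \<rho>. g ` \<rho>)"
  proof (intro equalityI subsetI)
    fix O' assume "O' \<in> (\<lambda>x. ?o (Cone {x})) ` Omega"
    then obtain x where x: "x \<in> Omega" "O' = ?o (Cone {x})" by blast
    have "Cone {x} \<in> rays fan_Y_A4" using Cone_Aut_ray[OF one_closed x(1)] by (simp add: Aut_one)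
    then show "O' \<in> orbits Aut_A4 (rays fan_Y_A4) (\<lambda>g \<rho>. g ` \<rho>)" unfolding orbits_def x(2) by blast
  next
    fix O' assume "O' \<in> orbits Aut_A4 (rays fan_Y_A4) (\<lambda>g \<rho>. g ` \<rho>)"
    then obtain \<rho> where \<rho>: "\<rho> \<in> rays fan_Y_A4" "O' = ?o \<rho>" unfolding orbits_def by blast
    obtain w where w: "w \<in> rayvecs" "\<rho> = Cone {w}" by (rule rays_subset[OF \<rho>(1)])
    obtain g x where gx: "g \<in> carrier Aut_A4" "x \<in> Omega" "w = g x" using w(1) unfolding rayvecs_def by blast
    have "O' = ?o (Cone {x})" unfolding \<rho>(2) w(2) gx(3) by (rule orbit_eq[OF gx(1)])
    then show "O' \<in> (\<lambda>x. ?o (Cone {x})) ` Omega" using gx(2) by blast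
  qed
qed


section \<open>Stabilizers\<close>

text \<open>The symmetric group of an \<open>n\<close>-element set \<open>A\<close>, transported from \<open>{1..n}\<close> along a bijection.\<close>

definition transport :: "(nat \<Rightarrow> 'a) \<Rightarrow> nat \<Rightarrow> 'a set \<Rightarrow> (nat \<Rightarrow> nat) \<Rightarrow> 'a \<Rightarrow> 'a" where
  "transport f n A \<pi> = (\<lambda>x. if x \<in> A then f (\<pi> (inv_into {1..n} f x)) else x)"

lemma transport_bij:
  "bij_betw f {1..n} A \<Longrightarrow> bij_betw (transport f n A) {\<pi>. \<pi> permutes {1..n}} {\<pi>. \<pi> permutes A}"
  unfolding transport_def by (rule bij_betw_permutations)

lemma transport_permutes: "bij_betw f {1..n} A \<Longrightarrow> \<pi> permutes {1..n} \<Longrightarrow> transport f n A \<pi> permutes A"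
  using bij_betw_apply[OF transport_bij, of f n A \<pi>] by simp

lemma transport_inj: "bij_betw f {1..n} A \<Longrightarrow> \<pi> permutes {1..n} \<Longrightarrow> \<rho> permutes {1..n} \<Longrightarrow>
    transport f n A \<pi> = transport f n A \<rho> \<Longrightarrow> \<pi> = \<rho>"
  by (rule inj_onD[OF bij_betw_imp_inj_on[OF transport_bij]]) simp_all

lemma transport_surj:
  assumes "bij_betw f {1..n} A" "p permutes A"
  obtains \<pi> where "\<pi> permutes {1..n}" "p = transport f n A \<pi>"
proof -
  have "p \<in> transport f n A ` {\<pi>. \<pi> permutes {1..n}}"
    using transport_bij[OF assms(1)] assms(2) by (simp add: bij_betw_def)
  then show thesis using that by blast
qed

lemma transport_comp:
  assumes f: "bij_betw f {1..n} A" and \<rho>: "\<rho> permutes {1..n}"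
  shows "transport f n A (\<pi> \<circ> \<rho>) = transport f n A \<pi> \<circ> transport f n A \<rho>"
proof
  fix x
  show "transport f n A (\<pi> \<circ> \<rho>) x = (transport f n A \<pi> \<circ> transport f n A \<rho>) x"
  proof (cases "x \<in> A")
    case True
    then have "inv_into {1..n} f x \<in> {1..n}" using f by (metis bij_betw_def inv_into_into)
    then have m: "\<rho> (inv_into {1..n} f x) \<in> {1..n}" using permutes_in_image[OF \<rho>] by blast
    then have "f (\<rho> (inv_into {1..n} f x)) \<in> A" using f by (auto simp: bij_betw_def)
    moreover have "inv_into {1..n} f (f (\<rho> (inv_into {1..n} f x))) = \<rho> (inv_into {1..n} f x)"
      using f m by (intro inv_into_f_f) (auto simp: bij_betw_def)
    ultimately show ?thesis using True by (simp add: transport_def)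
  qed (simp add: transport_def)
qed

lemma iso_reverse:
  assumes m: "m \<in> iso S K"
    and closed: "\<And>y z. y \<in> carrier S \<Longrightarrow> z \<in> carrier S \<Longrightarrow> y \<otimes>\<^bsub>S\<^esub> z \<in> carrier S"
  shows "K \<cong> S"
proof -
  have bij: "bij_betw m (carrier S) (carrier K)" and hom: "m \<in> hom S K"
    using m by (simp_all add: iso_def)
  let ?i = "inv_into (carrier S) m"
  have i: "?i y \<in> carrier S" "m (?i y) = y" if "y \<in> carrier K" for y
    using bij_betw_apply[OF bij_betw_inv_into[OF bij] that] bij_betw_inv_into_right[OF bij that] by simp_all
  have "?i \<in> hom K S"
  proof (rule homI)
    fix y z assume y: "y \<in> carrier K" and z: "z \<in> carrier K"
    have "y \<otimes>\<^bsub>K\<^esub> z = m (?i y \<otimes>\<^bsub>S\<^esub> ?i z)"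
      using hom_mult[OF hom i(1)[OF y] i(1)[OF z]] i(2)[OF y] i(2)[OF z] by simp
    then show "?i (y \<otimes>\<^bsub>K\<^esub> z) = ?i y \<otimes>\<^bsub>S\<^esub> ?i z"
      using inv_into_f_f[OF bij_betw_imp_inj_on[OF bij] closed[OF i(1)[OF y] i(1)[OF z]]] by simp
  qed (fact i(1))
  then have "?i \<in> iso K S" using bij_betw_inv_into[OF bij] by (simp add: iso_def)
  then show ?thesis by (auto simp: is_iso_def)
qed

lemma stab_group_simps [simp]:
  "carrier (stab_group x) = Stab x"
  "\<one>\<^bsub>stab_group x\<^esub> = \<one>\<^bsub>Aut_A4\<^esub>"
  "g \<otimes>\<^bsub>stab_group x\<^esub> h = g \<otimes>\<^bsub>Aut_A4\<^esub> h"
  by (simp_all add: stab_group_def)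

lemma Stab_eq: "Stab x = {g \<in> carrier Aut_A4. g x = x}"
  by (simp add: Stab_def stabilizer_def)

lemma Stab_subgroup: "subgroup (Stab x) Aut_A4"
proof -
  interpret group Aut_A4 by (rule group_Aut)
  show ?thesis
  proof (rule subgroupI)
    show "Stab x \<noteq> {}" using one_closed by (auto simp: Stab_eq Aut_one)
    fix g assume "g \<in> Stab x"
    then show "inv\<^bsub>Aut_A4\<^esub> g \<in> Stab x" using Aut_inv(1)[of g x] by (auto simp: Stab_eq)
  qed (auto simp: Stab_eq Aut_mult[symmetric] m_closed, auto simp: Aut_mult)
qed

lemma sperm_fixes_iff: "bij p \<Longrightarrow> sperm e p x = x \<longleftrightarrow> (\<forall>i. x $ p i = e * x $ i)"
proof -
  assume p: "bij p"
  have "sperm e p x = x \<longleftrightarrow> (\<forall>i. sperm e p x $ p i = x $ p i)"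
    using p by (metis bij_pointE vec_eq_iff)
  then show ?thesis using p by (auto simp: sperm_nth' eq_commute)
qed

text \<open>
  A vector with at most three coordinate values \<open>a\<close>, \<open>b\<close>, \<open>c\<close> that may be repeated; the permutations
  that fix it are those of the three blocks of equal coordinates.
\<close>

locale three_blocks =
  fixes x :: "real^5" and a b c :: real and I J K :: "5 set"
  assumes I: "I = {i. x $ i = a}" and J: "J = {i. x $ i = b}" and K: "K = {i. x $ i = c}"
    and distinct: "a \<noteq> b" "a \<noteq> c" "b \<noteq> c"
    and rest: "\<And>i j. x $ i \<notin> {a, b, c} \<Longrightarrow> x $ j = x $ i \<Longrightarrow> j = i"
begin

lemma block_permutes:
  "p permutes I \<Longrightarrow> x $ p i = x $ i" "p permutes I \<Longrightarrow> x $ i \<noteq> a \<Longrightarrow> p i = i"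
  "q permutes J \<Longrightarrow> x $ q i = x $ i" "q permutes J \<Longrightarrow> x $ i \<noteq> b \<Longrightarrow> q i = i"
  "s permutes K \<Longrightarrow> x $ s i = x $ i" "s permutes K \<Longrightarrow> x $ i \<noteq> c \<Longrightarrow> s i = i"
proof -
  have "x $ p i = x $ i \<and> (x $ i \<noteq> d \<longrightarrow> p i = i)" if "p permutes {i. x $ i = d}" for p d
    using permutes_in_image[OF that, of i] permutes_not_in[OF that, of i] by (cases "x $ i = d") simp_all
  then show "p permutes I \<Longrightarrow> x $ p i = x $ i" "p permutes I \<Longrightarrow> x $ i \<noteq> a \<Longrightarrow> p i = i"
    "q permutes J \<Longrightarrow> x $ q i = x $ i" "q permutes J \<Longrightarrow> x $ i \<noteq> b \<Longrightarrow> q i = i"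
    "s permutes K \<Longrightarrow> x $ s i = x $ i" "s permutes K \<Longrightarrow> x $ i \<noteq> c \<Longrightarrow> s i = i"
    unfolding I J K by blast+
qed

lemma fixing_permutations:
  "bij \<pi> \<and> (\<forall>i. x $ \<pi> i = x $ i) \<longleftrightarrow>
    (\<exists>p q s. p permutes I \<and> q permutes J \<and> s permutes K \<and> \<pi> = p \<circ> q \<circ> s)"
    (is "_ \<longleftrightarrow> (\<exists>p q s. ?R p q s)")
proof (intro iffI; elim conjE exE)
  fix p q s assume p: "p permutes I" and q: "q permutes J" and s: "s permutes K" and \<pi>: "\<pi> = p \<circ> q \<circ> s"
  show "bij \<pi> \<and> (\<forall>i. x $ \<pi> i = x $ i)"
    using permutes_bij[OF p] permutes_bij[OF q] permutes_bij[OF s]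
    by (simp add: \<pi> bij_comp block_permutes(1)[OF p] block_permutes(3)[OF q] block_permutes(5)[OF s])
next
  assume \<pi>: "bij \<pi>" "\<forall>i. x $ \<pi> i = x $ i"
  define r where "r A i = (if i \<in> A then \<pi> i else i)" for A i
  have res: "r A permutes A" if "\<pi> ` A \<subseteq> A" for A
  proof (rule bij_imp_permutes)
    have "inj_on \<pi> A" using bij_is_inj[OF \<pi>(1)] by (rule inj_on_subset) simp
    then have "bij_betw \<pi> A A" using that by (simp add: bij_betw_def endo_inj_surj)
    then show "bij_betw (r A) A A"
      by (rule bij_betw_cong[THEN iffD1, rotated]) (simp add: r_def)
  qed (simp add: r_def)
  have sub: "\<pi> ` I \<subseteq> I" "\<pi> ` J \<subseteq> J" "\<pi> ` K \<subseteq> K" using \<pi>(2) by (auto simp: I J K)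
  have out: "\<pi> i = i" if "x $ i \<noteq> a" "x $ i \<noteq> b" "x $ i \<noteq> c" for i
    using rest[of i "\<pi> i"] \<pi>(2) that by simp
  have "\<pi> i = r I (r J (r K i))" for i
    using \<pi>(2) distinct unfolding r_def I J K mem_Collect_eq
    by (cases "x $ i = a"; cases "x $ i = b"; cases "x $ i = c") (simp_all add: out)
  then have "\<pi> = r I \<circ> r J \<circ> r K" by (simp add: fun_eq_iff)
  with res[OF sub(1)] res[OF sub(2)] res[OF sub(3)]
  show "\<exists>p q s. ?R p q s" by blast
qed

lemma blocks_comp:
  assumes "p permutes I" "q permutes J" "s permutes K" "p' permutes I" "q' permutes J" "s' permutes K"
  shows "(p \<circ> q \<circ> s) \<circ> (p' \<circ> q' \<circ> s') = (p \<circ> p') \<circ> (q \<circ> q') \<circ> (s \<circ> s')"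
proof
  fix i
  note perm = block_permutes(1,2)[OF assms(1)] block_permutes(3,4)[OF assms(2)] block_permutes(5,6)[OF assms(3)]
    block_permutes(1,2)[OF assms(4)] block_permutes(3,4)[OF assms(5)] block_permutes(5,6)[OF assms(6)]
  show "((p \<circ> q \<circ> s) \<circ> (p' \<circ> q' \<circ> s')) i = ((p \<circ> p') \<circ> (q \<circ> q') \<circ> (s \<circ> s')) i"
    using distinct by (cases "x $ i = a"; cases "x $ i = b"; cases "x $ i = c") (simp_all add: perm)
qed

lemma blocks_inj:
  assumes "p permutes I" "q permutes J" "s permutes K" "p' permutes I" "q' permutes J" "s' permutes K"
    and eq: "p \<circ> q \<circ> s = p' \<circ> q' \<circ> s'"
  shows "p = p' \<and> q = q' \<and> s = s'"
proof (intro conjI ext)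
  note perm = block_permutes(1,2)[OF assms(1)] block_permutes(3,4)[OF assms(2)] block_permutes(5,6)[OF assms(3)]
    block_permutes(1,2)[OF assms(4)] block_permutes(3,4)[OF assms(5)] block_permutes(5,6)[OF assms(6)]
  fix i
  have e: "p (q (s i)) = p' (q' (s' i))" using fun_cong[OF eq, of i] by simp
  show "p i = p' i" using e distinct by (cases "x $ i = a") (simp_all add: perm)
  show "q i = q' i" using e distinct by (cases "x $ i = b") (simp_all add: perm)
  show "s i = s' i" using e distinct by (cases "x $ i = c") (simp_all add: perm)
qed

end

text \<open>
  A coordinate value whose negative is not taken rules out symmetries that change the sign, and leaves
  the product of the symmetric groups of the three blocks.
\<close>

lemma (in three_blocks) stab_group_iso:
  assumes card: "card I = r" "card J = t" "card K = u"
    and nosign: "\<exists>i. \<forall>j. x $ j \<noteq> - x $ i"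
  shows "stab_group x \<cong> sym_group r \<times>\<times> sym_group t \<times>\<times> sym_group u"
proof -
  obtain f where f: "bij_betw f {1..r} I" using ex_bij_betw_nat_finite_1[of I] card by auto
  obtain g where g: "bij_betw g {1..t} J" using ex_bij_betw_nat_finite_1[of J] card by auto
  obtain h where h: "bij_betw h {1..u} K" using ex_bij_betw_nat_finite_1[of K] card by auto
  let ?p = "transport f r I" and ?q = "transport g t J" and ?s = "transport h u K"
  let ?m = "\<lambda>(\<pi>, \<rho>, \<sigma>). sperm 1 (?p \<pi> \<circ> ?q \<rho> \<circ> ?s \<sigma>)"
  let ?S = "sym_group r \<times>\<times> sym_group t \<times>\<times> sym_group u"
  note perm = transport_permutes[OF f] transport_permutes[OF g] transport_permutes[OF h]
  have bij: "bij (?p \<pi> \<circ> ?q \<rho> \<circ> ?s \<sigma>)"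
    if "\<pi> permutes {1..r}" "\<rho> permutes {1..t}" "\<sigma> permutes {1..u}" for \<pi> \<rho> \<sigma>
    using perm[THEN permutes_bij] that by (intro bij_comp) auto
  have in_Stab: "?m (\<pi>, \<rho>, \<sigma>) \<in> Stab x"
    if "\<pi> permutes {1..r}" "\<rho> permutes {1..t}" "\<sigma> permutes {1..u}" for \<pi> \<rho> \<sigma>
  proof -
    have "\<forall>i. x $ (?p \<pi> \<circ> ?q \<rho> \<circ> ?s \<sigma>) i = x $ i"
      using fixing_permutations[of "?p \<pi> \<circ> ?q \<rho> \<circ> ?s \<sigma>"] perm that by blast
    then show ?thesis
      using bij[OF that] by (simp add: Stab_eq sperm_in_Aut sperm_fixes_iff del: o_apply)
  qed
  have "?m \<in> iso ?S (stab_group x)"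
  proof (rule isoI)
    show "?m \<in> hom ?S (stab_group x)"
    proof (rule homI)
      fix y assume "y \<in> carrier ?S"
      then show "?m y \<in> carrier (stab_group x)"
        using in_Stab by (auto simp: sym_group_def)
    next
      fix y z assume "y \<in> carrier ?S" "z \<in> carrier ?S"
      then obtain \<pi> \<rho> \<sigma> \<pi>' \<rho>' \<sigma>' where y: "y = (\<pi>, \<rho>, \<sigma>)" "\<pi> permutes {1..r}" "\<rho> permutes {1..t}" "\<sigma> permutes {1..u}"
        and z: "z = (\<pi>', \<rho>', \<sigma>')" "\<pi>' permutes {1..r}" "\<rho>' permutes {1..t}" "\<sigma>' permutes {1..u}"
        by (auto simp: sym_group_def)
      have "?m y \<otimes>\<^bsub>Aut_A4\<^esub> ?m z = ?m y \<circ> ?m z"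
        using in_Stab[OF y(2-4)] in_Stab[OF z(2-4)] y(1) z(1) by (intro Aut_mult) (simp_all add: Stab_eq)
      also have "\<dots> = sperm 1 ((?p \<pi> \<circ> ?q \<rho> \<circ> ?s \<sigma>) \<circ> (?p \<pi>' \<circ> ?q \<rho>' \<circ> ?s \<sigma>'))"
        using sperm_comp[OF bij[OF y(2-4)] bij[OF z(2-4)], of 1 1] y(1) z(1) by (simp add: fun_eq_iff)
      also have "\<dots> = ?m (y \<otimes>\<^bsub>?S\<^esub> z)"
        using y z perm by (simp add: sym_group_mult blocks_comp transport_comp[OF f] transport_comp[OF g] transport_comp[OF h])
      finally show "?m (y \<otimes>\<^bsub>?S\<^esub> z) = ?m y \<otimes>\<^bsub>stab_group x\<^esub> ?m z" by simp
    qed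
    show "bij_betw ?m (carrier ?S) (carrier (stab_group x))"
    proof (rule bij_betw_imageI)
      show "inj_on ?m (carrier ?S)"
      proof (rule inj_onI)
        fix y z assume "y \<in> carrier ?S" "z \<in> carrier ?S" and eq: "?m y = ?m z"
        then obtain \<pi> \<rho> \<sigma> \<pi>' \<rho>' \<sigma>' where y: "y = (\<pi>, \<rho>, \<sigma>)" "\<pi> permutes {1..r}" "\<rho> permutes {1..t}" "\<sigma> permutes {1..u}"
          and z: "z = (\<pi>', \<rho>', \<sigma>')" "\<pi>' permutes {1..r}" "\<rho>' permutes {1..t}" "\<sigma>' permutes {1..u}"
          by (auto simp: sym_group_def)
        have "?p \<pi> \<circ> ?q \<rho> \<circ> ?s \<sigma> = ?p \<pi>' \<circ> ?q \<rho>' \<circ> ?s \<sigma>'"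
          using sperm_inj[OF _ bij[OF y(2-4)] bij[OF z(2-4)], of 1 1] eq y(1) z(1) by simp
        then have "?p \<pi> = ?p \<pi>' \<and> ?q \<rho> = ?q \<rho>' \<and> ?s \<sigma> = ?s \<sigma>'"
          using perm y z by (intro blocks_inj) auto
        then show "y = z"
          using transport_inj[OF f y(2) z(2)] transport_inj[OF g y(3) z(3)] transport_inj[OF h y(4) z(4)] y(1) z(1)
          by simp
      qed
      show "?m ` carrier ?S = carrier (stab_group x)"
      proof (intro equalityI subsetI)
        fix k assume "k \<in> carrier (stab_group x)"
        then obtain e p where k: "k = sperm e p" "e \<in> {1, -1}" "bij p" and fixed: "\<forall>i. x $ p i = e * x $ i"
          by (auto simp: Stab_eq sperm_fixes_iff elim!: AutE)
        obtain i where i: "\<forall>j. x $ j \<noteq> - x $ i" using nosign by blast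
        have e: "e = 1" using k(2) spec[OF fixed, of i] spec[OF i, of "p i"] by auto
        then obtain p' q' s' where pqs: "p' permutes I" "q' permutes J" "s' permutes K" "p = p' \<circ> q' \<circ> s'"
          using fixing_permutations[of p] k(3) fixed by auto
        obtain \<pi> where "\<pi> permutes {1..r}" "p' = ?p \<pi>" by (rule transport_surj[OF f pqs(1)])
        moreover obtain \<rho> where "\<rho> permutes {1..t}" "q' = ?q \<rho>" by (rule transport_surj[OF g pqs(2)])
        moreover obtain \<sigma> where "\<sigma> permutes {1..u}" "s' = ?s \<sigma>" by (rule transport_surj[OF h pqs(3)])
        ultimately show "k \<in> ?m ` carrier ?S"
          using k(1) e pqs(4) by (intro image_eqI[of _ _ "(\<pi>, \<rho>, \<sigma>)"]) (auto simp: sym_group_def)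
      next
        fix k assume "k \<in> ?m ` carrier ?S"
        then show "k \<in> carrier (stab_group x)" using in_Stab by (auto simp: sym_group_def)
      qed
    qed
  qed
  then show ?thesis
  proof (rule iso_reverse)
    have "group ?S" by (intro DirProd_group sym_group_is_group)
    then show "y \<otimes>\<^bsub>?S\<^esub> z \<in> carrier ?S" if "y \<in> carrier ?S" "z \<in> carrier ?S" for y z
      using that monoid.m_closed group.is_monoid by metis
  qed
qed


text \<open>
  Here \<open>-\<tau>\<close> is a symmetry of order two that interchanges the blocks of \<open>a\<close> and \<open>-a\<close>. The bijections of
  the blocks with \<open>{1..r}\<close> are chosen to correspond under \<open>\<tau>\<close>, so that conjugation by \<open>\<tau>\<close> interchanges the
  two copies of \<open>S\<^sub>r\<close>.
\<close>

lemma (in three_blocks) stab_group_iso_swap: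
  assumes card: "card I = r" "card K = u" and opposite: "b = - a" "c = 0"
    and \<tau>: "bij \<tau>" "\<And>i. \<tau> (\<tau> i) = i" "\<And>i. x $ \<tau> i = - x $ i" "\<And>i. x $ i = 0 \<Longrightarrow> \<tau> i = i"
  shows "stab_group x \<cong>
    semidirect_product (sym_group r \<times>\<times> sym_group r) (sym_group 2) swap_action \<times>\<times> sym_group u"
proof -
  obtain f where f: "bij_betw f {1..r} I" using ex_bij_betw_nat_finite_1[of I] card by auto
  obtain h where h: "bij_betw h {1..u} K" using ex_bij_betw_nat_finite_1[of K] card by auto
  define g where "g = \<tau> \<circ> f"
  have \<tau>I: "bij_betw \<tau> I J"
  proof (rule bij_betw_imageI)
    show "inj_on \<tau> I" using bij_is_inj[OF \<tau>(1)] by (rule inj_on_subset) simp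
    show "\<tau> ` I = J"
    proof (intro equalityI subsetI)
      fix j assume "j \<in> J"
      then show "j \<in> \<tau> ` I" using \<tau> opposite by (intro image_eqI[of _ _ "\<tau> j"]) (simp_all add: I J)
    qed (use \<tau> opposite in \<open>auto simp: I J\<close>)
  qed
  have g: "bij_betw g {1..r} J" unfolding g_def by (rule bij_betw_trans[OF f \<tau>I])
  define P where "P = transport f r I"
  define Q where "Q = transport g r J"
  define S where "S = transport h u K"
  have P: "P \<pi> permutes I" and Q: "Q \<pi> permutes J" if "\<pi> permutes {1..r}" for \<pi>
    using transport_permutes[OF f that] transport_permutes[OF g that] by (simp_all add: P_def Q_def)
  have S: "S \<sigma> permutes K" if "\<sigma> permutes {1..u}" for \<sigma>
    using transport_permutes[OF h that] by (simp add: S_def)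
  define E where "E \<pi> \<rho> \<sigma> = P \<pi> \<circ> Q \<rho> \<circ> S \<sigma>" for \<pi> \<rho> \<sigma>
  have conj_P: "\<tau> (P \<pi> (\<tau> y)) = Q \<pi> y" if "\<pi> permutes {1..r}" for \<pi> y
  proof (cases "y \<in> J")
    case True
    have "\<tau> y \<in> I" using True \<tau>(3) opposite by (simp add: I J)
    then obtain k where k: "k \<in> {1..r}" "\<tau> y = f k" using f by (auto simp: bij_betw_def)
    then have "y = g k" using \<tau>(2)[of y] by (simp add: g_def)
    moreover have "inv_into {1..r} f (f k) = k" using f k by (intro inv_into_f_f) (simp_all add: bij_betw_def)
    moreover have "inv_into {1..r} g (g k) = k" using g k by (intro inv_into_f_f) (simp_all add: bij_betw_def)
    ultimately show ?thesis using True \<open>\<tau> y \<in> I\<close> k by (simp add: P_def Q_def transport_def g_def)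
  next
    case False
    then have "\<tau> y \<notin> I" using \<tau>(3)[of y] opposite by (auto simp: I J)
    then show ?thesis using False \<tau>(2) by (simp add: P_def Q_def transport_def)
  qed
  have conj_Q: "\<tau> (Q \<pi> (\<tau> y)) = P \<pi> y" if "\<pi> permutes {1..r}" for \<pi> y
    using conj_P[OF that, of "\<tau> y"] \<tau>(2) by metis
  have conj_S: "\<tau> (S \<sigma> (\<tau> y)) = S \<sigma> y" if \<sigma>: "\<sigma> permutes {1..u}" for \<sigma> y
  proof (cases "x $ y = 0")
    case True
    then have "x $ S \<sigma> y = 0" using block_permutes(5)[OF S[OF \<sigma>]] by simp
    then show ?thesis using True \<tau>(4) by simp
  next
    case False
    then show ?thesis
      using block_permutes(6)[OF S[OF \<sigma>], of y] block_permutes(6)[OF S[OF \<sigma>], of "\<tau> y"] \<tau>(2,3) opposite by simp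
  qed
  have E_comm: "Q \<rho> \<circ> P \<pi> \<circ> S \<sigma> = E \<pi> \<rho> \<sigma>"
    if "\<pi> permutes {1..r}" "\<rho> permutes {1..r}" "\<sigma> permutes {1..u}" for \<pi> \<rho> \<sigma>
    using blocks_comp[OF permutes_id Q[OF that(2)] permutes_id P[OF that(1)] permutes_id S[OF that(3)]]
    by (simp add: E_def comp_assoc)
  have E_\<tau>: "\<tau> \<circ> E \<pi> \<rho> \<sigma> = E \<rho> \<pi> \<sigma> \<circ> \<tau>"
    if "\<pi> permutes {1..r}" "\<rho> permutes {1..r}" "\<sigma> permutes {1..u}" for \<pi> \<rho> \<sigma>
  proof
    fix y
    have "\<tau> (P \<pi> (Q \<rho> (S \<sigma> y))) = Q \<pi> (P \<rho> (S \<sigma> (\<tau> y)))"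
      using conj_P[OF that(1), of "\<tau> (Q \<rho> (S \<sigma> y))"] conj_Q[OF that(2), of "\<tau> (S \<sigma> y)"]
        conj_S[OF that(3), of "\<tau> y"] by (simp only: \<tau>(2))
    then show "(\<tau> \<circ> E \<pi> \<rho> \<sigma>) y = (E \<rho> \<pi> \<sigma> \<circ> \<tau>) y"
      using fun_cong[OF E_comm[OF that(2,1,3)], of "\<tau> y"] by (simp add: E_def)
  qed
  have E_mult: "E \<pi> \<rho> \<sigma> \<circ> E \<pi>' \<rho>' \<sigma>' = E (\<pi> \<circ> \<pi>') (\<rho> \<circ> \<rho>') (\<sigma> \<circ> \<sigma>')"
    if "\<pi> permutes {1..r}" "\<rho> permutes {1..r}" "\<sigma> permutes {1..u}"
      "\<pi>' permutes {1..r}" "\<rho>' permutes {1..r}" "\<sigma>' permutes {1..u}" for \<pi> \<rho> \<sigma> \<pi>' \<rho>' \<sigma>'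
    unfolding E_def blocks_comp[OF P[OF that(1)] Q[OF that(2)] S[OF that(3)] P[OF that(4)] Q[OF that(5)] S[OF that(6)]]
    using that by (simp add: P_def Q_def S_def transport_comp[OF f] transport_comp[OF g] transport_comp[OF h])
  have E_bij: "bij (E \<pi> \<rho> \<sigma>)" and E_fix: "x $ E \<pi> \<rho> \<sigma> i = x $ i"
    if "\<pi> permutes {1..r}" "\<rho> permutes {1..r}" "\<sigma> permutes {1..u}" for \<pi> \<rho> \<sigma> i
  proof -
    have "bij (E \<pi> \<rho> \<sigma>) \<and> (\<forall>i. x $ E \<pi> \<rho> \<sigma> i = x $ i)"
      unfolding fixing_permutations E_def using P[OF that(1)] Q[OF that(2)] S[OF that(3)] by blast
    then show "bij (E \<pi> \<rho> \<sigma>)" "x $ E \<pi> \<rho> \<sigma> i = x $ i" by simp_all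
  qed
  define T where "T k = (if k = id then id else \<tau>)" for k :: "nat \<Rightarrow> nat"
  define sg where "sg k = (if k = id then 1 else - 1 :: real)" for k :: "nat \<Rightarrow> nat"
  define m where "m = (\<lambda>(((\<pi>, \<rho>), k), \<sigma>). sperm (sg k) (E \<pi> \<rho> \<sigma> \<circ> T k))"
  let ?S = "semidirect_product (sym_group r \<times>\<times> sym_group r) (sym_group 2) swap_action \<times>\<times> sym_group u"
  have two: "k permutes {1..2} \<longleftrightarrow> k = id \<or> k = Transposition.transpose 1 2" for k :: "nat \<Rightarrow> nat"
    unfolding nat_intervals by (rule permutes_doubleton_iff)
  have tr: "Transposition.transpose 1 (2::nat) \<noteq> id" by (metis id_apply one_eq_numeral_iff semiring_norm(85) transpose_apply_first)
  have S_carrier: "y \<in> carrier ?S \<longleftrightarrow> (\<exists>\<pi> \<rho> k \<sigma>. y = (((\<pi>, \<rho>), k), \<sigma>) \<and> \<pi> permutes {1..r} \<and>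
      \<rho> permutes {1..r} \<and> k permutes {1..2} \<and> \<sigma> permutes {1..u})" for y
    by (cases y) (auto simp: semidirect_product_def sym_group_def)
  have T_bij: "bij (T k)" for k using \<tau>(1) by (simp add: T_def)
  have sg: "sg k \<in> {1, -1}" for k by (simp add: sg_def)
  have in_Stab: "m (((\<pi>, \<rho>), k), \<sigma>) \<in> Stab x"
    if "\<pi> permutes {1..r}" "\<rho> permutes {1..r}" "\<sigma> permutes {1..u}" for \<pi> \<rho> k \<sigma>
  proof -
    have b: "bij (E \<pi> \<rho> \<sigma> \<circ> T k)" by (rule bij_comp[OF T_bij E_bij[OF that]])
    have "x $ (E \<pi> \<rho> \<sigma> \<circ> T k) i = sg k * x $ i" for i
      by (simp add: E_fix[OF that] T_def sg_def \<tau>(3))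
    then show ?thesis
      using sperm_in_Aut[OF sg b] sperm_fixes_iff[OF b] by (simp add: m_def Stab_eq)
  qed
  have "m \<in> iso ?S (stab_group x)"
  proof (rule isoI)
    show "m \<in> hom ?S (stab_group x)"
    proof (rule homI)
      fix y assume "y \<in> carrier ?S"
      then show "m y \<in> carrier (stab_group x)" unfolding S_carrier using in_Stab by auto
    next
      fix y z assume "y \<in> carrier ?S" "z \<in> carrier ?S"
      then obtain \<pi> \<rho> k \<sigma> \<pi>' \<rho>' k' \<sigma>' where
        y: "y = (((\<pi>, \<rho>), k), \<sigma>)" "\<pi> permutes {1..r}" "\<rho> permutes {1..r}" "\<sigma> permutes {1..u}" "k permutes {1..2}"
        and z: "z = (((\<pi>', \<rho>'), k'), \<sigma>')" "\<pi>' permutes {1..r}" "\<rho>' permutes {1..r}" "\<sigma>' permutes {1..u}" "k' permutes {1..2}"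
        unfolding S_carrier by blast
      have "m y \<otimes>\<^bsub>Aut_A4\<^esub> m z = m y \<circ> m z"
        using in_Stab[OF y(2-4)] in_Stab[OF z(2-4)] y(1) z(1) by (intro Aut_mult) (simp_all add: Stab_eq)
      also have "\<dots> = sperm (sg k * sg k') (E \<pi> \<rho> \<sigma> \<circ> T k \<circ> (E \<pi>' \<rho>' \<sigma>' \<circ> T k'))"
        using sperm_comp[OF bij_comp[OF T_bij E_bij[OF y(2-4)]] bij_comp[OF T_bij E_bij[OF z(2-4)]], of "sg k" k "sg k'" k'] y(1) z(1)
        by (simp add: fun_eq_iff m_def)
      also have "\<dots> = m (y \<otimes>\<^bsub>?S\<^esub> z)"
      proof (cases "k = id")
        case True
        have "sg id = 1" "T id = id" by (simp_all add: sg_def T_def)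
        then show ?thesis
          using True y(1) z(1) E_mult[OF y(2-4) z(2-4)]
          by (simp add: m_def semidirect_product_def swap_action_def sym_group_mult mult_DirProd' comp_assoc[symmetric])
      next
        case False
        then have k: "k = Transposition.transpose 1 2" using y(5) two by blast
        have "k \<circ> k' = id \<longleftrightarrow> k' \<noteq> id"
          using z(5) two tr by (auto simp: k)
        then have sgT: "sg k * sg k' = sg (k \<circ> k')" "\<tau> \<circ> T k' = T (k \<circ> k')"
          using False \<tau>(2) by (auto simp: sg_def T_def fun_eq_iff)
        have "E \<pi> \<rho> \<sigma> \<circ> T k \<circ> (E \<pi>' \<rho>' \<sigma>' \<circ> T k') = E \<pi> \<rho> \<sigma> \<circ> (\<tau> \<circ> E \<pi>' \<rho>' \<sigma>') \<circ> T k'"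
          using False by (simp add: T_def comp_assoc)
        also have "\<dots> = (E \<pi> \<rho> \<sigma> \<circ> E \<rho>' \<pi>' \<sigma>') \<circ> (\<tau> \<circ> T k')"
          unfolding E_\<tau>[OF z(2-4)] by (simp add: comp_assoc)
        also have "\<dots> = E (\<pi> \<circ> \<rho>') (\<rho> \<circ> \<pi>') (\<sigma> \<circ> \<sigma>') \<circ> T (k \<circ> k')"
          unfolding E_mult[OF y(2-4) z(3,2,4)] sgT(2) ..
        finally show ?thesis
          using False y(1) z(1) sgT(1)
          by (simp add: m_def semidirect_product_def swap_action_def sym_group_mult mult_DirProd')
      qed
      finally show "m (y \<otimes>\<^bsub>?S\<^esub> z) = m y \<otimes>\<^bsub>stab_group x\<^esub> m z" by simp
    qed
    show "bij_betw m (carrier ?S) (carrier (stab_group x))"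
    proof (rule bij_betw_imageI)
      show "inj_on m (carrier ?S)"
      proof (rule inj_onI)
        fix y z assume "y \<in> carrier ?S" "z \<in> carrier ?S" and eq: "m y = m z"
        then obtain \<pi> \<rho> k \<sigma> \<pi>' \<rho>' k' \<sigma>' where
          y: "y = (((\<pi>, \<rho>), k), \<sigma>)" "\<pi> permutes {1..r}" "\<rho> permutes {1..r}" "\<sigma> permutes {1..u}" "k permutes {1..2}"
          and z: "z = (((\<pi>', \<rho>'), k'), \<sigma>')" "\<pi>' permutes {1..r}" "\<rho>' permutes {1..r}" "\<sigma>' permutes {1..u}" "k' permutes {1..2}"
          unfolding S_carrier by blast
        have "sg k = sg k' \<and> E \<pi> \<rho> \<sigma> \<circ> T k = E \<pi>' \<rho>' \<sigma>' \<circ> T k'"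
          using eq y(1) z(1) by (intro sperm_inj bij_comp T_bij E_bij y z sg) (simp add: m_def)
        then have k: "k = k'" and e: "E \<pi> \<rho> \<sigma> \<circ> T k = E \<pi>' \<rho>' \<sigma>' \<circ> T k"
          using y(5) z(5) two tr by (auto simp: sg_def split: if_splits)
        have "T k (T k i) = i" for i by (simp add: T_def \<tau>(2))
        then have "E \<pi> \<rho> \<sigma> i = E \<pi>' \<rho>' \<sigma>' i" for i
          using fun_cong[OF e, of "T k i"] by simp
        then have "P \<pi> \<circ> Q \<rho> \<circ> S \<sigma> = P \<pi>' \<circ> Q \<rho>' \<circ> S \<sigma>'" unfolding E_def[symmetric] by (rule ext)
        then have "P \<pi> = P \<pi>' \<and> Q \<rho> = Q \<rho>' \<and> S \<sigma> = S \<sigma>'"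
          by (intro blocks_inj P Q S y z)
        then show "y = z"
          using transport_inj[OF f y(2) z(2)] transport_inj[OF g y(3) z(3)] transport_inj[OF h y(4) z(4)] y(1) z(1) k
          by (simp add: P_def Q_def S_def)
      qed
      show "m ` carrier ?S = carrier (stab_group x)"
      proof (intro equalityI subsetI)
        fix w assume "w \<in> carrier (stab_group x)"
        then obtain e p where w: "w = sperm e p" "e \<in> {1, -1}" "bij p" and fixed: "\<And>i. x $ p i = e * x $ i"
          by (auto simp: Stab_eq sperm_fixes_iff elim!: AutE)
        define k where "k = (if e = 1 then id else Transposition.transpose 1 (2::nat))"
        have k: "k permutes {1..2}" "sg k = e" using w(2) tr unfolding two by (auto simp: k_def sg_def)
        have TT: "T k (T k i) = i" for i by (simp add: T_def \<tau>(2))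
        have "x $ (p \<circ> T k) i = x $ i" for i
          using w(2) tr by (auto simp: fixed T_def k_def \<tau>(3))
        moreover have "bij (p \<circ> T k)" by (rule bij_comp[OF T_bij w(3)])
        ultimately obtain p' q' s' where pqs: "p' permutes I" "q' permutes J" "s' permutes K" "p \<circ> T k = p' \<circ> q' \<circ> s'"
          using fixing_permutations[of "p \<circ> T k"] by blast
        obtain \<pi> where pi: "\<pi> permutes {1..r}" "p' = P \<pi>" using transport_surj[OF f pqs(1)] by (auto simp: P_def)
        obtain \<rho> where rho: "\<rho> permutes {1..r}" "q' = Q \<rho>" using transport_surj[OF g pqs(2)] by (auto simp: Q_def)
        obtain \<sigma> where sigma: "\<sigma> permutes {1..u}" "s' = S \<sigma>" using transport_surj[OF h pqs(3)] by (auto simp: S_def)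
        have "p \<circ> T k = E \<pi> \<rho> \<sigma>" using pqs(4) by (simp only: E_def pi rho sigma)
        then have "p i = (E \<pi> \<rho> \<sigma> \<circ> T k) i" for i using TT by (metis comp_apply)
        then have "p = E \<pi> \<rho> \<sigma> \<circ> T k" by (simp add: fun_eq_iff)
        then have "w = m (((\<pi>, \<rho>), k), \<sigma>)" using w(1) k(2) by (simp add: m_def)
        moreover have "(((\<pi>, \<rho>), k), \<sigma>) \<in> carrier ?S" unfolding S_carrier using pi rho sigma k(1) by blast
        ultimately show "w \<in> m ` carrier ?S" by (rule image_eqI)
      next
        fix w assume "w \<in> m ` carrier ?S"
        then show "w \<in> carrier (stab_group x)" unfolding image_iff Bex_def S_carrier using in_Stab by auto
      qed
    qed
  qed
  then show ?thesis
  proof (rule iso_reverse)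
    show "y \<otimes>\<^bsub>?S\<^esub> z \<in> carrier ?S" if "y \<in> carrier ?S" "z \<in> carrier ?S" for y z
      using that unfolding S_carrier
      by (elim exE conjE) (simp add: semidirect_product_def swap_action_def sym_group_mult mult_DirProd' permutes_compose)
  qed
qed


lemma card_5: "card {i :: 5. P i} =
    of_bool (P 0) + of_bool (P 1) + of_bool (P 2) + of_bool (P 3) + of_bool (P 4)"
proof -
  have "card {i :: 5. P i} = (\<Sum>i\<in>{i \<in> UNIV. P i}. 1)" by simp
  also have "\<dots> = (\<Sum>i\<in>UNIV. if P i then 1 else 0)" by (rule sum.inter_filter) (rule finite)
  finally show ?thesis unfolding sum_5 by (simp add: of_bool_def)
qed

lemma stab_group_vec:
  assumes "a \<noteq> b" "a \<noteq> c" "b \<noteq> c" "\<forall>i j. x $ i \<notin> {a, b, c} \<longrightarrow> x $ j = x $ i \<longrightarrow> j = i"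
    and "\<exists>i. \<forall>j. x $ j \<noteq> - x $ i"
    and "card {i. x $ i = a} = r" "card {i. x $ i = b} = t" "card {i. x $ i = c} = u"
  shows "stab_group x \<cong> sym_group r \<times>\<times> sym_group t \<times>\<times> sym_group u"
  by (rule three_blocks.stab_group_iso[OF three_blocks.intro[OF refl refl refl assms(1-3)]])
    (use assms in auto)

lemma stab_group_srt_less:
  assumes "1 \<le> r" "r < t" "r + t \<le> 5"
  shows "stab_group (srt r t) \<cong> sym_group r \<times>\<times> sym_group t \<times>\<times> sym_group (5 - (r + t))"
proof -
  have "stab_group (srt 1 2) \<cong> sym_group 1 \<times>\<times> sym_group 2 \<times>\<times> sym_group 2" unfolding srt_eq
    by (rule stab_group_vec[of 2 "-1" 0])
      (simp_all only: forall_5 card_5 vec5_nth, simp_all, auto intro!: exI[of _ 1] simp: forall_5)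
  moreover have "stab_group (srt 1 3) \<cong> sym_group 1 \<times>\<times> sym_group 3 \<times>\<times> sym_group 1" unfolding srt_eq
    by (rule stab_group_vec[of 3 "-1" 0])
      (simp_all only: forall_5 card_5 vec5_nth, simp_all, auto intro!: exI[of _ 1] simp: forall_5)
  moreover have "stab_group (srt 1 4) \<cong> sym_group 1 \<times>\<times> sym_group 4 \<times>\<times> sym_group 0" unfolding srt_eq
    by (rule stab_group_vec[of 4 "-1" 0])
      (simp_all only: forall_5 card_5 vec5_nth, simp_all, auto intro!: exI[of _ 1] simp: forall_5)
  moreover have "stab_group (srt 2 3) \<cong> sym_group 2 \<times>\<times> sym_group 3 \<times>\<times> sym_group 0" unfolding srt_eq
    by (rule stab_group_vec[of 3 "-2" 0])
      (simp_all only: forall_5 card_5 vec5_nth, simp_all, auto intro!: exI[of _ 1] simp: forall_5)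
  moreover have "r = 1 \<and> (t = 2 \<or> t = 3 \<or> t = 4) \<or> r = 2 \<and> t = 3" using assms by arith
  ultimately show ?thesis by (elim disjE conjE) simp_all
qed

lemma stab_group_srt_eq:
  assumes "1 \<le> r" "r + r \<le> 5"
  shows "stab_group (srt r r) \<cong>
    semidirect_product (sym_group r \<times>\<times> sym_group r) (sym_group 2) swap_action \<times>\<times> sym_group (5 - 2 * r)"
proof -
  let ?\<tau> = "Transposition.transpose 1 (2::5)"
  let ?\<rho> = "Transposition.transpose 1 (3::5) \<circ> Transposition.transpose 2 4"
have "stab_group (srt 1 1) \<cong>
    semidirect_product (sym_group 1 \<times>\<times> sym_group 1) (sym_group 2) swap_action \<times>\<times> sym_group 3"
    unfolding srt_eq
  proof (rule three_blocks.stab_group_iso_swap[OF three_blocks.intro[OF refl refl refl, of 1 "-1" 0]])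
    let ?x = "vec5 1 (-1) 0 0 0"
    have "\<forall>i j. ?x $ i \<notin> {1, - 1, 0} \<longrightarrow> ?x $ j = ?x $ i \<longrightarrow> j = i"
      unfolding forall_5 by simp
    then show "j = i" if "?x $ i \<notin> {1, - 1, 0}" "?x $ j = ?x $ i" for i j using that by blast
    have "\<forall>i. ?\<tau> (?\<tau> i) = i" "\<forall>i. ?x $ ?\<tau> i = - ?x $ i" "\<forall>i. ?x $ i = 0 \<longrightarrow> ?\<tau> i = i"
      unfolding forall_5 by (simp_all add: Transposition.transpose_def)
    then show "?\<tau> (?\<tau> i) = i" "?x $ ?\<tau> i = - ?x $ i" "?x $ i = 0 \<Longrightarrow> ?\<tau> i = i" for i by blast+
    show "bij ?\<tau>" by simp
  qed (simp_all add: card_5)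
  moreover have "stab_group (srt 2 2) \<cong>
    semidirect_product (sym_group 2 \<times>\<times> sym_group 2) (sym_group 2) swap_action \<times>\<times> sym_group 1"
    unfolding srt_eq
  proof (rule three_blocks.stab_group_iso_swap[OF three_blocks.intro[OF refl refl refl, of 1 "-1" 0]])
    let ?x = "vec5 1 1 (-1) (-1) 0"
    have "\<forall>i j. ?x $ i \<notin> {1, - 1, 0} \<longrightarrow> ?x $ j = ?x $ i \<longrightarrow> j = i"
      unfolding forall_5 by simp
    then show "j = i" if "?x $ i \<notin> {1, - 1, 0}" "?x $ j = ?x $ i" for i j using that by blast
    have "\<forall>i. ?\<rho> (?\<rho> i) = i" "\<forall>i. ?x $ ?\<rho> i = - ?x $ i" "\<forall>i. ?x $ i = 0 \<longrightarrow> ?\<rho> i = i"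
      unfolding forall_5 by (simp_all add: Transposition.transpose_def)
    then show "?\<rho> (?\<rho> i) = i" "?x $ ?\<rho> i = - ?x $ i" "?x $ i = 0 \<Longrightarrow> ?\<rho> i = i" for i by blast+
    show "bij ?\<rho>" by (intro bij_comp) simp_all
  qed (simp_all add: card_5)
  moreover have "r = 1 \<or> r = 2" using assms by arith
  ultimately show ?thesis by (elim disjE) simp_all
qed

lemma DirProd_trivial_right:
  assumes "carrier H = {\<one>\<^bsub>H\<^esub>}"
  shows "G \<times>\<times> H \<cong> G"
proof -
  have "fst \<in> iso (G \<times>\<times> H) G"
    using assms by (auto simp: iso_def hom_def mult_DirProd' bij_betw_def inj_on_def)
  then show ?thesis by (auto simp: is_iso_def)
qed

lemma stab_group_v:
  "stab_group v1 \<cong> sym_group 3" "stab_group v2 \<cong> sym_group 2 \<times>\<times> sym_group 2" "stab_group v3 \<cong> sym_group 2"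
proof -
  have triv: "carrier (sym_group 0) = {\<one>\<^bsub>sym_group 0\<^esub>}" by (simp add: sym_group_def)
  then have triv2: "carrier (sym_group 0 \<times>\<times> sym_group 0) = {\<one>\<^bsub>sym_group 0 \<times>\<times> sym_group 0\<^esub>}" by simp
  \<comment> \<open>The numbers 10 and 11 are not coordinates, so they give empty blocks.\<close>
  have "stab_group v1 \<cong> sym_group 3 \<times>\<times> sym_group 0 \<times>\<times> sym_group 0" unfolding v_eq
    by (rule stab_group_vec[of "-1" 10 11])
      (simp_all only: forall_5 card_5 vec5_nth, simp_all, auto intro!: exI[of _ 2] simp: forall_5)
  then show "stab_group v1 \<cong> sym_group 3" using DirProd_trivial_right[OF triv2] by (rule iso_trans)
  have "stab_group v2 \<cong> sym_group 2 \<times>\<times> sym_group 2 \<times>\<times> sym_group 0" unfolding v_eq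
    by (rule stab_group_vec[of 2 "-1" 10])
      (simp_all only: forall_5 card_5 vec5_nth, simp_all, auto intro!: exI[of _ 4] simp: forall_5)
  then show "stab_group v2 \<cong> sym_group 2 \<times>\<times> sym_group 2"
    using group.DirProd_iso_trans[OF sym_group_is_group iso_refl DirProd_trivial_right[OF triv]]
    by (rule iso_trans)
  have "stab_group v3 \<cong> sym_group 2 \<times>\<times> sym_group 0 \<times>\<times> sym_group 0" unfolding v_eq
    by (rule stab_group_vec[of "-2" 10 11])
      (simp_all only: forall_5 card_5 vec5_nth, simp_all, auto intro!: exI[of _ 2] simp: forall_5)
  then show "stab_group v3 \<cong> sym_group 2" using DirProd_trivial_right[OF triv2] by (rule iso_trans)
qed


section \<open>The permutation lattice on the rays\<close>

interpretation P: coset_sum Aut_A4 Omega Stab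
  by (rule coset_sum.intro[OF group_Aut finite_Aut finite_Omega Stab_subgroup])

lemma coset_elem_eq: "coset_elem x g = P.bvec (x, g <#\<^bsub>Aut_A4\<^esub> Stab x)"
  by (simp add: coset_elem_def P.bvec_def)

text \<open>The vector at which a coset \<open>g Stab x\<close> points, namely \<open>g x\<close>.\<close>

definition coset_value :: "(real^5) \<times> (real^5 \<Rightarrow> real^5) set \<Rightarrow> real^5" where
  "coset_value = (\<lambda>(x, C). (SOME g. g \<in> C) x)"

lemma coset_value_coset:
  assumes g: "g \<in> carrier Aut_A4"
  shows "coset_value (x, g <#\<^bsub>Aut_A4\<^esub> Stab x) = g x"
proof -
  have "g \<in> g <#\<^bsub>Aut_A4\<^esub> Stab x" by (rule P.G.lcos_self[OF g Stab_subgroup])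
  then have "(SOME h. h \<in> g <#\<^bsub>Aut_A4\<^esub> Stab x) \<in> g <#\<^bsub>Aut_A4\<^esub> Stab x"
    by (rule someI[where P = "\<lambda>h. h \<in> g <#\<^bsub>Aut_A4\<^esub> Stab x"])
  then obtain s where "s \<in> Stab x" "(SOME h. h \<in> g <#\<^bsub>Aut_A4\<^esub> Stab x) = g \<otimes>\<^bsub>Aut_A4\<^esub> s"
    by (auto simp: l_coset_def)
  then show ?thesis using g by (simp add: coset_value_def Stab_eq Aut_mult)
qed

lemma index_cases:
  assumes "iC \<in> P.index"
  obtains x g where "x \<in> Omega" "g \<in> carrier Aut_A4" "iC = (x, g <#\<^bsub>Aut_A4\<^esub> Stab x)"
  using assms by (auto simp: P.index_def P.lcosets_eq)

text \<open>
  Different orbits are separated by \<open>shape\<close>, and cosets of a stabilizer by the points of the orbit.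
\<close>

lemma coset_value_inj: "inj_on coset_value P.index"
proof (rule inj_onI)
  fix iC jD assume "iC \<in> P.index" "jD \<in> P.index" and eq: "coset_value iC = coset_value jD"
  then obtain x g y h where x: "x \<in> Omega" "g \<in> carrier Aut_A4" "iC = (x, g <#\<^bsub>Aut_A4\<^esub> Stab x)"
    and y: "y \<in> Omega" "h \<in> carrier Aut_A4" "jD = (y, h <#\<^bsub>Aut_A4\<^esub> Stab y)"
    by (metis index_cases)
  have gh: "g x = h y" using eq x y by (simp add: coset_value_coset)
  then have "shape x = shape y" using x(2) y(2) shape_Aut by metis
  then have xy: "x = y" using Omega_shape_inj x(1) y(1) by blast
  let ?k = "inv\<^bsub>Aut_A4\<^esub> g \<otimes>\<^bsub>Aut_A4\<^esub> h"
  have "?k x = (inv\<^bsub>Aut_A4\<^esub> g) (h x)" using x y by (simp add: Aut_mult)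
  also have "h x = g x" using gh xy by simp
  also have "(inv\<^bsub>Aut_A4\<^esub> g) (g x) = x" by (rule Aut_inv(1)[OF x(2)])
  finally have "?k x = x" .
  then have "?k \<in> Stab x" using x y by (simp add: Stab_eq)
  moreover have "h = g \<otimes>\<^bsub>Aut_A4\<^esub> ?k" using x y by (simp flip: P.G.m_assoc)
  ultimately have "h \<in> g <#\<^bsub>Aut_A4\<^esub> Stab x" unfolding l_coset_def by blast
  then have "g <#\<^bsub>Aut_A4\<^esub> Stab x = h <#\<^bsub>Aut_A4\<^esub> Stab x"
    using P.G.l_repr_independence x(2) Stab_subgroup by blast
  then show "iC = jD" using x y xy by simp
qed

lemma coset_value_image: "coset_value ` P.index = rayvecs"
proof (intro equalityI subsetI)
  fix w assume "w \<in> coset_value ` P.index"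
  then obtain x g where "x \<in> Omega" "g \<in> carrier Aut_A4" "w = coset_value (x, g <#\<^bsub>Aut_A4\<^esub> Stab x)"
    by (auto elim!: index_cases)
  then show "w \<in> rayvecs" using coset_value_coset unfolding rayvecs_def by blast
next
  fix w assume "w \<in> rayvecs"
  then obtain g x where "g \<in> carrier Aut_A4" "x \<in> Omega" "w = g x" by (auto simp: rayvecs_def)
  then show "w \<in> coset_value ` P.index"
    by (intro image_eqI[of _ _ "(x, g <#\<^bsub>Aut_A4\<^esub> Stab x)"]) (auto simp: coset_value_coset P.index_def P.lcosets_eq)
qed

lemma coset_value_act:
  assumes "(x, C) \<in> P.index" "g \<in> carrier Aut_A4"
  shows "coset_value (x, g <#\<^bsub>Aut_A4\<^esub> C) = g (coset_value (x, C))"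
proof -
  obtain h where h: "h \<in> carrier Aut_A4" "C = h <#\<^bsub>Aut_A4\<^esub> Stab x" "x \<in> Omega"
    using assms(1) by (auto elim: index_cases)
  have "g <#\<^bsub>Aut_A4\<^esub> C = (g \<otimes>\<^bsub>Aut_A4\<^esub> h) <#\<^bsub>Aut_A4\<^esub> Stab x"
    using P.l_coset_assoc[OF h(3) assms(2) h(1)] h(2) by simp
  moreover have "coset_value (x, (g \<otimes>\<^bsub>Aut_A4\<^esub> h) <#\<^bsub>Aut_A4\<^esub> Stab x) = (g \<otimes>\<^bsub>Aut_A4\<^esub> h) x"
    by (rule coset_value_coset[OF P.G.m_closed[OF assms(2) h(1)]])
  ultimately show ?thesis using h assms(2) by (simp add: coset_value_coset Aut_mult)
qed

interpretation ZA: comm_group ZA4 by (rule comm_group_ZA4)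

lemma finprod_ZA4: "f \<in> A \<rightarrow> intvec \<Longrightarrow> finprod ZA4 f A = sum f A"
proof (induction A rule: infinite_finite_induct)
  case (insert a A)
  then have "f \<in> A \<rightarrow> carrier ZA4" "f a \<in> carrier ZA4" by (auto simp: carrier_ZA4)
  with insert show ?case by simp
qed simp_all

lemma int_pow_ZA4:
  assumes "x \<in> intvec"
  shows "x [^]\<^bsub>ZA4\<^esub> (n :: int) = of_int n *\<^sub>R x"
proof -
  have "(\<lambda>n. real_of_int n *\<^sub>R x) \<in> hom integer_group ZA4"
    using assms by (auto simp: hom_def carrier_ZA4 intvec_scale scaleR_add_left)
  from hom_int_pow[OF this, of 1 n] show ?thesis using ZA.group_axioms by simp
qed

abbreviation basis_P :: "(real^5 \<Rightarrow> (real^5 \<Rightarrow> real^5) set \<Rightarrow>\<^sub>0 int) set" where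
  "basis_P \<equiv> P.bvec ` P.index"

interpretation BP: based_lattice P_A4 basis_P
  unfolding P_A4_def by (rule based_lattice.intro[OF P.comm_group_M], unfold_locales) (rule P.lattice_basis_M)

lemma bvec_inj: "inj_on P.bvec P.index"
proof (rule inj_onI)
  fix iC jD assume ij: "iC \<in> P.index" "jD \<in> P.index" and eq: "P.bvec iC = P.bvec jD"
  obtain i C j D where [simp]: "iC = (i, C)" "jD = (j, D)" by fastforce
  have "i \<in> Omega" using ij(1) by (simp add: P.index_def)
  then have "frag_of C = (if i = j then frag_of D else 0)"
    using fun_cong[OF eq, of i] by (simp add: P.bvec_def)
  then show "iC = jD" by (simp add: frag_of_eq split: if_splits)
qed

theorem ex_projection:
  "\<exists>\<pi>. \<pi> \<in> equivariant_hom Aut_A4 P_A4 ZA4 \<and> (\<forall>iC\<in>P.index. \<pi> (P.bvec iC) = coset_value iC)"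
proof -
  let ?f = "\<lambda>b. coset_value (the_inv_into P.index P.bvec b)"
  have f: "?f (P.bvec iC) = coset_value iC" if "iC \<in> P.index" for iC
    using that by (simp add: the_inv_into_f_f[OF bvec_inj])
  have coset_value: "coset_value iC \<in> carrier ZA4" if "iC \<in> P.index" for iC
    using that rayvecs_intvec coset_value_image by (auto simp: carrier_ZA4)
  then have "?f \<in> basis_P \<rightarrow> carrier ZA4" using f by auto
  then obtain \<pi> where \<pi>: "\<pi> \<in> hom P_A4 ZA4" and \<pi>f: "\<And>b. b \<in> basis_P \<Longrightarrow> \<pi> b = ?f b"
    by (rule BP.hom_of_basis[OF comm_group_ZA4]) blast
  have \<pi>coset_value: "\<pi> (P.bvec iC) = coset_value iC" if "iC \<in> P.index" for iC
    using that \<pi>f[of "P.bvec iC"] f by simp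
  interpret PL: G_lattice Aut_A4 P_A4 unfolding P_A4_def by unfold_locales (rule P.is_G_lattice_M)
  have "\<pi> (act P_A4 g p) = act ZA4 g (\<pi> p)" if g: "g \<in> carrier Aut_A4" and p: "p \<in> carrier P_A4" for g p
  proof (rule BP.hom_eqI[OF comm_group_ZA4 _ _ _ p, where h = "\<lambda>p. \<pi> (act P_A4 g p)" and k = "\<lambda>p. act ZA4 g (\<pi> p)"])
    show "(\<lambda>p. \<pi> (act P_A4 g p)) \<in> hom P_A4 ZA4"
      using hom_compose[OF PL.act_hom[OF g] \<pi>] by (simp add: comp_def)
    have "act ZA4 g \<in> hom ZA4 ZA4" using is_G_lattice_ZA4 g unfolding is_G_lattice_def by blast
    from hom_compose[OF \<pi> this] show "(\<lambda>p. act ZA4 g (\<pi> p)) \<in> hom P_A4 ZA4" by (simp add: comp_def)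
    fix b assume "b \<in> basis_P"
    then obtain x C where xC: "(x, C) \<in> P.index" "b = P.bvec (x, C)" by auto
    have "act P_A4 g b = P.bvec (x, g <#\<^bsub>Aut_A4\<^esub> C)"
      unfolding P_A4_def xC(2) by (rule P.act_bvec[OF g xC(1)])
    then show "\<pi> (act P_A4 g b) = act ZA4 g (\<pi> b)"
      using \<pi>coset_value[OF xC(1)] \<pi>coset_value[OF P.index_act[OF g xC(1)]] coset_value_act[OF xC(1) g] xC(2) by simp
  qed
  with \<pi> have "\<pi> \<in> equivariant_hom Aut_A4 P_A4 ZA4" by (simp add: equivariant_hom_def)
  then show ?thesis using \<pi>coset_value by blast
qed

text \<open>
  The part of the basis that lies over the vectors \<open>e\<^sub>k - e\<^sub>5\<close> maps to a basis of the root lattice. An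
  expansion of \<open>x\<close> with its symmetries lifts \<open>x\<close> to the product of the basis elements \<open>b\<close>, raised to the
  coefficients at the vectors \<open>\<pi> b\<close>; symmetries of \<open>x\<close> only permute the factors.
\<close>

theorem invariant_lifting_P:
  assumes \<pi>: "\<pi> \<in> equivariant_hom Aut_A4 P_A4 ZA4" and coset_value: "\<And>iC. iC \<in> P.index \<Longrightarrow> \<pi> (P.bvec iC) = coset_value iC"
  shows "\<exists>A. invariant_lifting Aut_A4 P_A4 ZA4 \<pi> A basis_P"
proof
  have lat: "is_G_lattice Aut_A4 P_A4" unfolding P_A4_def by (rule P.is_G_lattice_M)
  interpret PL: G_lattice Aut_A4 P_A4 by unfold_locales (rule lat)
  have \<pi>hom: "\<pi> \<in> hom P_A4 ZA4" and \<pi>act: "\<And>g p. g \<in> carrier Aut_A4 \<Longrightarrow> p \<in> carrier P_A4 \<Longrightarrow> \<pi> (act P_A4 g p) = g (\<pi> p)"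
    using \<pi> by (simp_all add: equivariant_hom_def)
  have act_B: "act P_A4 g ` basis_P = basis_P" if "g \<in> carrier Aut_A4" for g
    unfolding P_A4_def by (rule P.act_basis[OF that])
  have inj: "inj_on \<pi> basis_P"
  proof (rule inj_onI)
    fix b b' assume "b \<in> basis_P" "b' \<in> basis_P" "\<pi> b = \<pi> b'"
    then show "b = b'" using coset_value inj_onD[OF coset_value_inj] by (auto; metis)
  qed
  have image: "\<pi> ` basis_P = rayvecs"
    using coset_value coset_value_image by (simp add: image_image cong: image_cong_simp)
  let ?A = "{b \<in> basis_P. \<pi> b \<in> basis_root ` (UNIV - {0})}"
  have "basis_root ` (UNIV - {0}) \<subseteq> rayvecs"
    using root_rayvecs by (auto simp: basis_root_def)
  then have sub: "basis_root ` (UNIV - {0}) \<subseteq> \<pi> ` basis_P" unfolding image .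
  have A_image: "\<pi> ` ?A = basis_root ` (UNIV - {0})"
  proof (intro equalityI subsetI)
    fix w assume w: "w \<in> basis_root ` (UNIV - {0})"
    then obtain b where "b \<in> basis_P" "w = \<pi> b" using sub by blast
    with w show "w \<in> \<pi> ` ?A" by (intro image_eqI[of _ _ b]) simp_all
  qed blast
  show "invariant_lifting Aut_A4 P_A4 ZA4 \<pi> ?A basis_P"
  proof
    show "inj_on \<pi> ?A" using inj by (rule inj_on_subset) auto
    show "lattice_basis ZA4 (\<pi> ` ?A)" unfolding A_image by (rule lattice_basis_ZA4)
    fix x assume "x \<in> carrier ZA4"
    then obtain c where c: "(\<Sum>w\<in>rayvecs. of_int (c w) *\<^sub>R w) = x"
      and c_inv: "\<And>g w. g \<in> carrier Aut_A4 \<Longrightarrow> g x = x \<Longrightarrow> c (g w) = c w"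
      using symmetric_expansion_exists[of x] by (auto simp: carrier_ZA4 symmetric_expansion_def)
    let ?p = "finprod P_A4 (\<lambda>b. b [^]\<^bsub>P_A4\<^esub> c (\<pi> b)) basis_P"
    have p: "?p \<in> carrier P_A4" by (rule BP.finprod_closed) auto
    have \<pi>b: "\<pi> b \<in> intvec" if "b \<in> basis_P" for b
      using that image rayvecs_intvec by blast
    have "\<pi> ?p = finprod ZA4 (\<lambda>b. \<pi> (b [^]\<^bsub>P_A4\<^esub> c (\<pi> b))) basis_P"
      by (rule hom_finprod[OF BP.comm_group_axioms comm_group_ZA4 \<pi>hom]) auto
    also have "\<dots> = finprod ZA4 (\<lambda>b. of_int (c (\<pi> b)) *\<^sub>R \<pi> b) basis_P"
      by (rule ZA.finprod_cong')
        (auto simp: hom_int_pow[OF \<pi>hom] int_pow_ZA4[OF \<pi>b] carrier_ZA4 intvec_scale[OF _ \<pi>b] BP.group_axioms ZA.group_axioms)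
    also have "\<dots> = (\<Sum>b\<in>basis_P. of_int (c (\<pi> b)) *\<^sub>R \<pi> b)"
      by (rule finprod_ZA4) (auto intro!: intvec_scale \<pi>b)
    also have "\<dots> = (\<Sum>w\<in>rayvecs. of_int (c w) *\<^sub>R w)"
      unfolding image[symmetric] by (simp add: sum.reindex[OF inj])
    finally have "\<pi> ?p = x" using c by simp
    moreover have "act P_A4 g ?p = ?p" if g: "g \<in> carrier Aut_A4" "act ZA4 g x = x" for g
    proof -
      have gB: "act P_A4 g b \<in> basis_P" if "b \<in> basis_P" for b using act_B[OF g(1)] that by blast
      have "act P_A4 g ?p = finprod P_A4 (\<lambda>b. act P_A4 g (b [^]\<^bsub>P_A4\<^esub> c (\<pi> b))) basis_P"
        by (rule hom_finprod[OF BP.comm_group_axioms BP.comm_group_axioms PL.act_hom[OF g(1)]]) auto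
      also have "\<dots> = finprod P_A4 (\<lambda>b. act P_A4 g b [^]\<^bsub>P_A4\<^esub> c (\<pi> (act P_A4 g b))) basis_P"
      proof (rule BP.finprod_cong')
        fix b assume b: "b \<in> basis_P"
        have "c (\<pi> (act P_A4 g b)) = c (\<pi> b)"
          using \<pi>act[OF g(1) BP.basis_in[OF b]] c_inv[OF g(1)] g(2) by simp
        then show "act P_A4 g (b [^]\<^bsub>P_A4\<^esub> c (\<pi> b)) = act P_A4 g b [^]\<^bsub>P_A4\<^esub> c (\<pi> (act P_A4 g b))"
          using hom_int_pow[OF PL.act_hom[OF g(1)] BP.basis_in[OF b] BP.group_axioms BP.group_axioms] by simp
      qed (use gB BP.basis_in in auto)
      also have "\<dots> = finprod P_A4 (\<lambda>b. b [^]\<^bsub>P_A4\<^esub> c (\<pi> b)) (act P_A4 g ` basis_P)"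
        by (rule BP.finprod_reindex[symmetric])
          (use gB BP.basis_in in \<open>auto simp: inj_on_def PL.act_eq_iff[OF g(1)]\<close>)
      finally show ?thesis unfolding act_B[OF g(1)] .
    qed
    ultimately show "\<exists>p\<in>carrier P_A4. \<pi> p = x \<and> (\<forall>g\<in>carrier Aut_A4. act ZA4 g x = x \<longrightarrow> act P_A4 g p = p)"
      using p by blast
  qed (use lat is_G_lattice_ZA4 finite_Aut BP.basis act_B \<pi> in auto)
qed

theorem resolutions:
  "\<exists>\<pi>. \<pi> \<in> equivariant_hom Aut_A4 P_A4 ZA4 \<and>
     (\<forall>x\<in>Omega. \<forall>g\<in>carrier Aut_A4. \<pi> (coset_elem x g) = g x) \<and>
     (let F = P_A4\<lparr>carrier := kernel P_A4 ZA4 \<pi>\<rparr> in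
        coflasque_resolution Aut_A4 F (\<lambda>f. f) P_A4 \<pi> ZA4 \<and>
        flasque_resolution Aut_A4 Lambda_A4
          (\<lambda>l. \<lambda>p\<in>carrier P_A4. \<lfloor>inner l (\<pi> p)\<rfloor>)
          (dual_lattice Aut_A4 P_A4)
          (\<lambda>f. restrict f (carrier F))
          (dual_lattice Aut_A4 F))"
proof -
  obtain \<pi> where \<pi>: "\<pi> \<in> equivariant_hom Aut_A4 P_A4 ZA4"
    and coset_value: "\<And>iC. iC \<in> P.index \<Longrightarrow> \<pi> (P.bvec iC) = coset_value iC" using ex_projection by blast
  obtain A where "invariant_lifting Aut_A4 P_A4 ZA4 \<pi> A basis_P"
    using invariant_lifting_P[OF \<pi> coset_value] by blast
  then interpret invariant_lifting Aut_A4 P_A4 ZA4 \<pi> A basis_P .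
  have "\<pi> (coset_elem x g) = g x" if "x \<in> Omega" "g \<in> carrier Aut_A4" for x g
  proof -
    have "(x, g <#\<^bsub>Aut_A4\<^esub> Stab x) \<in> P.index" using that by (auto simp: P.index_def P.lcosets_eq)
    then show ?thesis using coset_value coset_value_coset[OF that(2)] by (simp add: coset_elem_eq)
  qed
  moreover have "flasque_resolution Aut_A4 Lambda_A4 (\<lambda>l. \<lambda>p\<in>carrier P_A4. \<lfloor>inner l (\<pi> p)\<rfloor>)
      (dual_lattice Aut_A4 P_A4) (\<lambda>f. restrict f (carrier F)) (dual_lattice Aut_A4 F)"
  proof (rule flasque_resolution_dual[OF is_G_lattice_Lambda pairing_equivariant pairing_bij])
    show "(\<lambda>p\<in>carrier P_A4. \<lfloor>inner l (\<pi> p)\<rfloor>) = (\<lambda>p\<in>carrier P_A4. pairing l (\<pi> p))" for l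
      by (rule restrict_ext) (simp add: pairing_def)
  qed
  ultimately show ?thesis
    unfolding Let_def using \<pi> coflasque_resolution_kernel by blast
qed


theorem corollary7p7:
  shows
    "card s_reps = 6 \<and> card v_reps = 3 \<and> s_reps \<inter> v_reps = {}
     \<and> (\<forall>x\<in>Omega. primitive_vector (carrier ZA4) x)
     \<and> bij_betw (\<lambda>x. orbit Aut_A4 (\<lambda>g \<rho>. g ` \<rho>) (Cone {x})) Omega
           (orbits Aut_A4 (rays fan_Y_A4) (\<lambda>g \<rho>. g ` \<rho>))
     \<and> (\<forall>r t. 1 \<le> r \<and> r < t \<and> r + t \<le> 5 \<longrightarrow>
           stab_group (srt r t) \<cong> sym_group r \<times>\<times> sym_group t \<times>\<times> sym_group (5 - (r + t)))
     \<and> (\<forall>r. 1 \<le> r \<and> r + r \<le> 5 \<longrightarrow>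
           stab_group (srt r r) \<cong>
             semidirect_product (sym_group r \<times>\<times> sym_group r) (sym_group 2) swap_action
               \<times>\<times> sym_group (5 - 2 * r))
     \<and> stab_group v1 \<cong> sym_group 3
     \<and> stab_group v2 \<cong> sym_group 2 \<times>\<times> sym_group 2
     \<and> stab_group v3 \<cong> sym_group 2
     \<and> (\<exists>\<pi>. \<pi> \<in> equivariant_hom Aut_A4 P_A4 ZA4 \<and>
           (\<forall>x\<in>Omega. \<forall>g\<in>carrier Aut_A4. \<pi> (coset_elem x g) = g x) \<and>
           (let F = P_A4\<lparr>carrier := kernel P_A4 ZA4 \<pi>\<rparr> in
              coflasque_resolution Aut_A4 F (\<lambda>f. f) P_A4 \<pi> ZA4 \<and>
              flasque_resolution Aut_A4 Lambda_A4
                (\<lambda>l. \<lambda>p\<in>carrier P_A4. \<lfloor>inner l (\<pi> p)\<rfloor>)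
                (dual_lattice Aut_A4 P_A4)
                (\<lambda>f. restrict f (carrier F))
                (dual_lattice Aut_A4 F)))"
proof (intro conjI)
  show "card s_reps = 6" "card v_reps = 3" "s_reps \<inter> v_reps = {}" by (fact card_reps)+
  show "\<forall>x\<in>Omega. primitive_vector (carrier ZA4) x" using primitive_Omega by blast
  show "\<forall>r t. 1 \<le> r \<and> r < t \<and> r + t \<le> 5 \<longrightarrow>
      stab_group (srt r t) \<cong> sym_group r \<times>\<times> sym_group t \<times>\<times> sym_group (5 - (r + t))"
    using stab_group_srt_less by blast
  show "\<forall>r. 1 \<le> r \<and> r + r \<le> 5 \<longrightarrow> stab_group (srt r r) \<cong>
      semidirect_product (sym_group r \<times>\<times> sym_group r) (sym_group 2) swap_action \<times>\<times> sym_group (5 - 2 * r)"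
    using stab_group_srt_eq by blast
qed (fact ray_orbits stab_group_v resolutions)+

end
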